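(* There is a natural one-to-one correspondence between conjugacy classes of $(\mathrm{P})$-closed actions on trees and isomorphism classes of local action diagrams. Explicitly: sending a pair $(T,G)$, where $T$ is a tree and $G\le \mathrm{Aut}(T)$ is $(\mathrm{P})$-closed, to its associated local action diagram $\Delta(T,G)$ induces a well-defined bijection from the set of conjugacy classes of such pairs to the set of isomorphism classes of local action diagrams.
   Context: Graphs. A graph $\Gamma$ has a vertex set $V\Gamma$, an arc set $A\Gamma$, an origin map $o:A\Gamma\to V\Gamma$ and a reversal map $a\mapsto\overline a$ on $A\Gamma$ with $\overline{\overline a}=a$; $t(a):=o(\overline a)$. An arc $a$ with $o(a)=t(a)$ is a loop; for a loop both $\overline a=a$ and $\overline a\ne a$ are allowed. $o^{-1}(v)$ is the set of arcs with origin $v$. Graph isomorphisms are bijective on vertices and arcs and respect $o$ and reversal. A graph is simple if it has no loops and $a\mapsto(o(a),t(a))$ is injective; a tree is a nonempty simple connected graph without cycles. For any set $X$, $\mathrm{Sym}(X)$ has the permutation topology (pointwise stabilisers of finite sets form a base of neighbourhoods of the identity); $\mathrm{Aut}(T)\le\mathrm{Sym}(VT)$ has the subspace topology. The quotient graph $G\backslash T$ has as vertices and arcs the $G$-orbits of vertices and arcs, with the induced origin and reversal maps. Property $(\mathrm{P})$. Let $G\le\mathrm{Aut}(T)$. For a nonempty (finite or infinite) simple path $L$ in $T$, let $\pi_L:VT\to VL$ be the closest point projection and $G_{(L)}$ the pointwise stabiliser of $L$; for $x\in VL$ let $\phi_x:G_{(L)}\to\mathrm{Sym}(\pi_L^{-1}(x))$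 be the restriction of the action. $G$ has property $(\mathrm{P})$ if for every $L$ the homomorphism $G_{(L)}\to\prod_{x\in VL}\phi_x(G_{(L)})$, $g\mapsto(\phi_x(g))_x$, is surjective. $G$ is $(\mathrm{P})$-closed if it is closed in $\mathrm{Aut}(T)$ and has property $(\mathrm{P})$. Conjugacy. $(T,G)$ and $(T',G')$ are conjugate if there is a graph isomorphism $\theta:T\to T'$ with $\theta G\theta^{-1}=G'$. Local action diagrams. A local action diagram $\Delta=(\Gamma,(X_a),(G(v)))$ consists of a connected graph $\Gamma$; for each $a\in A\Gamma$ a nonempty set $X_a$ (the colour set of $a$; colour sets of distinct arcs are disjoint); and for each $v\in V\Gamma$ a closed subgroup $G(v)\le\mathrm{Sym}(X_v)$, where $X_v=\bigsqcup_{a\in o^{-1}(v)}X_a$, whose orbits on $X_v$ are exactly the sets $X_a$, $a\in o^{-1}(v)$. An isomorphism from $(\Gamma,(X_a),(G(v)))$ to $(\Gamma',(X'_a),(G'(v)))$ is a graph isomorphism $\theta:\Gamma\to\Gamma'$ together with bijections $\theta_v:X_v\to X'_{\theta(v)}$ for $v\in V\Gamma$, restricting to bijections $X_a\to X'_{\theta(a)}$ for $a\in o^{-1}(v)$, with $\theta_vG(v)\theta_v^{-1}=G'(\theta(v))$. Associated local action diagram $\Delta(T,G)$. Put $\Gamma=G\backslash T$ with quotient map $\pi$. For each $v\in V\Gamma$ choose $v^*\in\pi^{-1}(v)$. For $a\in o^{-1}(v)$ let $X_a=\{b\in o^{-1}(v^* ):\pi(b)=a\}$, so $X_v=o^{-1}(v^*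 )$, and let $G(v)$ be the closure in $\mathrm{Sym}(X_v)$ of the permutation group induced by the stabiliser $G_{v^*}$ on $X_v$. *)

theory Defs
  imports "HOL-Analysis.Abstract_Topology" "HOL-Algebra.Group_Action"
begin

section \<open>Graphs\<close>

record ('v, 'e) graph =
  verts :: "'v set"
  arcs :: "'e set"
  orig :: "'e \<Rightarrow> 'v"
  reversal :: "'e \<Rightarrow> 'e"

definition terminus :: "('v, 'e) graph \<Rightarrow> 'e \<Rightarrow> 'v" where
  "terminus \<Gamma> a = orig \<Gamma> (reversal \<Gamma> a)"

definition arcs_from :: "('v, 'e) graph \<Rightarrow> 'v \<Rightarrow> 'e set" where
  "arcs_from \<Gamma> v = {a \<in> arcs \<Gamma>. orig \<Gamma> a = v}"

text \<open>An arc with \<open>reversal \<Gamma> a = a\<close> is allowed; it is automatically a loop.\<close>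

definition wf_graph :: "('v, 'e) graph \<Rightarrow> bool" where
  "wf_graph \<Gamma> \<longleftrightarrow>
     (\<forall>a\<in>arcs \<Gamma>. orig \<Gamma> a \<in> verts \<Gamma> \<and> reversal \<Gamma> a \<in> arcs \<Gamma> \<and>
        reversal \<Gamma> (reversal \<Gamma> a) = a)"

definition graph_iso ::
  "('v, 'e) graph \<Rightarrow> ('w, 'f) graph \<Rightarrow> ('v \<Rightarrow> 'w) \<Rightarrow> ('e \<Rightarrow> 'f) \<Rightarrow> bool" where
  "graph_iso \<Gamma> \<Gamma>' \<theta> \<theta>A \<longleftrightarrow>
     bij_betw \<theta> (verts \<Gamma>) (verts \<Gamma>') \<and> bij_betw \<theta>A (arcs \<Gamma>) (arcs \<Gamma>') \<and>
     (\<forall>a\<in>arcs \<Gamma>. orig \<Gamma>' (\<theta>A a) = \<theta> (orig \<Gamma> a) \<and>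
        reversal \<Gamma>' (\<theta>A a) = \<theta>A (reversal \<Gamma> a))"

definition adjacency :: "('v, 'e) graph \<Rightarrow> ('v \<times> 'v) set" where
  "adjacency \<Gamma> = {(orig \<Gamma> a, terminus \<Gamma> a) | a. a \<in> arcs \<Gamma>}"

text \<open>Connected graphs are taken to be nonempty.\<close>

definition connected_graph :: "('v, 'e) graph \<Rightarrow> bool" where
  "connected_graph \<Gamma> \<longleftrightarrow>
     verts \<Gamma> \<noteq> {} \<and> (\<forall>u\<in>verts \<Gamma>. \<forall>v\<in>verts \<Gamma>. (u, v) \<in> (adjacency \<Gamma>)\<^sup>*)"

definition simple_graph :: "('v, 'e) graph \<Rightarrow> bool" where
  "simple_graph \<Gamma> \<longleftrightarrow>
     (\<forall>a\<in>arcs \<Gamma>. orig \<Gamma> a \<noteq> terminus \<Gamma> a) \<and>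
     inj_on (\<lambda>a. (orig \<Gamma> a, terminus \<Gamma> a)) (arcs \<Gamma>)"

text \<open>Cycles are only used in simple graphs, where a cycle is given by its cyclic vertex sequence.\<close>

definition is_cycle :: "('v, 'e) graph \<Rightarrow> 'v list \<Rightarrow> bool" where
  "is_cycle \<Gamma> vs \<longleftrightarrow>
     length vs \<ge> 3 \<and> distinct vs \<and>
     (\<forall>i<length vs. (vs ! i, vs ! (Suc i mod length vs)) \<in> adjacency \<Gamma>)"

definition tree :: "('v, 'e) graph \<Rightarrow> bool" where
  "tree T \<longleftrightarrow> wf_graph T \<and> simple_graph T \<and> connected_graph T \<and> (\<nexists>vs. is_cycle T vs)"


section \<open>Permutation groups\<close>

text \<open>
  \<open>BijGroup X\<close> is the symmetric group of \<open>X\<close>; its elements are the bijections of \<open>X\<close>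
  that are \<open>undefined\<close> outside \<open>X\<close>.  Permutation groups are given by their carriers.
\<close>

abbreviation perm_group :: "'a set \<Rightarrow> ('a \<Rightarrow> 'a) set \<Rightarrow> ('a \<Rightarrow> 'a) monoid" where
  "perm_group X G \<equiv> (BijGroup X)\<lparr>carrier := G\<rparr>"

definition pointwise_stabiliser :: "('a \<Rightarrow> 'a) set \<Rightarrow> 'a set \<Rightarrow> ('a \<Rightarrow> 'a) set" where
  "pointwise_stabiliser G F = {g \<in> G. \<forall>x\<in>F. g x = x}"

text \<open>
  The group topology on the symmetric group of \<open>X\<close> in which the pointwise stabilisers of finite
  sets form a base of neighbourhoods of the identity: a set is open iff it contains, with each
  of its elements \<open>g\<close>, a coset \<open>g Sym(X)\<^sub>(\<^sub>F\<^sub>)\<close> with \<open>F\<close> finite.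
\<close>

definition perm_open :: "'a set \<Rightarrow> ('a \<Rightarrow> 'a) set \<Rightarrow> bool" where
  "perm_open X U \<longleftrightarrow>
     U \<subseteq> carrier (BijGroup X) \<and>
     (\<forall>g\<in>U. \<exists>F. finite F \<and> F \<subseteq> X \<and>
        g <#\<^bsub>BijGroup X\<^esub> pointwise_stabiliser (carrier (BijGroup X)) F \<subseteq> U)"

definition perm_topology :: "'a set \<Rightarrow> ('a \<Rightarrow> 'a) topology" where
  "perm_topology X = topology (perm_open X)"

lemma istopology_perm_open: "istopology (perm_open X)"
  unfolding istopology_def
proof (intro conjI allI impI)
  fix S T assume S: "perm_open X S" and T: "perm_open X T"
  show "perm_open X (S \<inter> T)"
    unfolding perm_open_def
  proof (intro conjI ballI)
    show "S \<inter> T \<subseteq> carrier (BijGroup X)"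
      using S by (auto simp: perm_open_def)
    fix g assume g: "g \<in> S \<inter> T"
    let ?st = "pointwise_stabiliser (carrier (BijGroup X))"
    from g S obtain F where F: "finite F" "F \<subseteq> X" "g <#\<^bsub>BijGroup X\<^esub> ?st F \<subseteq> S"
      unfolding perm_open_def by blast
    from g T obtain E where E: "finite E" "E \<subseteq> X" "g <#\<^bsub>BijGroup X\<^esub> ?st E \<subseteq> T"
      unfolding perm_open_def by blast
    have "g <#\<^bsub>BijGroup X\<^esub> ?st (F \<union> E) \<subseteq> S \<inter> T"
      using F(3) E(3) unfolding l_coset_def pointwise_stabiliser_def by blast
    then show "\<exists>F. finite F \<and> F \<subseteq> X \<and> g <#\<^bsub>BijGroup X\<^esub> ?st F \<subseteq> S \<inter> T"
      using F(1,2) E(1,2) by (intro exI[of _ "F \<union> E"]) auto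
  qed
next
  fix \<K> assume K: "\<forall>K\<in>\<K>. perm_open X K"
  show "perm_open X (\<Union>\<K>)"
    unfolding perm_open_def
  proof (intro conjI ballI)
    show "\<Union>\<K> \<subseteq> carrier (BijGroup X)"
      using K by (auto simp: perm_open_def)
    fix g assume "g \<in> \<Union>\<K>"
    then obtain U where U: "U \<in> \<K>" "g \<in> U" by blast
    with K have "perm_open X U" by blast
    with U(2) obtain F where "finite F" "F \<subseteq> X"
        "g <#\<^bsub>BijGroup X\<^esub> pointwise_stabiliser (carrier (BijGroup X)) F \<subseteq> U"
      unfolding perm_open_def by blast
    with U(1) show "\<exists>F. finite F \<and> F \<subseteq> X \<and>
        g <#\<^bsub>BijGroup X\<^esub> pointwise_stabiliser (carrier (BijGroup X)) F \<subseteq> \<Union>\<K>"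
      by blast
  qed
qed

lemma openin_perm_topology: "openin (perm_topology X) U \<longleftrightarrow> perm_open X U"
  unfolding perm_topology_def by (simp add: istopology_perm_open topology_inverse')

lemma topspace_perm_topology: "topspace (perm_topology X) = carrier (BijGroup X)"
proof -
  have "perm_open X (carrier (BijGroup X))"
    unfolding perm_open_def
  proof (intro conjI ballI subset_refl)
    fix g assume g: "g \<in> carrier (BijGroup X)"
    interpret group "BijGroup X" by (rule group_BijGroup)
    have "g <#\<^bsub>BijGroup X\<^esub> pointwise_stabiliser (carrier (BijGroup X)) {}
            \<subseteq> carrier (BijGroup X)"
      using g by (intro l_coset_subset_G) (auto simp: pointwise_stabiliser_def)
    then show "\<exists>F. finite F \<and> F \<subseteq> X \<and>
        g <#\<^bsub>BijGroup X\<^esub> pointwise_stabiliser (carrier (BijGroup X)) F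
          \<subseteq> carrier (BijGroup X)"
      by blast
  qed
  then show ?thesis
    unfolding topspace_def openin_perm_topology by (auto simp: perm_open_def)
qed

text \<open>Conjugation \<open>g \<mapsto> \<theta> g \<theta>\<^sup>-\<^sup>1\<close> by a bijection \<open>\<theta>\<close> from \<open>X\<close> to \<open>Y\<close>.\<close>

definition conjugate_by :: "'a set \<Rightarrow> 'b set \<Rightarrow> ('a \<Rightarrow> 'b) \<Rightarrow> ('a \<Rightarrow> 'a) \<Rightarrow> 'b \<Rightarrow> 'b" where
  "conjugate_by X Y \<theta> g = restrict (\<theta> \<circ> g \<circ> inv_into X \<theta>) Y"


section \<open>Group actions on trees and property (P)\<close>

text \<open>
  Automorphisms of a tree are identified with their vertex permutations.  In a simple graph the
  permutation of the arcs is determined by the one of the vertices; it is \<open>arc_map\<close>.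
\<close>

definition tree_Aut :: "('v, 'e) graph \<Rightarrow> ('v \<Rightarrow> 'v) set" where
  "tree_Aut T = {g \<in> carrier (BijGroup (verts T)). \<exists>h. graph_iso T T g h}"

definition arc_map :: "('v, 'e) graph \<Rightarrow> ('v \<Rightarrow> 'v) \<Rightarrow> 'e \<Rightarrow> 'e" where
  "arc_map T g = (\<lambda>a\<in>arcs T. THE b. b \<in> arcs T \<and>
     orig T b = g (orig T a) \<and> terminus T b = g (terminus T a))"

text \<open>
  The vertex set of a nonempty simple path: finite (possibly a single vertex), infinite in one
  direction, or infinite in both directions, according to the interval \<open>I\<close> of integers.
\<close>

definition path_verts :: "('v, 'e) graph \<Rightarrow> 'v set \<Rightarrow> bool" where
  "path_verts T L \<longleftrightarrow>
     (\<exists>(I :: int set) f. I \<noteq> {} \<and> (\<forall>i\<in>I. \<forall>j\<in>I. {i..j} \<subseteq> I) \<and>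
        inj_on f I \<and> L = f ` I \<and> L \<subseteq> verts T \<and>
        (\<forall>i\<in>I. i + 1 \<in> I \<longrightarrow> (f i, f (i + 1)) \<in> adjacency T))"

definition graph_dist :: "('v, 'e) graph \<Rightarrow> 'v \<Rightarrow> 'v \<Rightarrow> nat" where
  "graph_dist T u v = (LEAST n. (u, v) \<in> adjacency T ^^ n)"

definition closest_point :: "('v, 'e) graph \<Rightarrow> 'v set \<Rightarrow> 'v \<Rightarrow> 'v" where
  "closest_point T L v = (THE x. x \<in> L \<and> (\<forall>y\<in>L. graph_dist T v x \<le> graph_dist T v y))"

definition path_fibre :: "('v, 'e) graph \<Rightarrow> 'v set \<Rightarrow> 'v \<Rightarrow> 'v set" where
  "path_fibre T L x = {v \<in> verts T. closest_point T L v = x}"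

definition property_P :: "('v, 'e) graph \<Rightarrow> ('v \<Rightarrow> 'v) set \<Rightarrow> bool" where
  "property_P T G \<longleftrightarrow>
     (\<forall>L. path_verts T L \<longrightarrow>
        (let G\<^sub>L = pointwise_stabiliser G L; \<phi> = (\<lambda>x g. restrict g (path_fibre T L x))
         in (\<lambda>g. \<lambda>x\<in>L. \<phi> x g) ` G\<^sub>L = (\<Pi>\<^sub>E x\<in>L. \<phi> x ` G\<^sub>L)))"

definition P_closed :: "('v, 'e) graph \<Rightarrow> ('v \<Rightarrow> 'v) set \<Rightarrow> bool" where
  "P_closed T G \<longleftrightarrow>
     closedin (subtopology (perm_topology (verts T)) (tree_Aut T)) G \<and> property_P T G"

definition P_closed_actions :: "(('v, 'e) graph \<times> ('v \<Rightarrow> 'v) set) set" where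
  "P_closed_actions =
     {(T, G). tree T \<and> subgroup G (BijGroup (verts T)) \<and> G \<subseteq> tree_Aut T \<and> P_closed T G}"

definition conjugate_actions ::
  "('v, 'e) graph \<times> ('v \<Rightarrow> 'v) set \<Rightarrow> ('w, 'f) graph \<times> ('w \<Rightarrow> 'w) set \<Rightarrow> bool" where
  "conjugate_actions = (\<lambda>(T, G) (T', G').
     \<exists>\<theta> \<theta>A. graph_iso T T' \<theta> \<theta>A \<and> conjugate_by (verts T) (verts T') \<theta> ` G = G')"

definition conjugacy ::
  "((('v, 'e) graph \<times> ('v \<Rightarrow> 'v) set) \<times> (('v, 'e) graph \<times> ('v \<Rightarrow> 'v) set)) set" where
  "conjugacy =
     {(p, q). p \<in> P_closed_actions \<and> q \<in> P_closed_actions \<and> conjugate_actions p q}"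


section \<open>Local action diagrams\<close>

record ('v, 'e, 'c) lad =
  lad_graph :: "('v, 'e) graph"
  colours :: "'e \<Rightarrow> 'c set"
  local_group :: "'v \<Rightarrow> ('c \<Rightarrow> 'c) set"

definition colours_at :: "('v, 'e, 'c) lad \<Rightarrow> 'v \<Rightarrow> 'c set" where
  "colours_at \<Delta> v = (\<Union>a\<in>arcs_from (lad_graph \<Delta>) v. colours \<Delta> a)"

definition local_action_diagrams :: "('v, 'e, 'c) lad set" where
  "local_action_diagrams = {\<Delta>.
     wf_graph (lad_graph \<Delta>) \<and> connected_graph (lad_graph \<Delta>) \<and>
     (\<forall>a\<in>arcs (lad_graph \<Delta>). colours \<Delta> a \<noteq> {}) \<and>
     (\<forall>a\<in>arcs (lad_graph \<Delta>). \<forall>b\<in>arcs (lad_graph \<Delta>).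
        a \<noteq> b \<longrightarrow> colours \<Delta> a \<inter> colours \<Delta> b = {}) \<and>
     (\<forall>v\<in>verts (lad_graph \<Delta>).
        subgroup (local_group \<Delta> v) (BijGroup (colours_at \<Delta> v)) \<and>
        closedin (perm_topology (colours_at \<Delta> v)) (local_group \<Delta> v) \<and>
        orbits (perm_group (colours_at \<Delta> v) (local_group \<Delta> v)) (colours_at \<Delta> v) (\<lambda>g. g) =
          colours \<Delta> ` arcs_from (lad_graph \<Delta>) v)}"

definition isomorphic_lads :: "('v, 'e, 'c) lad \<Rightarrow> ('w, 'f, 'd) lad \<Rightarrow> bool" where
  "isomorphic_lads \<Delta> \<Delta>' \<longleftrightarrow>
     (\<exists>\<theta> \<theta>A. graph_iso (lad_graph \<Delta>) (lad_graph \<Delta>') \<theta> \<theta>A \<and>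
       (\<exists>\<theta>X :: 'v \<Rightarrow> 'c \<Rightarrow> 'd. \<forall>v\<in>verts (lad_graph \<Delta>).
          bij_betw (\<theta>X v) (colours_at \<Delta> v) (colours_at \<Delta>' (\<theta> v)) \<and>
          (\<forall>a\<in>arcs_from (lad_graph \<Delta>) v.
             bij_betw (\<theta>X v) (colours \<Delta> a) (colours \<Delta>' (\<theta>A a))) \<and>
          conjugate_by (colours_at \<Delta> v) (colours_at \<Delta>' (\<theta> v)) (\<theta>X v) ` local_group \<Delta> v =
            local_group \<Delta>' (\<theta> v)))"

definition lad_isomorphism :: "(('v, 'e, 'c) lad \<times> ('v, 'e, 'c) lad) set" where
  "lad_isomorphism = {(\<Delta>, \<Delta>').
     \<Delta> \<in> local_action_diagrams \<and> \<Delta>' \<in> local_action_diagrams \<and> isomorphic_lads \<Delta> \<Delta>'}"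


section \<open>The associated local action diagram\<close>

definition vertex_orbit :: "('v, 'e) graph \<Rightarrow> ('v \<Rightarrow> 'v) set \<Rightarrow> 'v \<Rightarrow> 'v set" where
  "vertex_orbit T G v = orbit (perm_group (verts T) G) (\<lambda>g. g) v"

definition arc_orbit :: "('v, 'e) graph \<Rightarrow> ('v \<Rightarrow> 'v) set \<Rightarrow> 'e \<Rightarrow> 'e set" where
  "arc_orbit T G a = orbit (perm_group (verts T) G) (arc_map T) a"

text \<open>
  The origin of the orbit of \<open>a\<close> is the orbit of \<open>orig T a\<close>, that is the set of origins of the
  arcs in the orbit of \<open>a\<close>; similarly for reversal.
\<close>

definition quotient_graph :: "('v, 'e) graph \<Rightarrow> ('v \<Rightarrow> 'v) set \<Rightarrow> ('v set, 'e set) graph" where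
  "quotient_graph T G =
     \<lparr>verts = vertex_orbit T G ` verts T,
      arcs = arc_orbit T G ` arcs T,
      orig = (\<lambda>A. orig T ` A),
      reversal = (\<lambda>A. reversal T ` A)\<rparr>"

definition orbit_representatives ::
  "('v, 'e) graph \<Rightarrow> ('v \<Rightarrow> 'v) set \<Rightarrow> ('v set \<Rightarrow> 'v) \<Rightarrow> bool" where
  "orbit_representatives T G r \<longleftrightarrow>
     (\<forall>v\<in>verts (quotient_graph T G). r v \<in> verts T \<and> vertex_orbit T G (r v) = v)"

definition associated_lad ::
  "('v, 'e) graph \<Rightarrow> ('v \<Rightarrow> 'v) set \<Rightarrow> ('v set \<Rightarrow> 'v) \<Rightarrow> ('v set, 'e set, 'e) lad" where
  "associated_lad T G r =
     \<lparr>lad_graph = quotient_graph T G,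
      colours = (\<lambda>a. {b \<in> arcs_from T (r (orig (quotient_graph T G) a)). arc_orbit T G b = a}),
      local_group = (\<lambda>v. perm_topology (arcs_from T (r v)) closure_of
         ((\<lambda>g. restrict (arc_map T g) (arcs_from T (r v))) `
            stabilizer (perm_group (verts T) G) (\<lambda>g. g) (r v)))\<rparr>"

end

theory Submission
  imports Defs
begin

text \<open>
  Given a local action diagram \<open>\<Delta>\<close>, label the arcs of a tree \<open>T\<close> over the graph of \<open>\<Delta>\<close> so that the
  arcs at each vertex over \<open>v\<close> carry each colour in \<open>X\<^sub>v\<close> exactly once.  Such a labelled tree exists,
  and a partial isomorphism of labelled trees with local actions in the groups \<open>G(v)\<close> extends
  from one star to the whole tree, because the orbits of \<open>G(v)\<close> are the colour sets.  Hence the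
  labelled tree is unique, and its universal group \<open>U\<close> of all automorphisms with local actions in
  the \<open>G(v)\<close> has \<open>\<Delta>\<close> as its quotient data.  The group \<open>U\<close> is (P)-closed: it is defined by conditions
  on stars that are closed.  Conversely, property (P) for single edges shows that a (P)-closed
  group contains every automorphism that agrees on each finite part of each star with one of its
  elements, so that it is the universal group of its associated diagram.  The correspondence is
  therefore the relation ``\<open>G\<close> is the universal group of \<open>\<Delta>\<close> on \<open>T\<close>''.
\<close>

section \<open>Rooted trees\<close>

text \<open>Acyclicity gives no direct induction or recursion, so arguments on a tree run along a
  parent function towards a root, and the root is chosen to suit the argument: on the path when
  projecting to it, at the vertex with the prescribed local action when extending one. Bijectivity
  of a map built or glued piece by piece is checked on stars only. A map between trees that is
  bijective on every star is an isomorphism, because a tree has no proper connected covering. The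
  associated diagram depends on the chosen orbit representatives. Different choices are never
  compared with each other; instead, any two diagrams realised by the same action are isomorphic,
  and the map on classes is the image under the realisation relation, which involves no choice.
  Vertices, arcs and colours live in one infinite type. This is large enough for the converse
  construction because the tree of a diagram is made of finite lists of colours, whatever its graph
  is.\<close>

lemma adjacencyI: "a \<in> arcs T \<Longrightarrow> (orig T a, terminus T a) \<in> adjacency T"
  by (auto simp: adjacency_def)

lemma adjacencyE:
  assumes "(x, y) \<in> adjacency T"
  obtains a where "a \<in> arcs T" "orig T a = x" "terminus T a = y"
  using assms by (auto simp: adjacency_def)

lemma wf_graphD:
  assumes "wf_graph T" "a \<in> arcs T"
  shows "orig T a \<in> verts T" "terminus T a \<in> verts T" "reversal T a \<in> arcs T"
    "reversal T (reversal T a) = a" "orig T (reversal T a) = terminus T a"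
    "terminus T (reversal T a) = orig T a"
  using assms by (auto simp: wf_graph_def terminus_def)

lemma adjacency_sym: "wf_graph T \<Longrightarrow> (x, y) \<in> adjacency T \<Longrightarrow> (y, x) \<in> adjacency T"
  using adjacencyI[OF wf_graphD(3)] by (force elim!: adjacencyE simp: wf_graphD)

lemma adjacency_verts:
  "wf_graph T \<Longrightarrow> (x, y) \<in> adjacency T \<Longrightarrow> x \<in> verts T \<and> y \<in> verts T"
  by (auto elim!: adjacencyE simp: wf_graphD)

lemma simple_graph_arc_eq:
  assumes "simple_graph T" "a \<in> arcs T" "b \<in> arcs T" "orig T a = orig T b" "terminus T a = terminus T b"
  shows "a = b"
  using assms unfolding simple_graph_def inj_on_def by blast

lemma simple_graph_irrefl: "simple_graph T \<Longrightarrow> (x, x) \<notin> adjacency T"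
  by (auto simp: simple_graph_def adjacency_def)

text \<open>Here \<open>par\<close> sends a vertex to its neighbour nearest to the base; its value at the base itself is junk.\<close>

locale rooted_tree =
  fixes T :: "('v, 'e) graph" and base :: 'v and level :: "'v \<Rightarrow> nat" and par :: "'v \<Rightarrow> 'v"
  assumes wf: "wf_graph T" and simple: "simple_graph T"
    and base_in: "base \<in> verts T"
    and level_base: "level base = 0"
    and par_base: "par base = base"
    and adj_par: "v \<in> verts T \<Longrightarrow> v \<noteq> base \<Longrightarrow> (par v, v) \<in> adjacency T"
    and level_par: "v \<in> verts T \<Longrightarrow> v \<noteq> base \<Longrightarrow> level v = Suc (level (par v))"
    and adj_cases: "(x, y) \<in> adjacency T \<Longrightarrow> x \<noteq> base \<and> y = par x \<or> y \<noteq> base \<and> x = par y"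
begin

lemma par_in: "v \<in> verts T \<Longrightarrow> par v \<in> verts T"
  using adj_par[of v] adjacency_verts[OF wf] par_base by (cases "v = base") auto

lemma rooted_induct [consumes 1, case_names base par]:
  assumes "v \<in> verts T" and "P base"
    and "\<And>v. v \<in> verts T \<Longrightarrow> v \<noteq> base \<Longrightarrow> P (par v) \<Longrightarrow> P v"
  shows "P v"
  using assms(1)
proof (induction "level v" arbitrary: v rule: less_induct)
  case less
  show ?case
  proof (cases "v = base")
    case False
    then show ?thesis
      using less.hyps[OF _ par_in[OF less.prems]] assms(3)[OF less.prems] level_par[OF less.prems] by simp
  qed (simp add: assms(2))
qed

lemma base_reachable: "v \<in> verts T \<Longrightarrow> (base, v) \<in> (adjacency T)\<^sup>*"
  by (induction rule: rooted_induct) (auto intro: rtrancl.rtrancl_into_rtrancl adj_par)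

text \<open>On a cycle, a vertex of maximal level would have both its neighbours equal to its
  parent.\<close>

lemma is_tree: "tree T"
proof -
  have "sym (adjacency T)"
    using adjacency_sym[OF wf] by (auto intro: symI)
  then have "(u, v) \<in> (adjacency T)\<^sup>*" if "u \<in> verts T" "v \<in> verts T" for u v
    using base_reachable that sym_rtrancl[of "adjacency T"] by (meson rtrancl_trans symD)
  moreover have False if cyc: "is_cycle T vs" for vs
  proof -
    let ?n = "length vs"
    have n: "?n \<ge> 3" and dist: "distinct vs"
      and step: "\<And>i. i < ?n \<Longrightarrow> (vs ! i, vs ! (Suc i mod ?n)) \<in> adjacency T"
      using cyc by (auto simp: is_cycle_def)
    define m where "m = Max (level ` set vs)"
    have "m \<in> level ` set vs" unfolding m_def using n by (intro Max_in) (auto simp: Suc_le_eq)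
    then obtain i where i: "i < ?n" "level (vs ! i) = m"
      by (auto simp: in_set_conv_nth)
    have max: "level (vs ! k) \<le> m" if "k < ?n" for k
      unfolding m_def by (rule Max_ge) (use that in auto)
    have up: "y = par x" if "(x, y) \<in> adjacency T" "level y \<le> level x" for x y
    proof -
      have "x \<in> verts T" "y \<in> verts T" using adjacency_verts[OF wf that(1)] by auto
      then show ?thesis using adj_cases[OF that(1)] level_par that(2) by force
    qed
    define j where "j = Suc i mod ?n"
    define k where "k = (if i = 0 then ?n - 1 else i - 1)"
    have j: "j < ?n" using n unfolding j_def by (intro mod_less_divisor) linarith
    have k: "k < ?n" using n i unfolding k_def by presburger
    \<comment> \<open>The predecessor and the successor of position \<open>i\<close> differ because
      a cycle has at least three vertices.\<close>
    have kj: "k \<noteq> j"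
      using n i by (cases "Suc i = ?n") (auto simp: k_def j_def split: if_splits)
    have ki: "Suc k mod ?n = i" using n i by (auto simp: k_def)
    have "vs ! j = par (vs ! i)"
      using up[OF step[OF i(1)]] max[OF j] i(2) by (simp add: j_def)
    moreover have "vs ! k = par (vs ! i)"
      using up[OF adjacency_sym[OF wf step[OF k]]] max[OF k] i(2) by (simp add: ki)
    ultimately have "vs ! j = vs ! k" by simp
    then show False using dist kj j k nth_eq_iff_index_eq by blast
  qed
  ultimately show ?thesis
    unfolding tree_def connected_graph_def using wf simple base_in by auto
qed

end

text \<open>A shortest walk from \<open>u\<close> to \<open>v\<close> that avoids the edge repeats
  no vertex, and the edge closes it up to a cycle.\<close>

lemma tree_bridge:
  assumes T: "tree T" and uv: "(u, v) \<in> adjacency T"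
  shows "(u, v) \<notin> (adjacency T - {(u, v), (v, u)})\<^sup>*"
proof
  let ?E = "adjacency T - {(u, v), (v, u)}"
  have wf: "wf_graph T" and simple: "simple_graph T" and acyc: "\<not> is_cycle T vs" for vs
    using T by (auto simp: tree_def)
  assume "(u, v) \<in> ?E\<^sup>*"
  then have ex: "\<exists>n. (u, v) \<in> ?E ^^ n" by (simp add: rtrancl_power)
  define n where "n = (LEAST n. (u, v) \<in> ?E ^^ n)"
  have n: "(u, v) \<in> ?E ^^ n" unfolding n_def using ex by (rule LeastI_ex)
  have least: "n \<le> m" if "(u, v) \<in> ?E ^^ m" for m unfolding n_def using that by (rule Least_le)
  obtain f where f: "f 0 = u" "f n = v" "\<And>i. i < n \<Longrightarrow> (f i, f (Suc i)) \<in> ?E"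
    using n by (auto simp: relpow_fun_conv)
  have seg: "(f i, f (i + k)) \<in> ?E ^^ k" if "i + k \<le> n" for i k
    using that
  proof (induction k)
    case (Suc k)
    then have "(f i, f (i + k)) \<in> ?E ^^ k" "(f (i + k), f (Suc (i + k))) \<in> ?E"
      using f(3)[of "i + k"] by simp_all
    then show ?case by (simp only: relpow.simps add_Suc_right) (rule relcompI)
  qed simp
  have inj: "f i \<noteq> f j" if "i < j" "j \<le> n" for i j
  proof
    assume eq: "f i = f j"
    have "(f 0, f i) \<in> ?E ^^ i" "(f j, f n) \<in> ?E ^^ (n - j)"
      using seg[of 0 i] seg[of j "n - j"] that by auto
    then have "(u, v) \<in> ?E ^^ (i + (n - j))"
      using eq f(1,2) by (auto simp: relpow_add)
    then show False using least that by fastforce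
  qed
  have "u \<noteq> v" using uv simple_graph_irrefl[OF simple] by auto
  \<comment> \<open>Length 0 would give \<open>u = v\<close>, and length 1 would be the removed
    edge; hence the cycle below has at least three vertices.\<close>
  then have n2: "n \<ge> 2"
    using f by (metis (no_types, lifting) DiffE One_nat_def Suc_1 Suc_leI bot_nat_0.not_eq_extremum insertI1 le_antisym lessI not_less)
  let ?vs = "map f [0..<Suc n]"
  have "is_cycle T ?vs"
    unfolding is_cycle_def
  proof (intro conjI allI impI)
    show "3 \<le> length ?vs" using n2 by simp
    show "distinct ?vs"
      unfolding distinct_map
      by (auto intro!: inj_onI simp del: upt_Suc) (metis inj less_Suc_eq_le linorder_neqE_nat)
    fix i assume i: "i < length ?vs"
    show "(?vs ! i, ?vs ! (Suc i mod length ?vs)) \<in> adjacency T"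
    proof (cases "i = n")
      case True
      then show ?thesis using f(1,2) adjacency_sym[OF wf uv] by (simp del: upt_Suc)
    next
      case False
      with i have "i < n" by simp
      then show ?thesis using f(3)[of i] by (simp del: upt_Suc)
    qed
  qed
  then show False using acyc by blast
qed

text \<open>The level is the distance from \<open>base\<close>, and \<open>par v\<close> is some
  neighbour that is closer by one. The condition \<open>adj_cases\<close>, that there are no other
  edges, is where acyclicity enters, in the form that every edge is a bridge.\<close>

lemma tree_rooted:
  assumes T: "tree T" and base: "base \<in> verts T"
  shows "\<exists>level par. rooted_tree T base level par"
proof -
  have wf: "wf_graph T" and simple: "simple_graph T" and conn: "connected_graph T"
    using T by (auto simp: tree_def)
  let ?A = "adjacency T"
  define d where "d = graph_dist T base"
  have ex: "\<exists>n. (base, v) \<in> ?A ^^ n" if "v \<in> verts T" for v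
    using conn base that unfolding connected_graph_def by (auto simp: rtrancl_power)
  have d: "(base, v) \<in> ?A ^^ d v" if "v \<in> verts T" for v
    unfolding d_def graph_dist_def by (rule LeastI_ex) (use ex that in blast)
  have d_le: "d v \<le> n" if "(base, v) \<in> ?A ^^ n" for v n
    unfolding d_def graph_dist_def using that by (rule Least_le)
  have d0: "d base = 0" using d_le[of base 0] by simp
  have step: "d y \<le> Suc (d x)" if "(x, y) \<in> ?A" for x y
    by (rule d_le) (use d adjacency_verts[OF wf that] that in auto)
  have pex: "\<exists>p. (p, v) \<in> ?A \<and> d v = Suc (d p)" if "v \<in> verts T" "v \<noteq> base" for v
  proof (cases "d v")
    case 0
    then show ?thesis using d[OF that(1)] that(2) by simp
  next
    case (Suc m)
    with d[OF that(1)] obtain p where p: "(base, p) \<in> ?A ^^ m" "(p, v) \<in> ?A" by auto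
    then show ?thesis using d_le[OF p(1)] step[OF p(2)] Suc by (intro exI[of _ p]) auto
  qed
  define par where "par v = (if v = base then base else SOME p. (p, v) \<in> ?A \<and> d v = Suc (d p))" for v
  have par: "(par v, v) \<in> ?A \<and> d v = Suc (d (par v))" if "v \<in> verts T" "v \<noteq> base" for v
    unfolding par_def using that someI_ex[OF pex[OF that]] by simp
  \<comment> \<open>Edges leading away from \<open>base\<close> and ending within distance
    \<open>n\<close>. The bound shows that the geodesics used in \<open>up\<close> do not pass the
    edge between \<open>x\<close> and \<open>y\<close>.\<close>
  define R where "R n = {(a, b). (a, b) \<in> ?A \<and> d b = Suc (d a) \<and> d b \<le> n}" for n
  have R_mono: "(R m)\<^sup>* \<subseteq> (R n)\<^sup>*" if "m \<le> n" for m n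
    by (rule rtrancl_mono) (use that in \<open>auto simp: R_def\<close>)
  have chain: "(base, v) \<in> (R (d v))\<^sup>*" if "v \<in> verts T" for v
    using that
  proof (induction "d v" arbitrary: v rule: less_induct)
    case less
    show ?case
    proof (cases "v = base")
      case False
      note p = par[OF less.prems False]
      have "(base, par v) \<in> (R (d (par v)))\<^sup>*"
        using less.hyps[of "par v"] p adjacency_verts[OF wf] by auto
      then have "(base, par v) \<in> (R (d v))\<^sup>*" using R_mono p by (metis le_SucI order_refl subsetD)
      moreover have "(par v, v) \<in> R (d v)" using p by (auto simp: R_def)
      ultimately show ?thesis by (rule rtrancl_into_rtrancl)
    qed simp
  qed
  \<comment> \<open>If \<open>y\<close> were a second neighbour of \<open>x\<close> that is not
    farther from \<open>base\<close>, then \<open>x\<close> would reach \<open>y\<close> through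
    \<open>par x\<close> and \<open>base\<close> without the edge between them, which is a
    bridge.\<close>
  have up: "x \<noteq> base \<and> y = par x" if xy: "(x, y) \<in> ?A" and le: "d y \<le> d x" for x y
  proof -
    have V: "x \<in> verts T" "y \<in> verts T" using adjacency_verts[OF wf xy] by auto
    have xne: "x \<noteq> y" using xy simple_graph_irrefl[OF simple] by auto
    have xr: "x \<noteq> base"
      using d0 le par[OF V(2)] xne by auto
    note p = par[OF V(1) xr]
    let ?E = "?A - {(x, y), (y, x)}"
    have symE: "sym ?E" using adjacency_sym[OF wf] by (auto intro: symI)
    have "R (d y) \<subseteq> ?E" "R (d (par x)) \<subseteq> ?E"
      using le p by (auto simp: R_def)
    then have "(base, y) \<in> ?E\<^sup>*" "(base, par x) \<in> ?E\<^sup>*"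
      using chain V p adjacency_verts[OF wf] by (meson rtrancl_mono subsetD)+
    then have *: "(par x, y) \<in> ?E\<^sup>*"
      using sym_rtrancl[OF symE] by (meson rtrancl_trans symD)
    have "y = par x"
    proof (rule ccontr)
      assume "y \<noteq> par x"
      moreover have "x \<noteq> par x" using p by auto
      ultimately have "(x, par x) \<in> ?E" using p adjacency_sym[OF wf] by auto
      with * have "(x, y) \<in> ?E\<^sup>*" by (rule converse_rtrancl_into_rtrancl[rotated])
      then show False using tree_bridge[OF T xy] by simp
    qed
    with xr show ?thesis by simp
  qed
  have "rooted_tree T base d par"
  proof
    show "x \<noteq> base \<and> y = par x \<or> y \<noteq> base \<and> x = par y" if "(x, y) \<in> ?A" for x y
      using up[OF that] up[OF adjacency_sym[OF wf that]] by (meson nle_le)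
  qed (use wf simple base d0 par in \<open>auto simp: par_def[of base]\<close>)
  then show ?thesis by blast
qed

section \<open>Graph isomorphisms\<close>

lemma graph_isoD:
  assumes "graph_iso T T' f h"
  shows "bij_betw f (verts T) (verts T')" "bij_betw h (arcs T) (arcs T')"
    "a \<in> arcs T \<Longrightarrow> orig T' (h a) = f (orig T a)"
    "a \<in> arcs T \<Longrightarrow> reversal T' (h a) = h (reversal T a)"
  using assms by (auto simp: graph_iso_def)

lemma graph_iso_in:
  assumes "graph_iso T T' f h"
  shows "v \<in> verts T \<Longrightarrow> f v \<in> verts T'" "a \<in> arcs T \<Longrightarrow> h a \<in> arcs T'"
  using graph_isoD(1,2)[OF assms] by (auto simp: bij_betw_def)

lemma graph_iso_terminus:
  "graph_iso T T' f h \<Longrightarrow> wf_graph T \<Longrightarrow> a \<in> arcs T \<Longrightarrow> terminus T' (h a) = f (terminus T a)"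
  by (simp add: terminus_def graph_iso_def wf_graph_def)

lemma graph_iso_id: "graph_iso T T id id"
  by (simp add: graph_iso_def)

lemma graph_iso_cong:
  assumes "graph_iso T T' f h" "wf_graph T"
    "\<And>v. v \<in> verts T \<Longrightarrow> f' v = f v" "\<And>a. a \<in> arcs T \<Longrightarrow> h' a = h a"
  shows "graph_iso T T' f' h'"
  using assms bij_betw_cong[of "verts T" f' f] bij_betw_cong[of "arcs T" h' h]
  by (auto simp: graph_iso_def wf_graph_def)

lemma graph_iso_comp:
  assumes "graph_iso T T' f h" "graph_iso T' T'' f' h'"
  shows "graph_iso T T'' (f' \<circ> f) (h' \<circ> h)"
  using assms graph_iso_in(2)[OF assms(1)] by (auto simp: graph_iso_def intro: bij_betw_trans)

lemma graph_iso_inv: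
  assumes "graph_iso T T' f h" "wf_graph T"
  shows "graph_iso T' T (inv_into (verts T) f) (inv_into (arcs T) h)"
proof -
  have f: "bij_betw f (verts T) (verts T')" and h: "bij_betw h (arcs T) (arcs T')"
    using assms by (auto simp: graph_iso_def)
  show ?thesis
    unfolding graph_iso_def
  proof (intro conjI ballI)
    fix b assume "b \<in> arcs T'"
    then obtain a where a: "a \<in> arcs T" "b = h a" using h by (auto simp: bij_betw_def)
    then show "orig T (inv_into (arcs T) h b) = inv_into (verts T) f (orig T' b)"
      "reversal T (inv_into (arcs T) h b) = inv_into (arcs T) h (reversal T' b)"
      using assms f h by (auto simp: graph_iso_def bij_betw_def wf_graph_def)
  qed (use f h bij_betw_inv_into in auto)
qed

lemma wf_graph_iso:
  assumes "graph_iso T T' f h" "wf_graph T"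
  shows "wf_graph T'"
  unfolding wf_graph_def
proof
  fix b assume "b \<in> arcs T'"
  then obtain a where a: "a \<in> arcs T" "b = h a"
    using graph_isoD(2)[OF assms(1)] unfolding bij_betw_def by blast
  note wfa = wf_graphD(1,3,4)[OF assms(2) a(1)]
  show "orig T' b \<in> verts T' \<and> reversal T' b \<in> arcs T' \<and> reversal T' (reversal T' b) = b"
    unfolding a(2) graph_isoD(3,4)[OF assms(1) a(1)] graph_isoD(4)[OF assms(1) wfa(2)] wfa(3)
    using graph_iso_in[OF assms(1)] wfa by blast
qed

lemma graph_iso_adjacency:
  assumes "graph_iso T T' f h" "wf_graph T" "x \<in> verts T" "y \<in> verts T"
  shows "(f x, f y) \<in> adjacency T' \<longleftrightarrow> (x, y) \<in> adjacency T"
proof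
  assume "(x, y) \<in> adjacency T"
  then obtain a where a: "a \<in> arcs T" "orig T a = x" "terminus T a = y" by (rule adjacencyE)
  then show "(f x, f y) \<in> adjacency T'"
    using adjacencyI[OF graph_iso_in(2)[OF assms(1) a(1)]] graph_isoD(3)[OF assms(1) a(1)]
      graph_iso_terminus[OF assms(1,2) a(1)] by simp
next
  assume "(f x, f y) \<in> adjacency T'"
  then obtain b where b: "b \<in> arcs T'" "orig T' b = f x" "terminus T' b = f y" by (rule adjacencyE)
  then obtain a where a: "a \<in> arcs T" "b = h a"
    using graph_isoD(2)[OF assms(1)] unfolding bij_betw_def by blast
  then have "f (orig T a) = f x" "f (terminus T a) = f y"
    using b graph_isoD(3)[OF assms(1) a(1)] graph_iso_terminus[OF assms(1,2) a(1)] by auto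
  then have "orig T a = x" "terminus T a = y"
    using graph_isoD(1)[OF assms(1)] assms(3,4) wf_graphD(1,2)[OF assms(2) a(1)]
    by (meson bij_betw_imp_inj_on inj_onD)+
  then show "(x, y) \<in> adjacency T" using adjacencyI[OF a(1)] by simp
qed

text \<open>Cycles are not transported. Level and parent are moved along \<open>f\<close>, and
  \<open>rooted_tree.is_tree\<close> then yields acyclicity of \<open>T'\<close>.\<close>

lemma tree_iso:
  assumes iso: "graph_iso T T' f h" and T: "tree T"
  shows "tree T'"
proof -
  have wf: "wf_graph T" using T by (simp add: tree_def)
  obtain base where "base \<in> verts T" using T by (auto simp: tree_def connected_graph_def)
  then obtain level par where "rooted_tree T base level par" using tree_rooted[OF T] by blast
  then interpret rooted_tree T base level par .
  let ?g = "inv_into (verts T) f"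
  note bij = graph_isoD(1)[OF iso]
  have g: "?g (f v) = v" if "v \<in> verts T" for v
    using bij that by (simp add: bij_betw_def)
  have V': "verts T' = f ` verts T" using bij by (simp add: bij_betw_def)
  have A': "adjacency T' = (\<lambda>(x, y). (f x, f y)) ` adjacency T"
  proof -
    have "\<exists>x y. x' = f x \<and> y' = f y \<and> (x, y) \<in> adjacency T" if xy: "(x', y') \<in> adjacency T'" for x' y'
    proof -
      obtain x y where "x \<in> verts T" "y \<in> verts T" "x' = f x" "y' = f y"
        using adjacency_verts[OF wf_graph_iso[OF iso wf] xy] V' by blast
      then show ?thesis using graph_iso_adjacency[OF iso wf, of x y] xy by blast
    qed
    moreover have "(f x, f y) \<in> adjacency T'" if "(x, y) \<in> adjacency T" for x y
      using graph_iso_adjacency[OF iso wf, of x y] adjacency_verts[OF wf that] that by blast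
    ultimately show ?thesis by (auto simp: image_iff) (metis case_prod_conv)
  qed
  have simple': "simple_graph T'"
    unfolding simple_graph_def
  proof (intro conjI ballI)
    have "(x, x) \<notin> adjacency T'" for x
    proof
      assume "(x, x) \<in> adjacency T'"
      then obtain y z where yz: "f y = f z" "(y, z) \<in> adjacency T" using A' by auto
      then have "y = z" using bij adjacency_verts[OF wf yz(2)] by (auto simp: bij_betw_def inj_on_def)
      then show False using yz(2) simple_graph_irrefl[OF simple] by simp
    qed
    then show "orig T' a \<noteq> terminus T' a" if "a \<in> arcs T'" for a using adjacencyI[OF that] by auto
    show "inj_on (\<lambda>a. (orig T' a, terminus T' a)) (arcs T')"
    proof (rule inj_onI)
      fix b b' assume b: "b \<in> arcs T'" "b' \<in> arcs T'"
        and eq: "(orig T' b, terminus T' b) = (orig T' b', terminus T' b')"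
      obtain a a' where a: "a \<in> arcs T" "a' \<in> arcs T" "b = h a" "b' = h a'"
        using b graph_isoD(2)[OF iso] unfolding bij_betw_def by blast
      have "f (orig T a) = f (orig T a')" "f (terminus T a) = f (terminus T a')"
        using eq a graph_isoD(3)[OF iso] graph_iso_terminus[OF iso wf] by auto
      then have "orig T a = orig T a'" "terminus T a = terminus T a'"
        using a wf_graphD(1,2)[OF wf] bij by (auto simp: bij_betw_def inj_on_def)
      then show "b = b'" using simple_graph_arc_eq[OF simple] a by blast
    qed
  qed
  define level' where "level' v = level (?g v)" for v
  define par' where "par' v = f (par (?g v))" for v
  have lift: "level' (f x) = level x" "par' (f x) = f (par x)" "f x = f base \<longleftrightarrow> x = base"
    if "x \<in> verts T" for x
    unfolding level'_def par'_def g[OF that] using g[OF that] g[OF base_in] by metis+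
  interpret T': rooted_tree T' "f base" level' par'
  proof
    show "wf_graph T'" by (rule wf_graph_iso[OF iso wf])
    show "simple_graph T'" by (rule simple')
    show "f base \<in> verts T'" "level' (f base) = 0" "par' (f base) = f base"
      using base_in V' lift[OF base_in] level_base par_base by auto
    fix v assume v: "v \<in> verts T'" "v \<noteq> f base"
    obtain x where x: "x \<in> verts T" "v = f x" using v(1) V' by blast
    with v(2) have "x \<noteq> base" by blast
    then show "(par' v, v) \<in> adjacency T'" "level' v = Suc (level' (par' v))"
      using graph_iso_adjacency[OF iso wf par_in[OF x(1)] x(1)] adj_par[OF x(1)] level_par[OF x(1)]
      by (simp_all add: x(2) lift[OF x(1)] lift[OF par_in[OF x(1)]])
  next
    fix x y assume xy: "(x, y) \<in> adjacency T'"
    obtain x0 y0 where 0: "x = f x0" "y = f y0" "(x0, y0) \<in> adjacency T" using xy A' by auto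
    then have V: "x0 \<in> verts T" "y0 \<in> verts T" using adjacency_verts[OF wf] by auto
    show "x \<noteq> f base \<and> y = par' x \<or> y \<noteq> f base \<and> x = par' y"
      using adj_cases[OF 0(3)] by (auto simp: 0(1,2) lift[OF V(1)] lift[OF V(2)])
  qed
  show ?thesis by (rule T'.is_tree)
qed

section \<open>Distances and closest point projections\<close>

lemma graph_dist_self: "graph_dist T x x = 0"
  unfolding graph_dist_def by (rule Least_eq_0) simp

lemma graph_dist_relpow:
  assumes "connected_graph T" "x \<in> verts T" "y \<in> verts T"
  shows "(x, y) \<in> adjacency T ^^ graph_dist T x y"
proof -
  have "\<exists>n. (x, y) \<in> adjacency T ^^ n"
    using assms by (simp add: connected_graph_def flip: rtrancl_power)
  then show ?thesis unfolding graph_dist_def by (rule LeastI_ex)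
qed

lemma graph_dist_le: "(x, y) \<in> adjacency T ^^ n \<Longrightarrow> graph_dist T x y \<le> n"
  unfolding graph_dist_def by (rule Least_le)

lemma graph_dist_sym:
  assumes "wf_graph T"
  shows "graph_dist T x y = graph_dist T y x"
proof -
  have "(adjacency T ^^ n)\<inverse> = adjacency T ^^ n" for n
  proof -
    have A: "(adjacency T)\<inverse> = adjacency T" using adjacency_sym[OF assms] by auto
    show ?thesis
    proof (induction n)
      case (Suc n)
      then show ?case by (simp only: relpow.simps converse_relcomp A relpow_commute)
    qed simp
  qed
  then have "(x, y) \<in> adjacency T ^^ n \<longleftrightarrow> (y, x) \<in> adjacency T ^^ n" for n by blast
  then show ?thesis by (simp add: graph_dist_def)
qed

lemma graph_dist_pos:
  "connected_graph T \<Longrightarrow> x \<in> verts T \<Longrightarrow> y \<in> verts T \<Longrightarrow> x \<noteq> y \<Longrightarrow> graph_dist T x y > 0"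
  by (metis graph_dist_relpow gr0I relpow_0_E)

lemma closest_point_eqI:
  assumes "x \<in> L" "\<And>y. y \<in> L \<Longrightarrow> y \<noteq> x \<Longrightarrow> graph_dist T v x < graph_dist T v y"
  shows "closest_point T L v = x"
  unfolding closest_point_def
proof (rule the_equality)
  show "x \<in> L \<and> (\<forall>y\<in>L. graph_dist T v x \<le> graph_dist T v y)"
    using assms by (metis less_imp_le order_refl)
  show "x' = x" if "x' \<in> L \<and> (\<forall>y\<in>L. graph_dist T v x' \<le> graph_dist T v y)" for x'
    using assms that by (metis not_le)
qed

context rooted_tree
begin

lemma connected: "connected_graph T"
  using is_tree by (simp add: tree_def)

section \<open>Subtrees below a vertex and distances out of them\<close>

definition descendants :: "'v \<Rightarrow> 'v set" where
  "descendants z = {x \<in> verts T. \<exists>k. (par ^^ k) x = z}"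

lemma descendants_self: "z \<in> verts T \<Longrightarrow> z \<in> descendants z"
  by (auto simp: descendants_def intro: exI[of _ 0])

lemma descendants_par: "x \<in> verts T \<Longrightarrow> par x \<in> descendants z \<Longrightarrow> x \<in> descendants z"
  unfolding descendants_def mem_Collect_eq by (metis comp_apply funpow_Suc_right)

lemma par_descendants: "x \<in> descendants z \<Longrightarrow> x \<noteq> z \<Longrightarrow> par x \<in> descendants z"
  unfolding descendants_def mem_Collect_eq
  by (metis comp_apply funpow_Suc_right funpow_0 not0_implies_Suc par_in)

lemma level_descendants: "x \<in> descendants z \<Longrightarrow> x = z \<or> level z < level x"
proof -
  have "(par ^^ k) x = z \<Longrightarrow> x \<in> verts T \<Longrightarrow> x = z \<or> level z < level x" for k x
  proof (induction k arbitrary: x)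
    case (Suc k)
    show ?case
    proof (cases "x = base")
      case True
      then have "(par ^^ Suc k) x = base" by (induction k) (simp_all add: par_base)
      then show ?thesis using Suc.prems True by simp
    next
      case False
      then show ?thesis
        using Suc.IH[of "par x"] Suc.prems level_par[OF Suc.prems(2)] par_in
        by (auto simp del: funpow.simps simp: funpow_Suc_right)
    qed
  qed simp
  then show "x \<in> descendants z \<Longrightarrow> x = z \<or> level z < level x"
    by (auto simp: descendants_def)
qed

lemma descendants_base: "x \<in> verts T \<Longrightarrow> x \<in> descendants base"
  by (induction rule: rooted_induct) (auto intro: descendants_self base_in descendants_par)

text \<open>The only way out of the subtree below \<open>z\<close> is the edge from \<open>z\<close>
  to \<open>par z\<close>, so the walk has a proper final part that starts at
  \<open>par z\<close>.\<close>

lemma walk_from_descendant: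
  assumes "(w, u) \<in> adjacency T ^^ n" "w \<in> descendants z" "u \<notin> descendants z"
  shows "\<exists>m<n. (par z, u) \<in> adjacency T ^^ m"
  using assms
proof (induction n arbitrary: w)
  case (Suc n)
  obtain w' where w': "(w, w') \<in> adjacency T" "(w', u) \<in> adjacency T ^^ n"
    using relpow_Suc_D2[OF Suc.prems(1)] by blast
  have V: "w' \<in> verts T" using adjacency_verts[OF wf w'(1)] by simp
  show ?case
  proof (cases "w' \<in> descendants z")
    case True
    then show ?thesis using Suc.IH[OF w'(2) _ Suc.prems(3)] by (auto intro: less_SucI)
  next
    case False
    then have "w = z" "w' = par w"
      using adj_cases[OF w'(1)] par_descendants[OF Suc.prems(2)] descendants_par[OF V] Suc.prems(2)
      by auto
    then show ?thesis using w'(2) by auto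
  qed
qed auto

lemma graph_dist_par:
  assumes "z \<in> verts T" "u \<in> verts T" "u \<notin> descendants z"
  shows "graph_dist T z u = Suc (graph_dist T (par z) u)"
proof (rule antisym)
  have z: "z \<noteq> base" using assms descendants_base by auto
  have "(z, par z) \<in> adjacency T" using adjacency_sym[OF wf adj_par[OF assms(1) z]] .
  then have "(z, u) \<in> adjacency T ^^ Suc (graph_dist T (par z) u)"
    using graph_dist_relpow[OF connected par_in[OF assms(1)] assms(2)] by (rule relpow_Suc_I2)
  then show "graph_dist T z u \<le> Suc (graph_dist T (par z) u)" by (rule graph_dist_le)
  obtain m where "m < graph_dist T z u" "(par z, u) \<in> adjacency T ^^ m"
    using walk_from_descendant[OF graph_dist_relpow[OF connected assms(1,2)] descendants_self[OF assms(1)] assms(3)]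
    by blast
  then show "Suc (graph_dist T (par z) u) \<le> graph_dist T z u"
    using graph_dist_le by fastforce
qed

lemma closest_point_self:
  assumes "x \<in> L" "L \<subseteq> verts T"
  shows "closest_point T L x = x"
proof (rule closest_point_eqI)
  show "graph_dist T x x < graph_dist T x y" if "y \<in> L" "y \<noteq> x" for y
    unfolding graph_dist_self using assms that by (intro graph_dist_pos[OF connected]) auto
qed (rule assms)

text \<open>Passing from \<open>z\<close> to \<open>par z\<close> lowers each distance to
  \<open>L\<close> by exactly one. The two descriptions inside \<open>closest_point\<close> are
  therefore equivalent, whether or not they have a unique solution.\<close>

lemma closest_point_par:
  assumes "z \<in> verts T" "L \<subseteq> verts T" "L \<inter> descendants z = {}"
  shows "closest_point T L z = closest_point T L (par z)"
proof -
  have "graph_dist T z u = Suc (graph_dist T (par z) u)" if "u \<in> L" for u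
    by (rule graph_dist_par) (use assms that in auto)
  then have "x \<in> L \<and> (\<forall>u\<in>L. graph_dist T z x \<le> graph_dist T z u) \<longleftrightarrow>
      x \<in> L \<and> (\<forall>u\<in>L. graph_dist T (par z) x \<le> graph_dist T (par z) u)" for x by auto
  then show ?thesis unfolding closest_point_def by (rule arg_cong[where f = The, OF ext])
qed

text \<open>Identifies the two fibres that property (P) refers to for a one-edge path: deleting the
  edge cuts off the subtree below \<open>y\<close>.\<close>

lemma closest_point_edge:
  assumes y: "y \<in> verts T" "y \<noteq> base" and x: "x \<in> verts T"
  shows "closest_point T {par y, y} x = (if x \<in> descendants y then y else par y)"
proof (cases "x \<in> descendants y")
  case True
  have "x \<in> verts T \<Longrightarrow> x \<in> descendants y \<Longrightarrow> closest_point T {par y, y} x = y" for x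
  proof (induction x rule: rooted_induct)
    case base
    then show ?case using level_descendants[of base y] level_base y(2) by simp
  next
    case (par x)
    show ?case
    proof (cases "x = y")
      case True
      then show ?thesis using closest_point_self[of y "{par y, y}"] y(1) par_in[OF y(1)] by simp
    next
      case False
      then have "level y < level x" "level (par y) < level y"
        using level_descendants[OF par.prems] level_par[OF y] by auto
      then have "{par y, y} \<inter> descendants x = {}"
        using level_descendants[of y x] level_descendants[of "par y" x] by force
      then show ?thesis
        using closest_point_par[OF par.hyps(1), of "{par y, y}"] y(1) par_in[OF y(1)]
          par.IH[OF par_descendants[OF par.prems False]] by simp
    qed
  qed
  then show ?thesis using True x by simp
next
  case False
  have "graph_dist T x (par y) < graph_dist T x y"
    using graph_dist_par[OF y(1) x False] graph_dist_sym[OF wf, of x] by simp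
  then have "closest_point T {par y, y} x = par y" by (intro closest_point_eqI) auto
  then show ?thesis using False by simp
qed

section \<open>Projection to a path through the root\<close>

lemma path_verts_edge:
  assumes "y \<in> verts T" "y \<noteq> base"
  shows "path_verts T {par y, y}"
proof -
  have ne: "y \<noteq> par y" using level_par[OF assms] by auto
  have I: "{0..1::int} = {0, 1}" by auto
  show ?thesis
    unfolding path_verts_def
  proof (intro exI[of _ "{0..1::int}"] exI[of _ "\<lambda>i. if i = 0 then par y else y"] conjI)
    show "\<forall>i\<in>{0..1::int}. \<forall>j\<in>{0..1}. {i..j} \<subseteq> {0..1}" by auto
  qed (use ne adj_par[OF assms] assms par_in[OF assms(1)] in \<open>auto simp: I\<close>)
qed

text \<open>Moving along the path away from \<open>base\<close>, each step goes to a child.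
  Otherwise it would go to the parent, which by induction is the vertex before, and the path would
  repeat a vertex.\<close>

lemma par_path_up:
  fixes f :: "int \<Rightarrow> 'v"
  assumes int: "\<And>i j. i \<in> I \<Longrightarrow> j \<in> I \<Longrightarrow> {i..j} \<subseteq> I" and inj: "inj_on f I"
    and step: "\<And>i. i \<in> I \<Longrightarrow> i + 1 \<in> I \<Longrightarrow> (f i, f (i + 1)) \<in> adjacency T"
    and k: "k \<in> I" "f k = base" and i: "k \<le> i" "i \<in> I"
  shows "i = k \<or> par (f i) = f (i - 1) \<and> i - 1 \<in> I"
  using i
proof (induction i rule: int_ge_induct)
  case (step i)
  have iI: "i \<in> I" using int[OF k(1) step.prems] step.hyps by auto
  have "par (f (i + 1)) = f i"
  proof (rule ccontr)
    assume "par (f (i + 1)) \<noteq> f i"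
    then have *: "f i \<noteq> base" "f (i + 1) = par (f i)"
      using adj_cases[OF assms(3)[OF iI step.prems]] by metis+
    then have "i - 1 \<in> I" "f (i + 1) = f (i - 1)" using step.IH[OF iI] k(2) by auto
    then show False using inj_onD[OF inj, of "i + 1" "i - 1"] step.prems by simp
  qed
  then show ?case using iI by simp
qed simp

lemma par_path:
  assumes L: "path_verts T L" "base \<in> L" and x: "x \<in> L"
  shows "par x \<in> L"
proof -
  obtain I :: "int set" and f where "\<forall>i\<in>I. \<forall>j\<in>I. {i..j} \<subseteq> I" "inj_on f I"
      "L = f ` I" "\<forall>i\<in>I. i + 1 \<in> I \<longrightarrow> (f i, f (i + 1)) \<in> adjacency T"
    using L(1) unfolding path_verts_def by (elim exE conjE)
  then have I: "\<And>i j. i \<in> I \<Longrightarrow> j \<in> I \<Longrightarrow> {i..j} \<subseteq> I" "inj_on f I"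
      "L = f ` I" "\<And>i. i \<in> I \<Longrightarrow> i + 1 \<in> I \<Longrightarrow> (f i, f (i + 1)) \<in> adjacency T"
    by simp_all
  obtain k where k: "k \<in> I" "f k = base" using L(2) I(3) by auto
  obtain i where i: "i \<in> I" "x = f i" using x I(3) by auto
  have "i = k \<or> par x \<in> L"
  proof (cases "k \<le> i")
    case True
    then show ?thesis using par_path_up[OF I(1,2,4) k True i(1)] I(3) i by auto
  next
    case False
    \<comment> \<open>The part of the path on the other side of \<open>base\<close> is treated by
      traversing the path backwards.\<close>
    let ?I = "uminus ` I" and ?f = "f \<circ> uminus"
    have "- i = - k \<or> par (?f (- i)) = ?f (- i - 1) \<and> - i - 1 \<in> ?I"
    proof (rule par_path_up)
      show "{i'..j'} \<subseteq> ?I" if "i' \<in> ?I" "j' \<in> ?I" for i' j'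
      proof -
        have "{- j'..- i'} \<subseteq> I" using that by (intro I(1)) auto
        then have "uminus ` {- j'..- i'} \<subseteq> ?I" by blast
        then show ?thesis by simp
      qed
      show "inj_on ?f ?I" using I(2) by (auto simp: inj_on_def)
      show "(?f j, ?f (j + 1)) \<in> adjacency T" if "j \<in> ?I" "j + 1 \<in> ?I" for j
      proof -
        have "- j - 1 \<in> I" "- j \<in> I" using that by auto (metis add.commute add_uminus_conv_diff minus_add_distrib minus_minus)
        then show ?thesis using I(4)[of "- j - 1"] adjacency_sym[OF wf] by simp
      qed
    qed (use k i False in auto)
    moreover have "i + 1 \<in> I" if "- i - 1 \<in> ?I"
    proof -
      from that obtain j where j: "j \<in> I" "- i - 1 = - j" by blast
      then have "j = i + 1" by linarith
      then show ?thesis using j(1) by simp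
    qed
    moreover have "?f (- i - 1) = f (i + 1)" "?f (- i) = f i" by (simp_all add: comp_def add.commute)
    ultimately have "i = k \<or> par (f i) = f (i + 1) \<and> i + 1 \<in> I" by auto
    then show ?thesis using I(3) i(2) by blast
  qed
  then show ?thesis using k i L(2) par_base by auto
qed

text \<open>As \<open>L\<close> is closed under parents, a vertex outside \<open>L\<close> has no
  descendant in \<open>L\<close>, so it has the same projection as its parent. Projecting thus means
  climbing until \<open>L\<close> is met.\<close>

lemma closest_point_in:
  assumes L: "L \<subseteq> verts T" "base \<in> L" and par_L: "\<And>x. x \<in> L \<Longrightarrow> par x \<in> L" and "v \<in> verts T"
  shows "closest_point T L v \<in> L"
    and "v \<notin> L \<Longrightarrow> closest_point T L v = closest_point T L (par v)"
proof -
  have disj: "L \<inter> descendants z = {}" if "z \<notin> L" for z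
  proof -
    have "(par ^^ k) x \<in> L" if "x \<in> L" for x k using that by (induction k) (simp_all add: par_L)
    then show ?thesis using that unfolding descendants_def by blast
  qed
  then have *: "closest_point T L v = closest_point T L (par v)" if "v \<in> verts T" "v \<notin> L" for v
    using closest_point_par[OF that(1) L(1)] that(2) by blast
  then show "v \<notin> L \<Longrightarrow> closest_point T L v = closest_point T L (par v)"
    using \<open>v \<in> verts T\<close> by blast
  show "closest_point T L v \<in> L"
    using \<open>v \<in> verts T\<close>
  proof (induction v rule: rooted_induct)
    case base
    then show ?case using closest_point_self[OF L(2,1)] L(2) by simp
  next
    case (par v)
    then show ?case using closest_point_self[OF _ L(1), of v] *[of v] by (cases "v \<in> L") simp_all
  qed
qed

end

text \<open>The tree is rooted at a vertex of \<open>L\<close>. The third fact is the one needed for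
  patching along fibres: two different fibres are joined only by edges with both ends in
  \<open>L\<close>, and these are fixed by the fixator of \<open>L\<close>.\<close>

lemma path_projection:
  assumes T: "tree T" and L: "path_verts T L"
  shows "\<And>v. v \<in> verts T \<Longrightarrow> closest_point T L v \<in> L"
    and "\<And>v. v \<in> L \<Longrightarrow> closest_point T L v = v"
    and "\<And>x y. (x, y) \<in> adjacency T \<Longrightarrow>
      closest_point T L x = closest_point T L y \<or> x \<in> L \<and> y \<in> L"
proof -
  have LV: "L \<subseteq> verts T" "L \<noteq> {}" using L by (auto simp: path_verts_def)
  then obtain base where base: "base \<in> L" by auto
  then obtain level par where "rooted_tree T base level par"
    using tree_rooted[OF T] LV by blast
  then interpret rooted_tree T base level par .
  note par_L = par_path[OF L base]
  note cl = closest_point_in[OF LV(1) base par_L]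
  show "\<And>v. v \<in> verts T \<Longrightarrow> closest_point T L v \<in> L" by (rule cl)
  show "\<And>v. v \<in> L \<Longrightarrow> closest_point T L v = v" using closest_point_self LV by auto
  have *: "closest_point T L x = closest_point T L (par x) \<or> x \<in> L \<and> par x \<in> L"
    if "x \<in> verts T" for x
    using cl(2)[OF _ that] par_L by blast
  fix x y assume "(x, y) \<in> adjacency T"
  then show "closest_point T L x = closest_point T L y \<or> x \<in> L \<and> y \<in> L"
    using adj_cases[of x y] adjacency_verts[OF wf, of x y] *[of x] *[of y] by auto
qed

section \<open>Permutation groups and their topology\<close>

lemma carrier_BijGroup: "carrier (BijGroup X) = Bij X"
  by (simp add: BijGroup_def)

lemma mult_BijGroup: "g \<in> Bij X \<Longrightarrow> h \<in> Bij X \<Longrightarrow> g \<otimes>\<^bsub>BijGroup X\<^esub> h = compose X g h"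
  by (simp add: BijGroup_def)

lemma BijD:
  assumes "g \<in> Bij X"
  shows "x \<in> X \<Longrightarrow> g x \<in> X" "x \<in> X \<Longrightarrow> y \<in> X \<Longrightarrow> g x = g y \<longleftrightarrow> x = y" "g ` X = X"
    "x \<in> X \<Longrightarrow> inv_into X g (g x) = x" "x \<in> X \<Longrightarrow> g (inv_into X g x) = x"
    "x \<in> X \<Longrightarrow> inv_into X g x \<in> X"
  using assms by (auto simp: Bij_def bij_betw_def inj_on_eq_iff inv_into_into f_inv_into_f)

lemma Bij_eqI: "g \<in> Bij X \<Longrightarrow> h \<in> Bij X \<Longrightarrow> (\<And>x. x \<in> X \<Longrightarrow> g x = h x) \<Longrightarrow> g = h"
  by (metis Bij_imp_extensional extensionalityI)

lemma subgroup_BijGroup_iff: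
  "subgroup G (BijGroup X) \<longleftrightarrow> G \<subseteq> Bij X \<and> (\<lambda>x\<in>X. x) \<in> G \<and>
     (\<forall>g\<in>G. \<forall>h\<in>G. compose X g h \<in> G) \<and> (\<forall>g\<in>G. restrict (inv_into X g) X \<in> G)"
  (is "?L \<longleftrightarrow> ?R")
proof
  assume L: ?L
  then have G: "G \<subseteq> Bij X" using subgroup.subset carrier_BijGroup by metis
  moreover have "compose X g h \<in> G" if "g \<in> G" "h \<in> G" for g h
    using subgroup.m_closed[OF L that] mult_BijGroup[OF subsetD[OF G] subsetD[OF G], OF that] by simp
  moreover have "restrict (inv_into X g) X \<in> G" if "g \<in> G" for g
    using subgroup.m_inv_closed[OF L that] inv_BijGroup[OF subsetD[OF G that]] by simp
  ultimately show ?R using subgroup.one_closed[OF L] by (auto simp: BijGroup_def)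
next
  assume R: ?R
  show ?L
  proof (rule subgroup.intro)
    show "x \<otimes>\<^bsub>BijGroup X\<^esub> y \<in> G" if "x \<in> G" "y \<in> G" for x y
      using R that mult_BijGroup[of x X y] by (simp add: subset_iff)
    show "inv\<^bsub>BijGroup X\<^esub> x \<in> G" if "x \<in> G" for x
      using R that inv_BijGroup[of x X] by (simp add: subset_iff)
  qed (use R in \<open>auto simp: BijGroup_def\<close>)
qed

text \<open>Turns basic neighbourhoods into agreement on a finite set: an \<open>h\<close> that
  agrees with \<open>g\<close> on \<open>F\<close> is \<open>g\<close> times the permutation
  \<open>g^-1 h\<close>, which fixes \<open>F\<close> pointwise.\<close>

lemma coset_pointwise_stabiliser:
  assumes g: "g \<in> Bij X" and F: "F \<subseteq> X"
  shows "g <#\<^bsub>BijGroup X\<^esub> pointwise_stabiliser (carrier (BijGroup X)) F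
    = {h \<in> Bij X. \<forall>x\<in>F. h x = g x}"
proof (intro equalityI subsetI)
  fix h assume "h \<in> g <#\<^bsub>BijGroup X\<^esub> pointwise_stabiliser (carrier (BijGroup X)) F"
  then obtain k where "k \<in> Bij X" "\<forall>x\<in>F. k x = x" "h = compose X g k"
    using mult_BijGroup[OF g] unfolding l_coset_def pointwise_stabiliser_def carrier_BijGroup by blast
  then show "h \<in> {h \<in> Bij X. \<forall>x\<in>F. h x = g x}"
    using g F compose_Bij[of g X k] subsetD[OF F] by (simp add: compose_def)
next
  fix h assume h: "h \<in> {h \<in> Bij X. \<forall>x\<in>F. h x = g x}"
  let ?k = "compose X (restrict (inv_into X g) X) h"
  have k: "?k \<in> Bij X" using g h by (intro compose_Bij restrict_inv_into_Bij) auto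
  moreover have "?k x = x" if "x \<in> F" for x
  proof -
    have "h x = g x" "x \<in> X" using h F that by auto
    then show ?thesis using BijD[OF g] by (simp add: compose_def)
  qed
  moreover have "h = g \<otimes>\<^bsub>BijGroup X\<^esub> ?k"
  proof (rule Bij_eqI)
    show "g \<otimes>\<^bsub>BijGroup X\<^esub> ?k \<in> Bij X" using g k compose_Bij by (simp add: mult_BijGroup)
    show "h x = (g \<otimes>\<^bsub>BijGroup X\<^esub> ?k) x" if "x \<in> X" for x
      unfolding mult_BijGroup[OF g k]
      using h that BijD(1)[of h X x] BijD(5)[OF g, of "h x"] by (simp add: compose_def)
  qed (use h in auto)
  ultimately show "h \<in> g <#\<^bsub>BijGroup X\<^esub> pointwise_stabiliser (carrier (BijGroup X)) F"
    unfolding l_coset_def pointwise_stabiliser_def carrier_BijGroup by blast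
qed

text \<open>From here on the topology enters only through agreement on finite sets.\<close>

lemma in_perm_closure_iff:
  assumes "A \<subseteq> Bij X"
  shows "g \<in> perm_topology X closure_of A \<longleftrightarrow>
    g \<in> Bij X \<and> (\<forall>F. finite F \<and> F \<subseteq> X \<longrightarrow> (\<exists>h\<in>A. \<forall>x\<in>F. h x = g x))"
proof -
  have "(\<forall>U. g \<in> U \<and> perm_open X U \<longrightarrow> (\<exists>h\<in>A. h \<in> U)) \<longleftrightarrow>
      (\<forall>F. finite F \<and> F \<subseteq> X \<longrightarrow> (\<exists>h\<in>A. \<forall>x\<in>F. h x = g x))" if g: "g \<in> Bij X"
  proof (intro iffI allI impI)
    fix F assume *: "\<forall>U. g \<in> U \<and> perm_open X U \<longrightarrow> (\<exists>h\<in>A. h \<in> U)" and F: "finite F \<and> F \<subseteq> X"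
    have "perm_open X {h \<in> Bij X. \<forall>x\<in>F. h x = g x}"
      unfolding perm_open_def carrier_BijGroup
    proof (intro conjI ballI)
      fix k assume k: "k \<in> {h \<in> Bij X. \<forall>x\<in>F. h x = g x}"
      then show "\<exists>F'. finite F' \<and> F' \<subseteq> X \<and> k <#\<^bsub>BijGroup X\<^esub> pointwise_stabiliser (Bij X) F'
          \<subseteq> {h \<in> Bij X. \<forall>x\<in>F. h x = g x}"
        using coset_pointwise_stabiliser[of k X F] F
        by (intro exI[of _ F]) (auto simp: carrier_BijGroup)
    qed auto
    then have "\<exists>h\<in>A. h \<in> {h \<in> Bij X. \<forall>x\<in>F. h x = g x}"
      by (intro *[rule_format] conjI) (simp_all add: g)
    then show "\<exists>h\<in>A. \<forall>x\<in>F. h x = g x" by blast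
  next
    fix U assume *: "\<forall>F. finite F \<and> F \<subseteq> X \<longrightarrow> (\<exists>h\<in>A. \<forall>x\<in>F. h x = g x)"
      and U: "g \<in> U \<and> perm_open X U"
    then obtain F where F: "finite F" "F \<subseteq> X"
        "g <#\<^bsub>BijGroup X\<^esub> pointwise_stabiliser (carrier (BijGroup X)) F \<subseteq> U"
      unfolding perm_open_def by blast
    obtain h where "h \<in> A" "\<forall>x\<in>F. h x = g x" using * F(1,2) by blast
    then show "\<exists>h\<in>A. h \<in> U"
      using F(3) assms unfolding coset_pointwise_stabiliser[OF g F(2)] by blast
  qed
  then show ?thesis
    unfolding in_closure_of topspace_perm_topology openin_perm_topology carrier_BijGroup Bex_def
    by (simp cong: conj_cong)
qed

lemma closedin_perm_iff:
  assumes "A \<subseteq> Bij X"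
  shows "closedin (perm_topology X) A \<longleftrightarrow>
    (\<forall>g\<in>Bij X. (\<forall>F. finite F \<and> F \<subseteq> X \<longrightarrow> (\<exists>h\<in>A. \<forall>x\<in>F. h x = g x)) \<longrightarrow> g \<in> A)"
  using in_perm_closure_iff[OF assms] assms
  by (simp add: subset_iff topspace_perm_topology carrier_BijGroup flip: closure_of_subset_eq) blast

section \<open>Automorphisms of trees\<close>

lemma arc_map_eq:
  assumes T: "tree T" and iso: "graph_iso T T g h" and a: "a \<in> arcs T"
  shows "arc_map T g a = h a"
proof -
  have wf: "wf_graph T" and simple: "simple_graph T" using T by (auto simp: tree_def)
  have "(THE b. b \<in> arcs T \<and> orig T b = g (orig T a) \<and> terminus T b = g (terminus T a)) = h a"
  proof (rule the_equality)
    show *: "h a \<in> arcs T \<and> orig T (h a) = g (orig T a) \<and> terminus T (h a) = g (terminus T a)"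
      using graph_iso_in(2)[OF iso a] graph_isoD(3)[OF iso a] graph_iso_terminus[OF iso wf a] by simp
    show "b = h a" if "b \<in> arcs T \<and> orig T b = g (orig T a) \<and> terminus T b = g (terminus T a)" for b
      using simple_graph_arc_eq[OF simple, of b "h a"] that * by simp
  qed
  then show ?thesis using a by (simp add: arc_map_def)
qed

lemma tree_Aut_iso:
  assumes "tree T" "g \<in> tree_Aut T"
  shows "graph_iso T T g (arc_map T g)"
proof -
  obtain h where h: "graph_iso T T g h" using assms(2) by (auto simp: tree_Aut_def)
  have "wf_graph T" using assms(1) by (simp add: tree_def)
  from graph_iso_cong[OF h this refl arc_map_eq[OF assms(1) h]] show ?thesis .
qed

lemma tree_Aut_Bij: "g \<in> tree_Aut T \<Longrightarrow> g \<in> Bij (verts T)"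
  by (simp add: tree_Aut_def carrier_BijGroup)

lemma arc_map_compose:
  assumes T: "tree T" and g: "g \<in> tree_Aut T" "h \<in> tree_Aut T" and a: "a \<in> arcs T"
  shows "arc_map T (compose (verts T) g h) a = arc_map T g (arc_map T h a)"
proof -
  have wf: "wf_graph T" using T by (simp add: tree_def)
  have "graph_iso T T (g \<circ> h) (arc_map T g \<circ> arc_map T h)"
    by (rule graph_iso_comp[OF tree_Aut_iso[OF T g(2)] tree_Aut_iso[OF T g(1)]])
  then have "graph_iso T T (compose (verts T) g h) (arc_map T g \<circ> arc_map T h)"
    by (rule graph_iso_cong[OF _ wf]) (simp_all add: compose_def)
  from arc_map_eq[OF T this a] show ?thesis by simp
qed

lemma arc_map_id: "tree T \<Longrightarrow> a \<in> arcs T \<Longrightarrow> arc_map T (\<lambda>x\<in>verts T. x) a = a"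
proof -
  assume T: "tree T" and a: "a \<in> arcs T"
  then have "graph_iso T T (\<lambda>x\<in>verts T. x) id"
    by (intro graph_iso_cong[OF graph_iso_id]) (auto simp: tree_def)
  from arc_map_eq[OF T this a] show ?thesis by simp
qed

lemma arc_map_cong:
  assumes T: "tree T" and g: "g \<in> tree_Aut T" "h \<in> tree_Aut T" and a: "a \<in> arcs T"
    and eq: "g (orig T a) = h (orig T a)" "g (terminus T a) = h (terminus T a)"
  shows "arc_map T g a = arc_map T h a"
  using a eq by (simp add: arc_map_def)

section \<open>Coverings of trees\<close>

context rooted_tree
begin

lemma level_eq_0: "v \<in> verts T \<Longrightarrow> level v = 0 \<Longrightarrow> v = base"
  using level_par by fastforce

text \<open>Recursion along \<open>par\<close> becomes primitive recursion on the number of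
  unfoldings, and at \<open>w\<close> the right number is \<open>level w\<close>.\<close>

lemma rooted_recursion: "\<exists>f. f base = x0 \<and> (\<forall>w\<in>verts T. w \<noteq> base \<longrightarrow> f w = F w (f (par w)))"
proof -
  define st where "st = rec_nat (\<lambda>_. x0) (\<lambda>_ g w. F w (g (par w)))"
  have st: "st 0 = (\<lambda>_. x0)" "st (Suc n) w = F w (st n (par w))" for n w
    by (simp_all add: st_def)
  show ?thesis
    by (intro exI[of _ "\<lambda>w. st (level w) w"] conjI ballI impI)
      (simp_all add: st level_base level_par)
qed

definition down_arc :: "'v \<Rightarrow> 'e" where
  "down_arc w = (SOME a. a \<in> arcs T \<and> orig T a = par w \<and> terminus T a = w)"

lemma down_arc:
  assumes "w \<in> verts T" "w \<noteq> base"
  shows "down_arc w \<in> arcs T" "orig T (down_arc w) = par w" "terminus T (down_arc w) = w"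
proof -
  have "\<exists>a. a \<in> arcs T \<and> orig T a = par w \<and> terminus T a = w"
    using adj_par[OF assms] by (metis adjacencyE)
  from someI_ex[OF this]
  show "down_arc w \<in> arcs T" "orig T (down_arc w) = par w" "terminus T (down_arc w) = w"
    by (simp_all add: down_arc_def)
qed

lemma arc_cases:
  assumes a: "a \<in> arcs T"
  obtains (down) w where "w \<in> verts T" "w \<noteq> base" "a = down_arc w"
  | (up) w where "w \<in> verts T" "w \<noteq> base" "reversal T a = down_arc w"
  using adj_cases[OF adjacencyI[OF a]]
proof
  assume *: "orig T a \<noteq> base \<and> terminus T a = par (orig T a)"
  have V: "orig T a \<in> verts T" using wf_graphD[OF wf a] by simp
  have "reversal T a = down_arc (orig T a)"
    using down_arc[OF V] * wf_graphD[OF wf a] by (intro simple_graph_arc_eq[OF simple]) simp_all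
  then show thesis using up V * by blast
next
  assume *: "terminus T a \<noteq> base \<and> orig T a = par (terminus T a)"
  have V: "terminus T a \<in> verts T" using wf_graphD[OF wf a] by simp
  have "a = down_arc (terminus T a)"
    using down_arc[OF V] * a by (intro simple_graph_arc_eq[OF simple]) simp_all
  then show thesis using down V * by blast
qed

end

lemma arcs_from_iff: "a \<in> arcs_from T v \<longleftrightarrow> a \<in> arcs T \<and> orig T a = v"
  by (auto simp: arcs_from_def)

text \<open>The map is a covering, and a covering of a tree by a connected graph is bijective.
  Injectivity on stars forbids backtracking, so \<open>f\<close> preserves levels and parents;
  injectivity of \<open>f\<close> then follows by induction on the level, and surjectivity by
  lifting arcs down from the root.\<close>

lemma local_iso_imp_graph_iso:
  assumes T: "tree T" and T': "tree T'"
    and orig: "\<And>a. a \<in> arcs T \<Longrightarrow> orig T' (h a) = f (orig T a)"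
    and rev: "\<And>a. a \<in> arcs T \<Longrightarrow> h (reversal T a) = reversal T' (h a)"
    and V: "\<And>v. v \<in> verts T \<Longrightarrow> f v \<in> verts T'"
    and star: "\<And>v. v \<in> verts T \<Longrightarrow> bij_betw h (arcs_from T v) (arcs_from T' (f v))"
  shows "graph_iso T T' f h"
proof -
  obtain base where base: "base \<in> verts T" using T by (auto simp: tree_def connected_graph_def)
  obtain level par where "rooted_tree T base level par" using tree_rooted[OF T base] by blast
  then interpret rooted_tree T base level par .
  obtain level' par' where "rooted_tree T' (f base) level' par'"
    using tree_rooted[OF T' V[OF base]] by blast
  then interpret R: rooted_tree T' "f base" level' par' .
  have harc: "h a \<in> arcs T'" if "a \<in> arcs T" for a
    using star[OF wf_graphD(1)[OF wf that]] that by (auto simp: bij_betw_def arcs_from_def)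
  have tm: "terminus T' (h a) = f (terminus T a)" if "a \<in> arcs T" for a
    unfolding terminus_def rev[OF that, symmetric] orig[OF wf_graphD(3)[OF wf that]] ..
  have hinj: "a = b" if "a \<in> arcs T" "b \<in> arcs T" "orig T a = orig T b" "h a = h b" for a b
  proof -
    have "inj_on h (arcs_from T (orig T a))"
      using star[OF wf_graphD(1)[OF wf that(1)]] by (rule bij_betw_imp_inj_on)
    then show ?thesis using that by (auto simp: arcs_from_def inj_on_def)
  qed
  have hinj': "a = b" if "a \<in> arcs T" "b \<in> arcs T" "orig T a = orig T b"
      "f (terminus T a) = f (terminus T b)" for a b
    using that by (intro hinj simple_graph_arc_eq[OF R.simple]) (simp_all add: harc orig tm)
  have lev: "level' (f w) = level w \<and> (w \<noteq> base \<longrightarrow> par' (f w) = f (par w))" if "w \<in> verts T" for w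
    using that
  proof (induction w rule: rooted_induct)
    case base
    then show ?case by (simp add: R.level_base level_base)
  next
    case (par w)
    note d = down_arc[OF par.hyps]
    have adj: "(f (par w), f w) \<in> adjacency T'"
      using adjacencyI[OF harc[OF d(1)]] orig[OF d(1)] tm[OF d(1)] d by simp
    \<comment> \<open>In the case of backtracking, the arc from \<open>par w\<close> to
      \<open>w\<close> and the arc from \<open>par w\<close> to its own parent would have the same
      image, although both lie in the star of \<open>par w\<close>.\<close>
    have no: False if *: "f (par w) \<noteq> f base" "f w = par' (f (par w))"
    proof -
      have pw: "par w \<noteq> base" using * by auto
      then have fw: "f w = f (par (par w))" using par.IH * by simp
      note d2 = down_arc[OF par_in[OF par.hyps(1)] pw]
      have "down_arc w = reversal T (down_arc (par w))"
        using d d2 fw wf_graphD[OF wf d2(1)] by (intro hinj') simp_all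
      then have "w = par (par w)" using d d2 wf_graphD[OF wf d2(1)] by simp
      then show False
        using level_par[OF par.hyps] level_par[OF par_in[OF par.hyps(1)] pw] by simp
    qed
    then have fw: "f w \<noteq> f base" "f (par w) = par' (f w)"
      using R.adj_cases[OF adj] by metis+
    then show ?case
      using R.level_par[OF V[OF par.hyps(1)]] level_par[OF par.hyps] par.IH by simp
  qed
  \<comment> \<open>Vertices with equal image have equal level. Their parents agree by induction,
    and then so do the arcs leading to them, by injectivity on one star.\<close>
  have inj: "x = y" if "x \<in> verts T" "y \<in> verts T" "f x = f y" for x y
    using that
  proof (induction x arbitrary: y rule: rooted_induct)
    case base
    then have "level y = 0" using lev[OF base(1)] lev[OF base_in] level_base by simp
    then show ?case using level_eq_0 base by metis
  next
    case (par x)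
    have ly: "level y = level x" using lev[OF par.prems(1)] lev[OF par.hyps(1)] par.prems by simp
    then have y: "y \<noteq> base" using level_par[OF par.hyps] level_base by auto
    then have "f (par x) = f (par y)"
      using lev[OF par.prems(1)] lev[OF par.hyps(1)] par.prems par.hyps by simp
    then have "par x = par y" by (rule par.IH[OF par_in[OF par.prems(1)]])
    then have "down_arc x = down_arc y"
      using down_arc[OF par.hyps] down_arc[OF par.prems(1) y] par.prems(2) by (intro hinj') simp_all
    then show ?case using down_arc(3)[OF par.hyps] down_arc(3)[OF par.prems(1) y] by metis
  qed
  have surj: "\<exists>x\<in>verts T. v' = f x" if "v' \<in> verts T'" for v'
    using that
  proof (induction v' rule: R.rooted_induct)
    case base
    show ?case by (rule bexI[OF refl base_in])
  next
    case (par v')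
    from par.IH obtain x where x: "x \<in> verts T" "par' v' = f x" by (elim bexE)
    note d = R.down_arc[OF par.hyps]
    have "R.down_arc v' \<in> arcs_from T' (f x)" using d x by (simp add: arcs_from_iff)
    then have "R.down_arc v' \<in> h ` arcs_from T x" using star[OF x(1)] by (simp add: bij_betw_def)
    then obtain a where a: "a \<in> arcs T" "R.down_arc v' = h a" unfolding arcs_from_def by blast
    then have "v' = f (terminus T a)" using d(3) tm[OF a(1)] by simp
    then show ?case using wf_graphD(2)[OF wf a(1)] by blast
  qed
  have "bij_betw f (verts T) (verts T')"
    unfolding bij_betw_def inj_on_def using inj surj V by blast
  moreover have "bij_betw h (arcs T) (arcs T')"
    unfolding bij_betw_def
  proof
    show "inj_on h (arcs T)"
    proof (rule inj_onI)
      fix a b assume *: "a \<in> arcs T" "b \<in> arcs T" "h a = h b"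
      then have "f (orig T a) = f (orig T b)" using orig by metis
      then have "orig T a = orig T b" using inj wf_graphD(1)[OF wf] * by blast
      then show "a = b" using hinj * by blast
    qed
    have "b \<in> h ` arcs T" if b: "b \<in> arcs T'" for b
    proof -
      obtain x where x: "x \<in> verts T" "orig T' b = f x" using surj wf_graphD(1)[OF R.wf b] by blast
      then have "b \<in> h ` arcs_from T x"
        using star[OF x(1)] b by (simp add: bij_betw_def arcs_from_iff)
      then show ?thesis by (auto simp: arcs_from_iff)
    qed
    then show "h ` arcs T = arcs T'" using harc by blast
  qed
  ultimately show ?thesis
    unfolding graph_iso_def using orig rev by simp
qed

section \<open>Trees labelled by a local action diagram\<close>

text \<open>A colour determines its arc because colour sets are disjoint; a labelling by colours
  therefore records the projection of arcs as well.\<close>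

definition arc_of :: "('v, 'e, 'c) lad \<Rightarrow> 'c \<Rightarrow> 'e" where
  "arc_of \<Delta> c = (THE a. a \<in> arcs (lad_graph \<Delta>) \<and> c \<in> colours \<Delta> a)"

locale action_diagram =
  fixes \<Delta> :: "('w, 'f, 'c) lad"
  assumes lad: "\<Delta> \<in> local_action_diagrams"
begin

abbreviation "\<Gamma> \<equiv> lad_graph \<Delta>"

lemma wf_lad: "wf_graph \<Gamma>" and connected_lad: "connected_graph \<Gamma>"
  and colours_nonempty: "a \<in> arcs \<Gamma> \<Longrightarrow> colours \<Delta> a \<noteq> {}"
  and colours_disjoint: "a \<in> arcs \<Gamma> \<Longrightarrow> b \<in> arcs \<Gamma> \<Longrightarrow> c \<in> colours \<Delta> a \<Longrightarrow> c \<in> colours \<Delta> b \<Longrightarrow> a = b"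
  using lad by (auto simp: local_action_diagrams_def)

lemma arc_of_eq: "a \<in> arcs \<Gamma> \<Longrightarrow> c \<in> colours \<Delta> a \<Longrightarrow> arc_of \<Delta> c = a"
  unfolding arc_of_def by (rule the_equality) (use colours_disjoint in blast)+

lemma arc_of_colours_at:
  assumes "c \<in> colours_at \<Delta> v"
  shows "arc_of \<Delta> c \<in> arcs \<Gamma>" "orig \<Gamma> (arc_of \<Delta> c) = v" "c \<in> colours \<Delta> (arc_of \<Delta> c)"
proof -
  obtain a where a: "a \<in> arcs \<Gamma>" "orig \<Gamma> a = v" "c \<in> colours \<Delta> a"
    using assms by (auto simp: colours_at_def arcs_from_def)
  then show "arc_of \<Delta> c \<in> arcs \<Gamma>" "orig \<Gamma> (arc_of \<Delta> c) = v" "c \<in> colours \<Delta> (arc_of \<Delta> c)"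
    by (simp_all add: arc_of_eq)
qed

lemma colours_atI: "a \<in> arcs \<Gamma> \<Longrightarrow> c \<in> colours \<Delta> a \<Longrightarrow> c \<in> colours_at \<Delta> (orig \<Gamma> a)"
  by (auto simp: colours_at_def arcs_from_def)

lemma local_group:
  assumes "v \<in> verts \<Gamma>"
  shows local_group_Bij: "s \<in> local_group \<Delta> v \<Longrightarrow> s \<in> Bij (colours_at \<Delta> v)"
    and local_group_id: "(\<lambda>c\<in>colours_at \<Delta> v. c) \<in> local_group \<Delta> v"
    and local_group_compose: "s \<in> local_group \<Delta> v \<Longrightarrow> t \<in> local_group \<Delta> v \<Longrightarrow>
      compose (colours_at \<Delta> v) s t \<in> local_group \<Delta> v"
    and local_group_inv: "s \<in> local_group \<Delta> v \<Longrightarrow>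
      restrict (inv_into (colours_at \<Delta> v) s) (colours_at \<Delta> v) \<in> local_group \<Delta> v"
proof -
  have "subgroup (local_group \<Delta> v) (BijGroup (colours_at \<Delta> v))"
    using assms lad by (simp add: local_action_diagrams_def)
  from this[unfolded subgroup_BijGroup_iff] have *: "local_group \<Delta> v \<subseteq> Bij (colours_at \<Delta> v) \<and> (\<lambda>c\<in>colours_at \<Delta> v. c) \<in> local_group \<Delta> v \<and>
     (\<forall>g\<in>local_group \<Delta> v. \<forall>h\<in>local_group \<Delta> v. compose (colours_at \<Delta> v) g h \<in> local_group \<Delta> v) \<and>
     (\<forall>g\<in>local_group \<Delta> v. restrict (inv_into (colours_at \<Delta> v) g) (colours_at \<Delta> v) \<in> local_group \<Delta> v)" .
  show "s \<in> local_group \<Delta> v \<Longrightarrow> s \<in> Bij (colours_at \<Delta> v)" using * by blast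
  show "(\<lambda>c\<in>colours_at \<Delta> v. c) \<in> local_group \<Delta> v" using * by blast
  show "s \<in> local_group \<Delta> v \<Longrightarrow> t \<in> local_group \<Delta> v \<Longrightarrow>
      compose (colours_at \<Delta> v) s t \<in> local_group \<Delta> v" using * by blast
  show "s \<in> local_group \<Delta> v \<Longrightarrow>
      restrict (inv_into (colours_at \<Delta> v) s) (colours_at \<Delta> v) \<in> local_group \<Delta> v" using * by blast
qed

lemma local_group_closed:
  assumes v: "v \<in> verts \<Gamma>" and s: "s \<in> Bij (colours_at \<Delta> v)"
    and approx: "\<And>F. finite F \<Longrightarrow> F \<subseteq> colours_at \<Delta> v \<Longrightarrow> \<exists>t\<in>local_group \<Delta> v. \<forall>c\<in>F. t c = s c"
  shows "s \<in> local_group \<Delta> v"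
proof -
  have "closedin (perm_topology (colours_at \<Delta> v)) (local_group \<Delta> v)"
    using v lad by (simp add: local_action_diagrams_def)
  moreover have "local_group \<Delta> v \<subseteq> Bij (colours_at \<Delta> v)" using local_group_Bij[OF v] by blast
  ultimately show ?thesis using closedin_perm_iff s approx by metis
qed

lemma local_orbit:
  assumes v: "v \<in> verts \<Gamma>" and c: "c \<in> colours_at \<Delta> v"
  shows "{s c | s. s \<in> local_group \<Delta> v} = colours \<Delta> (arc_of \<Delta> c)"
proof -
  have "orbits (perm_group (colours_at \<Delta> v) (local_group \<Delta> v)) (colours_at \<Delta> v) (\<lambda>g. g) =
      colours \<Delta> ` arcs_from \<Gamma> v"
    using v lad by (simp add: local_action_diagrams_def)
  then have "{s c | s. s \<in> local_group \<Delta> v} \<in> colours \<Delta> ` arcs_from \<Gamma> v"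
    using c by (auto simp: orbits_def orbit_def)
  then obtain a where a: "a \<in> arcs \<Gamma>" "{s c | s. s \<in> local_group \<Delta> v} = colours \<Delta> a"
    by (auto simp: arcs_from_def)
  moreover have "c \<in> {s c | s. s \<in> local_group \<Delta> v}"
    using local_group_id[OF v] c by (metis (mono_tags, lifting) mem_Collect_eq restrict_apply')
  ultimately show ?thesis using arc_of_eq by simp
qed

lemma arc_of_local_group:
  assumes "v \<in> verts \<Gamma>" "c \<in> colours_at \<Delta> v" "s \<in> local_group \<Delta> v"
  shows "arc_of \<Delta> (s c) = arc_of \<Delta> c"
  using local_orbit[OF assms(1,2)] assms(3) arc_of_colours_at[OF assms(2)] by (intro arc_of_eq) auto

lemma local_group_transitive:
  assumes "v \<in> verts \<Gamma>" "c \<in> colours_at \<Delta> v" "c' \<in> colours_at \<Delta> v" "arc_of \<Delta> c = arc_of \<Delta> c'"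
  shows "\<exists>s\<in>local_group \<Delta> v. s c = c'"
proof -
  have "c' \<in> {s c | s. s \<in> local_group \<Delta> v}"
    using local_orbit[OF assms(1,2)] arc_of_colours_at(3)[OF assms(3)] assms(4) by simp
  then show ?thesis by blast
qed

end

text \<open>The projection of arcs from \<open>T\<close> to the graph of \<open>\<Delta>\<close> is \<open>arc_of \<Delta> \<circ> L\<close>.\<close>

definition delta_tree ::
  "('w, 'f, 'c) lad \<Rightarrow> ('v, 'e) graph \<Rightarrow> ('v \<Rightarrow> 'w) \<Rightarrow> ('e \<Rightarrow> 'c) \<Rightarrow> bool" where
  "delta_tree \<Delta> T \<pi> L \<longleftrightarrow> tree T \<and>
     (\<forall>v\<in>verts T. \<pi> v \<in> verts (lad_graph \<Delta>) \<and> bij_betw L (arcs_from T v) (colours_at \<Delta> (\<pi> v))) \<and>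
     (\<forall>a\<in>arcs T. arc_of \<Delta> (L (reversal T a)) = reversal (lad_graph \<Delta>) (arc_of \<Delta> (L a)))"

text \<open>Labels are compared only up to the local groups, but one group element has to serve a
  whole star. For \<open>T' = T\<close> this is the condition that defines the universal
  group.\<close>

definition delta_iso where
  "delta_iso \<Delta> T \<pi> L T' \<pi>' L' f h \<longleftrightarrow> graph_iso T T' f h \<and>
     (\<forall>v\<in>verts T. \<pi>' (f v) = \<pi> v \<and>
        (\<exists>s\<in>local_group \<Delta> (\<pi> v). \<forall>a\<in>arcs_from T v. L' (h a) = s (L a)))"

locale labelled_tree = action_diagram \<Delta> for \<Delta> :: "('w, 'f, 'c) lad" +
  fixes T :: "('v, 'e) graph" and \<pi> :: "'v \<Rightarrow> 'w" and L :: "'e \<Rightarrow> 'c"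
  assumes delta: "delta_tree \<Delta> T \<pi> L"
begin

lemma is_tree: "tree T" and proj_in: "v \<in> verts T \<Longrightarrow> \<pi> v \<in> verts \<Gamma>"
  and label_bij: "v \<in> verts T \<Longrightarrow> bij_betw L (arcs_from T v) (colours_at \<Delta> (\<pi> v))"
  and arc_of_rev: "a \<in> arcs T \<Longrightarrow> arc_of \<Delta> (L (reversal T a)) = reversal \<Gamma> (arc_of \<Delta> (L a))"
  using delta by (auto simp: delta_tree_def)

lemma wf_T: "wf_graph T" and simple_T: "simple_graph T" and connected_T: "connected_graph T"
  using is_tree by (auto simp: tree_def)

lemma label_in: "a \<in> arcs T \<Longrightarrow> L a \<in> colours_at \<Delta> (\<pi> (orig T a))"
  using label_bij[OF wf_graphD(1)[OF wf_T]] by (auto simp: bij_betw_def arcs_from_def)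

lemma label_inj:
  assumes "a \<in> arcs T" "b \<in> arcs T" "orig T a = orig T b" "L a = L b"
  shows "a = b"
  using bij_betw_imp_inj_on[OF label_bij[OF wf_graphD(1)[OF wf_T assms(1)]]] assms
  by (auto simp: inj_on_def arcs_from_def)

lemma label_surj:
  assumes "v \<in> verts T" "c \<in> colours_at \<Delta> (\<pi> v)"
  obtains a where "a \<in> arcs T" "orig T a = v" "L a = c"
proof -
  have "c \<in> L ` arcs_from T v" using label_bij[OF assms(1)] assms(2) by (simp add: bij_betw_def)
  then show thesis using that by (auto simp: arcs_from_iff)
qed

lemma arc_of_label:
  assumes "a \<in> arcs T"
  shows "arc_of \<Delta> (L a) \<in> arcs \<Gamma>" "orig \<Gamma> (arc_of \<Delta> (L a)) = \<pi> (orig T a)"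
    "terminus \<Gamma> (arc_of \<Delta> (L a)) = \<pi> (terminus T a)"
proof -
  show "arc_of \<Delta> (L a) \<in> arcs \<Gamma>" "orig \<Gamma> (arc_of \<Delta> (L a)) = \<pi> (orig T a)"
    using arc_of_colours_at[OF label_in[OF assms]] by blast+
  have "terminus \<Gamma> (arc_of \<Delta> (L a)) = \<pi> (orig T (reversal T a))"
    using arc_of_colours_at(2)[OF label_in[OF wf_graphD(3)[OF wf_T assms]]]
    unfolding terminus_def arc_of_rev[OF assms] .
  then show "terminus \<Gamma> (arc_of \<Delta> (L a)) = \<pi> (terminus T a)" by (simp only: terminus_def)
qed

text \<open>Walks in the graph of \<open>\<Delta>\<close> lift arc by arc: an arc has at least one
  colour, and each colour at \<open>\<pi> v\<close> occurs in the star of \<open>v\<close>.\<close>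

lemma proj_surj: "w \<in> verts \<Gamma> \<Longrightarrow> \<exists>v\<in>verts T. \<pi> v = w"
proof -
  assume w: "w \<in> verts \<Gamma>"
  obtain v0 where v0: "v0 \<in> verts T" using connected_T by (auto simp: connected_graph_def)
  have "(\<pi> v0, w) \<in> (adjacency \<Gamma>)\<^sup>*" using connected_lad w proj_in[OF v0] by (simp add: connected_graph_def)
  then show ?thesis
  proof (induction rule: rtrancl_induct)
    case base
    then show ?case using v0 by blast
  next
    case (step y z)
    then obtain v where v: "v \<in> verts T" "\<pi> v = y" by blast
    from step(2) obtain e where e: "e \<in> arcs \<Gamma>" "orig \<Gamma> e = y" "terminus \<Gamma> e = z" by (rule adjacencyE)
    obtain c where c: "c \<in> colours \<Delta> e" using colours_nonempty[OF e(1)] by blast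
    then have "c \<in> colours_at \<Delta> (\<pi> v)" using colours_atI[OF e(1)] e v by simp
    then obtain a where a: "a \<in> arcs T" "orig T a = v" "L a = c" using label_surj v by blast
    then have "\<pi> (terminus T a) = z" using arc_of_label(3)[OF a(1)] arc_of_eq[OF e(1) c] e by simp
    then show ?case using wf_graphD(2)[OF wf_T a(1)] by blast
  qed
qed

end

locale labelled_tree_pair = labelled_tree \<Delta> T \<pi> L + T': labelled_tree \<Delta> T' \<pi>' L'
  for \<Delta> :: "('w, 'f, 'c) lad" and T :: "('v, 'e) graph" and \<pi> L
    and T' :: "('v1, 'e1) graph" and \<pi>' L'
begin

text \<open>The isomorphism is built outwards from \<open>v0\<close>, together with a local action
  at each vertex. At a new vertex the local action is constrained only on the arc back to the
  parent. Its required value lies in the same colour set as its label, and the local group is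
  transitive on colour sets, so the construction never gets stuck.\<close>

theorem extend_local_action:
  assumes v0: "v0 \<in> verts T" "v0' \<in> verts T'" "\<pi>' v0' = \<pi> v0" and s0: "s0 \<in> local_group \<Delta> (\<pi> v0)"
  shows "\<exists>f h. delta_iso \<Delta> T \<pi> L T' \<pi>' L' f h \<and> f v0 = v0' \<and>
    (\<forall>a\<in>arcs_from T v0. L' (h a) = s0 (L a))"
proof -
  obtain level par where "rooted_tree T v0 level par" using tree_rooted[OF is_tree v0(1)] by blast
  then interpret rooted_tree T v0 level par .
  define arc' where "arc' v' c = (SOME b. b \<in> arcs T' \<and> orig T' b = v' \<and> L' b = c)" for v' c
  \<comment> \<open>The state at a vertex is the pair of its image and its local action. The second
    component is chosen so that the arc back to the parent goes to the reverse of the image of the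
    arc that led here.\<close>
  define F where "F w = (\<lambda>(v', t). let b = arc' v' (t (L (down_arc w))) in
      (terminus T' b, SOME s. s \<in> local_group \<Delta> (\<pi> w) \<and>
        s (L (reversal T (down_arc w))) = L' (reversal T' b)))" for w
  obtain st where st: "st v0 = (v0', s0)" "\<And>w. w \<in> verts T \<Longrightarrow> w \<noteq> v0 \<Longrightarrow> st w = F w (st (par w))"
    using rooted_recursion[of "(v0', s0)" F] by blast
  define f where "f w = fst (st w)" for w
  define \<sigma> where "\<sigma> w = snd (st w)" for w
  define h where "h a = arc' (f (orig T a)) (\<sigma> (orig T a) (L a))" for a
  define ok where "ok w \<longleftrightarrow> f w \<in> verts T' \<and> \<pi>' (f w) = \<pi> w \<and> \<sigma> w \<in> local_group \<Delta> (\<pi> w)" for w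
  have h: "h a \<in> arcs T'" "orig T' (h a) = f (orig T a)" "L' (h a) = \<sigma> (orig T a) (L a)"
    if a: "a \<in> arcs T" and ok: "ok (orig T a)" for a
  proof -
    have "\<sigma> (orig T a) (L a) \<in> colours_at \<Delta> (\<pi>' (f (orig T a)))"
      using ok BijD(1)[OF local_group_Bij[OF proj_in[OF wf_graphD(1)[OF wf_T a]]] label_in[OF a]]
      by (simp add: ok_def)
    then have "\<exists>b. b \<in> arcs T' \<and> orig T' b = f (orig T a) \<and> L' b = \<sigma> (orig T a) (L a)"
      using T'.label_surj ok unfolding ok_def by metis
    from someI_ex[OF this]
    show "h a \<in> arcs T'" "orig T' (h a) = f (orig T a)" "L' (h a) = \<sigma> (orig T a) (L a)"
      by (simp_all add: h_def arc'_def)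
  qed
  have step: "f w = terminus T' (h (down_arc w)) \<and> ok w \<and>
      \<sigma> w (L (reversal T (down_arc w))) = L' (reversal T' (h (down_arc w)))"
    if w: "w \<in> verts T" "w \<noteq> v0" and ok: "ok (par w)" for w
  proof -
    note d = down_arc[OF w]
    let ?a = "down_arc w"
    have b: "h ?a \<in> arcs T'" "orig T' (h ?a) = f (par w)" "L' (h ?a) = \<sigma> (par w) (L ?a)"
      using h[OF d(1)] ok by (simp_all add: d)
    have "st w = (let b = h ?a in (terminus T' b, SOME s. s \<in> local_group \<Delta> (\<pi> w) \<and>
        s (L (reversal T ?a)) = L' (reversal T' b)))"
      using st(2)[OF w] by (simp add: F_def h_def d f_def \<sigma>_def split_beta)
    then have fw: "f w = terminus T' (h ?a)" and
      \<sigma>w: "\<sigma> w = (SOME s. s \<in> local_group \<Delta> (\<pi> w) \<and> s (L (reversal T ?a)) = L' (reversal T' (h ?a)))"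
      by (simp_all add: f_def \<sigma>_def Let_def)
    have pw: "par w \<in> verts T" using par_in[OF w(1)] .
    \<comment> \<open>Local groups preserve colour sets, so arcs stay over the same arc of the graph
      of \<open>\<Delta>\<close>; this gives both the projection of the new vertex and the colour
      set of the reverse arc.\<close>
    have arc: "arc_of \<Delta> (L' (h ?a)) = arc_of \<Delta> (L ?a)"
      unfolding b(3) using ok label_in[OF d(1)] d
      by (intro arc_of_local_group[OF proj_in[OF pw]]) (simp_all add: ok_def)
    have \<pi>w: "\<pi>' (f w) = \<pi> w"
      using T'.arc_of_label(3)[OF b(1)] arc_of_label(3)[OF d(1)] arc fw d by simp
    have "\<exists>s\<in>local_group \<Delta> (\<pi> w). s (L (reversal T ?a)) = L' (reversal T' (h ?a))"
    proof (rule local_group_transitive[OF proj_in[OF w(1)]])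
      show "L (reversal T ?a) \<in> colours_at \<Delta> (\<pi> w)"
        using label_in[OF wf_graphD(3)[OF wf_T d(1)]] wf_graphD(5)[OF wf_T d(1)] d by simp
      show "L' (reversal T' (h ?a)) \<in> colours_at \<Delta> (\<pi> w)"
        using T'.label_in[OF wf_graphD(3)[OF T'.wf_T b(1)]] wf_graphD(5)[OF T'.wf_T b(1)] fw \<pi>w by simp
      show "arc_of \<Delta> (L (reversal T ?a)) = arc_of \<Delta> (L' (reversal T' (h ?a)))"
        using arc arc_of_rev[OF d(1)] T'.arc_of_rev[OF b(1)] by simp
    qed
    then have "\<exists>s. s \<in> local_group \<Delta> (\<pi> w) \<and> s (L (reversal T ?a)) = L' (reversal T' (h ?a))" by blast
    from someI_ex[OF this] have "\<sigma> w \<in> local_group \<Delta> (\<pi> w)"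
        "\<sigma> w (L (reversal T ?a)) = L' (reversal T' (h ?a))"
      by (simp_all add: \<sigma>w)
    then show ?thesis
      using fw \<pi>w wf_graphD(2)[OF T'.wf_T b(1)] by (simp add: ok_def)
  qed
  have ok: "ok w" if "w \<in> verts T" for w
    using that
  proof (induction w rule: rooted_induct)
    case base
    then show ?case using v0 s0 st(1) by (simp add: ok_def f_def \<sigma>_def)
  next
    case (par w)
    then show ?case using step[OF par.hyps par.IH] by simp
  qed
  note h = h[OF _ ok[OF wf_graphD(1)[OF wf_T]]]
  \<comment> \<open>Two arcs with the same origin are equal once their labels are, and equality of
    these labels is the condition under which \<open>\<sigma> w\<close> was chosen.\<close>
  have h_down: "h (reversal T (down_arc w)) = reversal T' (h (down_arc w))"
    if w: "w \<in> verts T" "w \<noteq> v0" for w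
  proof (rule T'.label_inj)
    note d = down_arc[OF w]
    note s = step[OF w ok[OF par_in[OF w(1)]]]
    note rd = wf_graphD[OF wf_T d(1)]
    note h1 = h[OF d(1) d(1)] and h2 = h[OF rd(3) rd(3)]
    show "h (reversal T (down_arc w)) \<in> arcs T'" "reversal T' (h (down_arc w)) \<in> arcs T'"
      using h1 h2 wf_graphD(3)[OF T'.wf_T] by simp_all
    show "orig T' (h (reversal T (down_arc w))) = orig T' (reversal T' (h (down_arc w)))"
      using h1 h2 s wf_graphD(5)[OF T'.wf_T] rd(5) d(3) by simp
    show "L' (h (reversal T (down_arc w))) = L' (reversal T' (h (down_arc w)))"
      using h2 s rd(5) d(3) by simp
  qed
  have h_rev: "h (reversal T a) = reversal T' (h a)" if a: "a \<in> arcs T" for a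
    using a
  proof (cases a rule: arc_cases)
    case (down w)
    then show ?thesis using h_down by simp
  next
    case (up w)
    have "h (reversal T (reversal T a)) = reversal T' (h (reversal T a))"
      using h_down[OF up(1,2)] up(3) by simp
    then have "h a = reversal T' (h (reversal T a))" using wf_graphD(4)[OF wf_T a] by simp
    moreover have "h (reversal T a) \<in> arcs T'" using h(1) wf_graphD(3)[OF wf_T a] by blast
    ultimately show ?thesis using wf_graphD(4)[OF T'.wf_T] by simp
  qed
  have star: "bij_betw h (arcs_from T w) (arcs_from T' (f w))" if w: "w \<in> verts T" for w
  proof -
    have ow: "f w \<in> verts T'" "\<pi>' (f w) = \<pi> w" "\<sigma> w \<in> local_group \<Delta> (\<pi> w)"
      using ok[OF w] by (simp_all add: ok_def)
    have \<sigma>: "bij_betw (\<sigma> w) (colours_at \<Delta> (\<pi> w)) (colours_at \<Delta> (\<pi> w))"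
      using local_group_Bij[OF proj_in[OF w] ow(3)] by (simp add: Bij_def)
    have "bij_betw (\<sigma> w \<circ> L) (arcs_from T w) (colours_at \<Delta> (\<pi> w))"
      by (rule bij_betw_trans[OF label_bij[OF w] \<sigma>])
    also have "?this \<longleftrightarrow> bij_betw (L' \<circ> h) (arcs_from T w) (colours_at \<Delta> (\<pi> w))"
      by (rule bij_betw_cong) (simp add: arcs_from_iff h)
    finally have "bij_betw (L' \<circ> h) (arcs_from T w) (colours_at \<Delta> (\<pi> w))" .
    moreover have "bij_betw L' (arcs_from T' (f w)) (colours_at \<Delta> (\<pi> w))"
      using T'.label_bij[OF ow(1)] ow(2) by simp
    moreover have "h ` arcs_from T w \<subseteq> arcs_from T' (f w)"
      using h by (auto simp: arcs_from_iff)
    ultimately show ?thesis using bij_betw_comp_iff2 by blast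
  qed
  \<comment> \<open>Only bijectivity on stars has been established; on trees this is enough.\<close>
  have "graph_iso T T' f h"
    by (rule local_iso_imp_graph_iso[OF is_tree T'.is_tree])
      (use h h_rev ok star in \<open>auto simp: ok_def\<close>)
  moreover have "\<forall>v\<in>verts T. \<pi>' (f v) = \<pi> v \<and>
        (\<exists>s\<in>local_group \<Delta> (\<pi> v). \<forall>a\<in>arcs_from T v. L' (h a) = s (L a))"
  proof
    fix v assume v: "v \<in> verts T"
    have "\<sigma> v \<in> local_group \<Delta> (\<pi> v)" "\<pi>' (f v) = \<pi> v" using ok[OF v] by (simp_all add: ok_def)
    moreover have "\<forall>a\<in>arcs_from T v. L' (h a) = \<sigma> v (L a)" by (auto simp: arcs_from_iff h)
    ultimately show "\<pi>' (f v) = \<pi> v \<and>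
        (\<exists>s\<in>local_group \<Delta> (\<pi> v). \<forall>a\<in>arcs_from T v. L' (h a) = s (L a))" by blast
  qed
  moreover have "f v0 = v0'" "\<forall>a\<in>arcs_from T v0. L' (h a) = s0 (L a)"
    using st(1) h by (auto simp: f_def \<sigma>_def arcs_from_iff)
  ultimately show ?thesis unfolding delta_iso_def by blast
qed

end

section \<open>Universal groups\<close>

text \<open>An element of the product of the images is a choice of one \<open>k x\<close> for each
  fibre, so surjectivity says that such a family can be patched to a single element.\<close>

lemma property_P_iff:
  "property_P T G \<longleftrightarrow> (\<forall>P k. path_verts T P \<longrightarrow> (\<forall>x\<in>P. k x \<in> pointwise_stabiliser G P) \<longrightarrow>
     (\<exists>g\<in>pointwise_stabiliser G P. \<forall>x\<in>P. \<forall>v\<in>path_fibre T P x. g v = k x v))"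
proof -
  have "(\<lambda>g. \<lambda>x\<in>P. restrict g (path_fibre T P x)) ` pointwise_stabiliser G P =
        (\<Pi>\<^sub>E x\<in>P. (\<lambda>g. restrict g (path_fibre T P x)) ` pointwise_stabiliser G P) \<longleftrightarrow>
      (\<forall>k. (\<forall>x\<in>P. k x \<in> pointwise_stabiliser G P) \<longrightarrow>
     (\<exists>g\<in>pointwise_stabiliser G P. \<forall>x\<in>P. \<forall>v\<in>path_fibre T P x. g v = k x v))"
    (is "?l ` ?G = ?R \<longleftrightarrow> ?Q") for P
  proof
    assume eq: "?l ` ?G = ?R"
    show ?Q
    proof (intro allI impI)
      fix k assume k: "\<forall>x\<in>P. k x \<in> ?G"
      then have "(\<lambda>x\<in>P. restrict (k x) (path_fibre T P x)) \<in> ?R" by auto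
      then obtain g where g: "g \<in> ?G" "(\<lambda>x\<in>P. restrict (k x) (path_fibre T P x)) = ?l g"
        unfolding eq[symmetric] by blast
      have "g v = k x v" if "x \<in> P" "v \<in> path_fibre T P x" for x v
        using fun_cong[OF fun_cong[OF g(2), of x], of v] that by simp
      then show "\<exists>g\<in>?G. \<forall>x\<in>P. \<forall>v\<in>path_fibre T P x. g v = k x v" using g(1) by blast
    qed
  next
    assume Q: ?Q
    have "F \<in> ?l ` ?G" if F: "F \<in> ?R" for F
    proof -
      have "\<forall>x\<in>P. \<exists>k. k \<in> ?G \<and> F x = restrict k (path_fibre T P x)"
        using F by (auto simp: PiE_def Pi_def)
      then obtain k where k: "\<And>x. x \<in> P \<Longrightarrow> k x \<in> ?G"
          "\<And>x. x \<in> P \<Longrightarrow> F x = restrict (k x) (path_fibre T P x)"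
        unfolding bchoice_iff by blast
      then obtain g where g: "g \<in> ?G" "\<forall>x\<in>P. \<forall>v\<in>path_fibre T P x. g v = k x v"
        using Q by blast
      have "F = ?l g"
      proof (rule PiE_ext[OF F])
        show "?l g \<in> ?R" using g(1) by auto
        show "F x = ?l g x" if "x \<in> P" for x
          using g(2) that k(2)[OF that] by (simp cong: restrict_cong)
      qed
      then show ?thesis using g(1) by blast
    qed
    then show "?l ` ?G = ?R" by auto
  qed
  then show ?thesis unfolding property_P_def Let_def by simp
qed

lemma closedin_tree_Aut_iff:
  assumes G: "G \<subseteq> tree_Aut T"
  shows "closedin (subtopology (perm_topology (verts T)) (tree_Aut T)) G \<longleftrightarrow>
    (\<forall>g\<in>tree_Aut T. (\<forall>F. finite F \<and> F \<subseteq> verts T \<longrightarrow> (\<exists>h\<in>G. \<forall>x\<in>F. h x = g x)) \<longrightarrow> g \<in> G)"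
    (is "?L \<longleftrightarrow> ?R")
proof -
  let ?X = "perm_topology (verts T)"
  have A: "tree_Aut T \<subseteq> Bij (verts T)" using tree_Aut_Bij by blast
  then have GB: "G \<subseteq> Bij (verts T)" using G by blast
  then have GX: "G \<subseteq> topspace ?X" by (simp add: topspace_perm_topology carrier_BijGroup)
  have "?L \<longleftrightarrow> tree_Aut T \<inter> ?X closure_of G \<subseteq> G"
  proof
    assume ?L
    then obtain C where "closedin ?X C" "G = C \<inter> tree_Aut T" unfolding closedin_subtopology by blast
    then show "tree_Aut T \<inter> ?X closure_of G \<subseteq> G" using closure_of_minimal[of G C ?X] by blast
  next
    assume "tree_Aut T \<inter> ?X closure_of G \<subseteq> G"
    then have "G = ?X closure_of G \<inter> tree_Aut T" using closure_of_subset[OF GX] G by blast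
    then show ?L unfolding closedin_subtopology using closedin_closure_of by blast
  qed
  also have "\<dots> \<longleftrightarrow> ?R" using in_perm_closure_iff[OF GB] A by blast
  finally show ?thesis .
qed

lemma graph_iso_star:
  assumes iso: "graph_iso T T' f h" and wf: "wf_graph T" and v: "v \<in> verts T"
  shows "bij_betw h (arcs_from T v) (arcs_from T' (f v))"
  unfolding bij_betw_def
proof
  note f = graph_isoD(1)[OF iso, unfolded bij_betw_def] and h = graph_isoD(2)[OF iso, unfolded bij_betw_def]
  show "inj_on h (arcs_from T v)" using h by (auto simp: arcs_from_def intro: inj_on_subset)
  have "h a \<in> arcs_from T' (f v)" if "a \<in> arcs_from T v" for a
    using that graph_isoD(3)[OF iso] graph_iso_in(2)[OF iso] by (simp add: arcs_from_iff)
  moreover have "b \<in> h ` arcs_from T v" if b: "b \<in> arcs_from T' (f v)" for b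
  proof -
    obtain a where a: "a \<in> arcs T" "b = h a" using b h by (auto simp: arcs_from_iff)
    then have "f (orig T a) = f v" using b graph_isoD(3)[OF iso a(1)] by (simp add: arcs_from_iff)
    then have "orig T a = v" using inj_onD[of f "verts T"] f wf_graphD(1)[OF wf a(1)] v by blast
    then show ?thesis using a by (auto simp: arcs_from_iff)
  qed
  ultimately show "h ` arcs_from T v = arcs_from T' (f v)" by blast
qed

text \<open>The elements \<open>k\<close> may differ from vertex to vertex. An arc has the same
  image under the elements chosen for its two ends, since each agrees with \<open>g\<close> at both;
  so the arc maps fit together, and bijectivity on stars suffices.\<close>

lemma tree_Aut_gluing:
  assumes T: "tree T" and ext: "g \<in> extensional (verts T)"
    and loc: "\<And>v. v \<in> verts T \<Longrightarrow>
      \<exists>k\<in>tree_Aut T. k v = g v \<and> (\<forall>a\<in>arcs_from T v. k (terminus T a) = g (terminus T a))"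
  shows "g \<in> tree_Aut T"
proof -
  have wf: "wf_graph T" and simple: "simple_graph T" using T by (auto simp: tree_def)
  obtain k where k: "\<And>v. v \<in> verts T \<Longrightarrow> k v \<in> tree_Aut T" "\<And>v. v \<in> verts T \<Longrightarrow> k v v = g v"
      "\<And>v a. v \<in> verts T \<Longrightarrow> a \<in> arcs_from T v \<Longrightarrow> k v (terminus T a) = g (terminus T a)"
    using loc by metis
  define h where "h a = arc_map T (k (orig T a)) a" for a
  have h: "h a \<in> arcs T" "orig T (h a) = g (orig T a)" "terminus T (h a) = g (terminus T a)"
    if a: "a \<in> arcs T" for a
  proof -
    have v: "orig T a \<in> verts T" using wf_graphD(1)[OF wf a] .
    note iso = tree_Aut_iso[OF T k(1)[OF v]]
    show "h a \<in> arcs T" "orig T (h a) = g (orig T a)" "terminus T (h a) = g (terminus T a)"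
      unfolding h_def using graph_iso_in(2)[OF iso a] graph_isoD(3)[OF iso a] graph_iso_terminus[OF iso wf a]
        k(2)[OF v] k(3)[OF v, of a] a by (simp_all add: arcs_from_iff)
  qed
  have "graph_iso T T g h"
  proof (rule local_iso_imp_graph_iso[OF T T])
    show "orig T (h a) = g (orig T a)" if "a \<in> arcs T" for a using h(2)[OF that] .
    show "g v \<in> verts T" if "v \<in> verts T" for v
      using graph_iso_in(1)[OF tree_Aut_iso[OF T k(1)[OF that]] that] k(2)[OF that] by simp
    show "bij_betw h (arcs_from T v) (arcs_from T (g v))" if v: "v \<in> verts T" for v
    proof -
      have "bij_betw (arc_map T (k v)) (arcs_from T v) (arcs_from T (g v))"
        using graph_iso_star[OF tree_Aut_iso[OF T k(1)[OF v]] wf v] k(2)[OF v] by simp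
      then show ?thesis by (rule bij_betw_cong[THEN iffD1, rotated]) (simp add: h_def arcs_from_iff)
    qed
    show "h (reversal T a) = reversal T (h a)" if a: "a \<in> arcs T" for a
      using h[OF a] h[OF wf_graphD(3)[OF wf a]] wf_graphD[OF wf a] wf_graphD[OF wf h(1)[OF a]]
      by (intro simple_graph_arc_eq[OF simple]) simp_all
  qed
  then show ?thesis using ext by (auto simp: tree_Aut_def carrier_BijGroup Bij_def graph_iso_def)
qed

section \<open>Identity, composition and inverse of isomorphisms of labelled trees\<close>

lemma delta_isoD:
  assumes "delta_iso \<Delta> T \<pi> L T' \<pi>' L' f h"
  shows "graph_iso T T' f h" "v \<in> verts T \<Longrightarrow> \<pi>' (f v) = \<pi> v"
    "v \<in> verts T \<Longrightarrow> \<exists>s\<in>local_group \<Delta> (\<pi> v). \<forall>a\<in>arcs_from T v. L' (h a) = s (L a)"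
  using assms by (auto simp: delta_iso_def)

lemma delta_iso_cong:
  assumes "delta_iso \<Delta> T \<pi> L T' \<pi>' L' f h" "wf_graph T"
    "\<And>v. v \<in> verts T \<Longrightarrow> f' v = f v" "\<And>a. a \<in> arcs T \<Longrightarrow> h' a = h a"
  shows "delta_iso \<Delta> T \<pi> L T' \<pi>' L' f' h'"
  unfolding delta_iso_def
proof (intro conjI ballI)
  show "graph_iso T T' f' h'" by (rule graph_iso_cong[OF delta_isoD(1)[OF assms(1)] assms(2-4)])
  fix v assume v: "v \<in> verts T"
  show "\<pi>' (f' v) = \<pi> v" using delta_isoD(2)[OF assms(1) v] assms(3)[OF v] by simp
  show "\<exists>s\<in>local_group \<Delta> (\<pi> v). \<forall>a\<in>arcs_from T v. L' (h' a) = s (L a)"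
    using delta_isoD(3)[OF assms(1) v] assms(4) by (simp add: arcs_from_iff)
qed

lemma (in labelled_tree) delta_iso_id: "delta_iso \<Delta> T \<pi> L T \<pi> L id id"
  unfolding delta_iso_def
proof (intro conjI ballI)
  fix v assume v: "v \<in> verts T"
  show "\<exists>s\<in>local_group \<Delta> (\<pi> v). \<forall>a\<in>arcs_from T v. L (id a) = s (L a)"
    by (rule bexI[OF _ local_group_id[OF proj_in[OF v]]]) (auto simp: arcs_from_iff label_in)
qed (simp_all add: graph_iso_id)

lemma (in labelled_tree) delta_iso_comp:
  assumes f: "delta_iso \<Delta> T \<pi> L T' \<pi>' L' f h" and f': "delta_iso \<Delta> T' \<pi>' L' T'' \<pi>'' L'' f' h'"
  shows "delta_iso \<Delta> T \<pi> L T'' \<pi>'' L'' (f' \<circ> f) (h' \<circ> h)"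
  unfolding delta_iso_def
proof (intro conjI ballI)
  note iso = delta_isoD(1)[OF f]
  show "graph_iso T T'' (f' \<circ> f) (h' \<circ> h)" by (rule graph_iso_comp[OF iso delta_isoD(1)[OF f']])
  fix v assume v: "v \<in> verts T"
  have fv: "f v \<in> verts T'" using graph_iso_in(1)[OF iso v] .
  show "\<pi>'' ((f' \<circ> f) v) = \<pi> v" using delta_isoD(2)[OF f v] delta_isoD(2)[OF f' fv] by simp
  obtain s where s: "s \<in> local_group \<Delta> (\<pi> v)" "\<forall>a\<in>arcs_from T v. L' (h a) = s (L a)"
    using delta_isoD(3)[OF f v] by blast
  obtain s' where s': "s' \<in> local_group \<Delta> (\<pi> v)" "\<forall>a\<in>arcs_from T' (f v). L'' (h' a) = s' (L' a)"
    using delta_isoD(3)[OF f' fv] delta_isoD(2)[OF f v] by auto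
  show "\<exists>s\<in>local_group \<Delta> (\<pi> v). \<forall>a\<in>arcs_from T v. L'' ((h' \<circ> h) a) = s (L a)"
  proof (intro bexI ballI)
    show "compose (colours_at \<Delta> (\<pi> v)) s' s \<in> local_group \<Delta> (\<pi> v)"
      by (rule local_group_compose[OF proj_in[OF v] s'(1) s(1)])
    fix a assume a: "a \<in> arcs_from T v"
    then have "h a \<in> arcs_from T' (f v)"
      using graph_isoD(3)[OF iso] graph_iso_in(2)[OF iso] by (simp add: arcs_from_iff)
    then show "L'' ((h' \<circ> h) a) = compose (colours_at \<Delta> (\<pi> v)) s' s (L a)"
      using s s' a label_in by (auto simp: compose_def arcs_from_iff)
  qed
qed

lemma (in labelled_tree) delta_iso_inv:
  assumes f: "delta_iso \<Delta> T \<pi> L T' \<pi>' L' f h"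
  shows "delta_iso \<Delta> T' \<pi>' L' T \<pi> L (inv_into (verts T) f) (inv_into (arcs T) h)"
  unfolding delta_iso_def
proof (intro conjI ballI)
  note iso = delta_isoD(1)[OF f]
  show "graph_iso T' T (inv_into (verts T) f) (inv_into (arcs T) h)" by (rule graph_iso_inv[OF iso wf_T])
  fix v' assume "v' \<in> verts T'"
  then obtain v where v: "v \<in> verts T" "v' = f v"
    using graph_isoD(1)[OF iso] unfolding bij_betw_def by blast
  have inv: "inv_into (verts T) f v' = v"
    using graph_isoD(1)[OF iso] v unfolding bij_betw_def by (metis inv_into_f_f)
  have \<pi>: "\<pi>' v' = \<pi> v" using delta_isoD(2)[OF f v(1)] v(2) by simp
  then show "\<pi> (inv_into (verts T) f v') = \<pi>' v'" by (simp add: inv)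
  obtain s where s: "s \<in> local_group \<Delta> (\<pi> v)" "\<forall>a\<in>arcs_from T v. L' (h a) = s (L a)"
    using delta_isoD(3)[OF f v(1)] by blast
  let ?X = "colours_at \<Delta> (\<pi> v)"
  show "\<exists>s\<in>local_group \<Delta> (\<pi>' v'). \<forall>b\<in>arcs_from T' v'. L (inv_into (arcs T) h b) = s (L' b)"
    unfolding \<pi>
  proof (intro bexI ballI)
    show "restrict (inv_into ?X s) ?X \<in> local_group \<Delta> (\<pi> v)"
      by (rule local_group_inv[OF proj_in[OF v(1)] s(1)])
    fix b assume "b \<in> arcs_from T' v'"
    then obtain a where a: "a \<in> arcs_from T v" "b = h a"
      using graph_iso_star[OF iso wf_T v(1)] v(2) unfolding bij_betw_def by blast
    then have La: "L a \<in> ?X" using label_in by (auto simp: arcs_from_iff)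
    note sB = local_group_Bij[OF proj_in[OF v(1)] s(1)]
    have "inv_into (arcs T) h b = a"
      using graph_isoD(2)[OF iso] a unfolding bij_betw_def arcs_from_iff by (metis inv_into_f_f)
    moreover have "L' b = s (L a)" using s a by simp
    ultimately show "L (inv_into (arcs T) h b) = restrict (inv_into ?X s) ?X (L' b)"
      using BijD(1,4)[OF sB La] by simp
  qed
qed

definition universal_group ::
  "('w, 'f, 'c) lad \<Rightarrow> ('v, 'e) graph \<Rightarrow> ('v \<Rightarrow> 'w) \<Rightarrow> ('e \<Rightarrow> 'c) \<Rightarrow> ('v \<Rightarrow> 'v) set" where
  "universal_group \<Delta> T \<pi> L = {g \<in> tree_Aut T. delta_iso \<Delta> T \<pi> L T \<pi> L g (arc_map T g)}"

section \<open>The universal group as a (P)-closed group\<close>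

context labelled_tree
begin

abbreviation "U \<equiv> universal_group \<Delta> T \<pi> L"

lemma universal_group_tree_Aut: "U \<subseteq> tree_Aut T"
  by (auto simp: universal_group_def)

lemma universal_groupD:
  assumes "g \<in> U"
  shows "g \<in> tree_Aut T" "delta_iso \<Delta> T \<pi> L T \<pi> L g (arc_map T g)"
  using assms by (auto simp: universal_group_def)

lemma universal_groupI:
  assumes f: "delta_iso \<Delta> T \<pi> L T \<pi> L f h"
  shows "restrict f (verts T) \<in> U"
proof -
  let ?g = "restrict f (verts T)"
  have g: "delta_iso \<Delta> T \<pi> L T \<pi> L ?g h" by (rule delta_iso_cong[OF f wf_T]) simp_all
  note iso = delta_isoD(1)[OF g]
  have "?g \<in> tree_Aut T"
    using iso unfolding tree_Aut_def carrier_BijGroup Bij_def graph_iso_def by auto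
  moreover have "delta_iso \<Delta> T \<pi> L T \<pi> L ?g (arc_map T ?g)"
    by (rule delta_iso_cong[OF g wf_T]) (simp_all add: arc_map_eq[OF is_tree iso])
  ultimately show ?thesis by (simp add: universal_group_def)
qed

lemma subgroup_universal_group: "subgroup U (BijGroup (verts T))"
  unfolding subgroup_BijGroup_iff
proof (intro conjI ballI)
  show "U \<subseteq> Bij (verts T)" using universal_group_tree_Aut tree_Aut_Bij by blast
  show "(\<lambda>x\<in>verts T. x) \<in> U" using universal_groupI[OF delta_iso_id] by (simp add: restrict_def id_def)
  show "compose (verts T) g h \<in> U" if "g \<in> U" "h \<in> U" for g h
    using universal_groupI[OF delta_iso_comp[OF universal_groupD(2)[OF that(2)] universal_groupD(2)[OF that(1)]]]
    by (simp add: compose_def comp_def)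
  show "restrict (inv_into (verts T) g) (verts T) \<in> U" if "g \<in> U" for g
    by (rule universal_groupI[OF delta_iso_inv[OF universal_groupD(2)[OF that]]])
qed

text \<open>The local action at \<open>v\<close> depends only on the images of \<open>v\<close> and
  its neighbours, so it is inherited from the element that agrees with \<open>g\<close>
  there.\<close>

lemma universal_group_gluing:
  assumes ext: "g \<in> extensional (verts T)"
    and loc: "\<And>v. v \<in> verts T \<Longrightarrow>
      \<exists>k\<in>U. k v = g v \<and> (\<forall>a\<in>arcs_from T v. k (terminus T a) = g (terminus T a))"
  shows "g \<in> U"
proof -
  have g: "g \<in> tree_Aut T"
    by (rule tree_Aut_gluing[OF is_tree ext]) (use loc universal_group_tree_Aut in blast)
  have "\<pi> (g v) = \<pi> v \<and> (\<exists>s\<in>local_group \<Delta> (\<pi> v). \<forall>a\<in>arcs_from T v. L (arc_map T g a) = s (L a))"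
    if v: "v \<in> verts T" for v
  proof -
    obtain k where k: "k \<in> U" "k v = g v" "\<forall>a\<in>arcs_from T v. k (terminus T a) = g (terminus T a)"
      using loc[OF v] by blast
    note kD = universal_groupD[OF k(1)]
    have "arc_map T g a = arc_map T k a" if "a \<in> arcs_from T v" for a
      using that k(2,3) by (intro arc_map_cong[OF is_tree g kD(1)]) (simp_all add: arcs_from_iff)
    then show ?thesis using delta_isoD(2,3)[OF kD(2) v] k(2) by simp
  qed
  then show ?thesis
    using g tree_Aut_iso[OF is_tree g] by (simp add: universal_group_def delta_iso_def)
qed

text \<open>The labelling forces the local action of \<open>g\<close> at \<open>v\<close>.
  Approximating \<open>g\<close> on finitely many vertices approximates this permutation on finitely
  many colours, and the local group is closed.\<close>

lemma universal_group_closed: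
  assumes g: "g \<in> tree_Aut T"
    and approx: "\<And>F. finite F \<Longrightarrow> F \<subseteq> verts T \<Longrightarrow> \<exists>h\<in>U. \<forall>x\<in>F. h x = g x"
  shows "g \<in> U"
proof -
  have "\<pi> (g v) = \<pi> v \<and> (\<exists>s\<in>local_group \<Delta> (\<pi> v). \<forall>a\<in>arcs_from T v. L (arc_map T g a) = s (L a))"
    if v: "v \<in> verts T" for v
  proof -
    obtain u where u: "u \<in> U" "u v = g v" using approx[of "{v}"] v by auto
    then have \<pi>: "\<pi> (g v) = \<pi> v" using delta_isoD(2)[OF universal_groupD(2)[OF u(1)] v] by simp
    let ?X = "colours_at \<Delta> (\<pi> v)"
    define e where "e = inv_into (arcs_from T v) L"
    \<comment> \<open>The action of \<open>g\<close> on the star of \<open>v\<close>, read through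
      the labels at both ends.\<close>
    define s where "s = (\<lambda>c\<in>?X. L (arc_map T g (e c)))"
    have Lb: "bij_betw L (arcs_from T v) ?X" by (rule label_bij[OF v])
    then have e: "bij_betw e ?X (arcs_from T v)" unfolding e_def by (rule bij_betw_inv_into)
    have eL: "e (L a) = a" if "a \<in> arcs_from T v" for a
      using Lb that unfolding e_def bij_betw_def by (metis inv_into_f_f)
    have Le: "L (e c) = c" if "c \<in> ?X" for c
      using Lb that unfolding e_def bij_betw_def by (metis f_inv_into_f)
    have gv: "g v \<in> verts T" using graph_iso_in(1)[OF tree_Aut_iso[OF is_tree g] v] .
    have "bij_betw L (arcs_from T (g v)) ?X" using label_bij[OF gv] \<pi> by simp
    from bij_betw_trans[OF bij_betw_trans[OF e graph_iso_star[OF tree_Aut_iso[OF is_tree g] wf_T v]] this]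
    have "bij_betw s ?X ?X"
      by (rule bij_betw_cong[THEN iffD1, rotated]) (simp add: s_def)
    then have "s \<in> Bij ?X" by (simp add: Bij_def s_def)
    moreover have "\<exists>t\<in>local_group \<Delta> (\<pi> v). \<forall>c\<in>C. t c = s c" if C: "finite C" "C \<subseteq> ?X" for C
    proof -
      have eC: "e c \<in> arcs T" "orig T (e c) = v" if "c \<in> C" for c
        using bij_betwE[OF e] C(2) that by (auto simp: arcs_from_iff)
      \<comment> \<open>The image of an arc is determined by the images of its ends, so finitely
        many colours at \<open>v\<close> are controlled by \<open>v\<close> and finitely many
        neighbours.\<close>
      have "insert v ((\<lambda>c. terminus T (e c)) ` C) \<subseteq> verts T"
        using v wf_graphD(2)[OF wf_T eC(1)] by blast
      then obtain u where u: "u \<in> U" "\<forall>x\<in>insert v ((\<lambda>c. terminus T (e c)) ` C). u x = g x"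
        using approx[of "insert v ((\<lambda>c. terminus T (e c)) ` C)"] C(1) by blast
      note uD = universal_groupD[OF u(1)]
      obtain t where t: "t \<in> local_group \<Delta> (\<pi> v)" "\<forall>a\<in>arcs_from T v. L (arc_map T u a) = t (L a)"
        using delta_isoD(3)[OF uD(2) v] by blast
      have "t c = s c" if c: "c \<in> C" for c
      proof -
        have "arc_map T u (e c) = arc_map T g (e c)"
          using u(2) c by (intro arc_map_cong[OF is_tree uD(1) g eC(1)[OF c]]) (simp_all add: eC)
        moreover have "L (arc_map T u (e c)) = t c" using t(2) eC[OF c] Le c C(2) by (auto simp: arcs_from_iff)
        ultimately show ?thesis using c C(2) by (auto simp: s_def)
      qed
      then show ?thesis using t(1) by blast
    qed
    ultimately have "s \<in> local_group \<Delta> (\<pi> v)" by (rule local_group_closed[OF proj_in[OF v]])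
    moreover have "\<forall>a\<in>arcs_from T v. L (arc_map T g a) = s (L a)"
      using Lb eL unfolding bij_betw_def by (auto simp: s_def)
    ultimately show ?thesis using \<pi> by blast
  qed
  then show ?thesis
    using g tree_Aut_iso[OF is_tree g] by (simp add: universal_group_def delta_iso_def)
qed

text \<open>The patched map applies to each vertex the element that belongs to its fibre. On the
  star of \<open>v\<close> it agrees with \<open>k (\<rho> v)\<close>: a neighbour in the same fibre
  uses the same element, and for a neighbour in another fibre both ends lie on the path, where every
  \<open>k x\<close> is the identity.\<close>

lemma universal_group_property_P: "property_P T U"
  unfolding property_P_iff
proof (intro allI impI)
  fix P k assume P: "path_verts T P" and "\<forall>x\<in>P. k x \<in> pointwise_stabiliser U P"
  then have k: "\<And>x. x \<in> P \<Longrightarrow> k x \<in> U" and k_fix: "\<And>x y. x \<in> P \<Longrightarrow> y \<in> P \<Longrightarrow> k x y = y"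
    by (auto simp: pointwise_stabiliser_def)
  define \<rho> where "\<rho> = closest_point T P"
  note \<rho> = path_projection[OF is_tree P, folded \<rho>_def]
  define g where "g = (\<lambda>v\<in>verts T. k (\<rho> v) v)"
  have PV: "P \<subseteq> verts T" using P by (auto simp: path_verts_def)
  have "g \<in> U"
  proof (rule universal_group_gluing)
    fix v assume v: "v \<in> verts T"
    have "k (\<rho> v) (terminus T a) = g (terminus T a)" if a: "a \<in> arcs_from T v" for a
    proof -
      have aT: "a \<in> arcs T" "orig T a = v" using a by (simp_all add: arcs_from_iff)
      then have z: "terminus T a \<in> verts T" using wf_graphD(2)[OF wf_T] by blast
      have "\<rho> v = \<rho> (terminus T a) \<or> v \<in> P \<and> terminus T a \<in> P"
        using \<rho>(3)[OF adjacencyI[OF aT(1)]] aT(2) by simp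
      then show ?thesis
      proof
        assume *: "v \<in> P \<and> terminus T a \<in> P"
        then have "\<rho> v = v" "\<rho> (terminus T a) = terminus T a" using \<rho>(2) by blast+
        then show ?thesis using * k_fix z by (simp add: g_def)
      qed (simp add: g_def z)
    qed
    then show "\<exists>k\<in>U. k v = g v \<and> (\<forall>a\<in>arcs_from T v. k (terminus T a) = g (terminus T a))"
      using v k[OF \<rho>(1)[OF v]] by (intro bexI[of _ "k (\<rho> v)"]) (simp_all add: g_def)
  qed (simp add: g_def)
  moreover have "g x = x" if "x \<in> P" for x
    using that PV \<rho>(2) k_fix by (auto simp: g_def)
  moreover have "g v = k x v" if "v \<in> path_fibre T P x" for x v
    using that by (auto simp: g_def path_fibre_def \<rho>_def)
  ultimately show "\<exists>g\<in>pointwise_stabiliser U P. \<forall>x\<in>P. \<forall>v\<in>path_fibre T P x. g v = k x v"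
    unfolding pointwise_stabiliser_def by blast
qed

theorem universal_group_P_closed: "(T, U) \<in> P_closed_actions"
proof -
  have "closedin (subtopology (perm_topology (verts T)) (tree_Aut T)) U"
    unfolding closedin_tree_Aut_iff[OF universal_group_tree_Aut]
    by (intro ballI impI) (rule universal_group_closed, simp_all)
  then show ?thesis
    unfolding P_closed_actions_def P_closed_def
    using is_tree subgroup_universal_group universal_group_tree_Aut universal_group_property_P by simp
qed

end

section \<open>Reconstructing a (P)-closed group from its local actions\<close>

locale P_closed_action =
  fixes T :: "('v, 'e) graph" and G :: "('v \<Rightarrow> 'v) set"
  assumes P_closed: "(T, G) \<in> P_closed_actions"
begin

lemma is_tree: "tree T" and G_Aut: "G \<subseteq> tree_Aut T" and prop_P: "property_P T G"
  using P_closed by (auto simp: P_closed_actions_def P_closed_def)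

lemma wf_T: "wf_graph T" and simple_T: "simple_graph T" and connected_T: "connected_graph T"
  using is_tree by (auto simp: tree_def)

lemma G_closed:
  assumes "g \<in> tree_Aut T" "\<And>F. finite F \<Longrightarrow> F \<subseteq> verts T \<Longrightarrow> \<exists>h\<in>G. \<forall>x\<in>F. h x = g x"
  shows "g \<in> G"
proof -
  have "closedin (subtopology (perm_topology (verts T)) (tree_Aut T)) G"
    using P_closed by (simp add: P_closed_actions_def P_closed_def)
  then show ?thesis unfolding closedin_tree_Aut_iff[OF G_Aut] using assms by simp
qed

lemma G_group: "G \<subseteq> Bij (verts T) \<and> (\<lambda>x\<in>verts T. x) \<in> G \<and>
     (\<forall>g\<in>G. \<forall>h\<in>G. compose (verts T) g h \<in> G) \<and> (\<forall>g\<in>G. restrict (inv_into (verts T) g) (verts T) \<in> G)"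
  unfolding subgroup_BijGroup_iff[symmetric] using P_closed by (simp add: P_closed_actions_def)

lemma G_Bij: "g \<in> G \<Longrightarrow> g \<in> Bij (verts T)" and G_id: "(\<lambda>x\<in>verts T. x) \<in> G"
  and G_compose: "g \<in> G \<Longrightarrow> h \<in> G \<Longrightarrow> compose (verts T) g h \<in> G"
  and G_inv: "g \<in> G \<Longrightarrow> restrict (inv_into (verts T) g) (verts T) \<in> G"
  using G_group by blast+

lemma G_iso: "g \<in> G \<Longrightarrow> graph_iso T T g (arc_map T g)"
  using tree_Aut_iso[OF is_tree] G_Aut by blast

lemma G_verts: "g \<in> G \<Longrightarrow> v \<in> verts T \<Longrightarrow> g v \<in> verts T"
  and G_arcs: "g \<in> G \<Longrightarrow> a \<in> arcs T \<Longrightarrow> arc_map T g a \<in> arcs T"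
  using graph_iso_in[OF G_iso] by blast+

text \<open>Property (P) for the edge, applied to \<open>h\<close> on the side of \<open>y\<close>
  and the identity on the side of \<open>par y\<close>.\<close>

lemma edge_split:
  assumes "rooted_tree T base level par" and y: "y \<in> verts T" "y \<noteq> base"
    and h: "h \<in> G" "h y = y" "h (par y) = par y"
  shows "\<exists>h'\<in>G. \<forall>x\<in>verts T. h' x = (if x \<in> rooted_tree.descendants T par y then h x else x)"
proof -
  interpret rooted_tree T base level par by fact
  let ?P = "{par y, y}"
  define k where "k x = (if x = y then h else (\<lambda>x\<in>verts T. x))" for x
  have ne: "par y \<noteq> y" using level_par[OF y] by auto
  have "\<forall>x\<in>?P. k x \<in> pointwise_stabiliser G ?P"
    using h G_id y(1) par_in[OF y(1)] by (auto simp: k_def pointwise_stabiliser_def)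
  then obtain g where g: "g \<in> pointwise_stabiliser G ?P" "\<forall>x\<in>?P. \<forall>v\<in>path_fibre T ?P x. g v = k x v"
    using prop_P[unfolded property_P_iff] path_verts_edge[OF y] by blast
  have "g x = (if x \<in> descendants y then h x else x)" if x: "x \<in> verts T" for x
  proof (cases "x \<in> descendants y")
    case True
    then have "x \<in> path_fibre T ?P y" using closest_point_edge[OF y x] x by (simp add: path_fibre_def)
    then show ?thesis using g(2) True by (simp add: k_def)
  next
    case False
    then have "x \<in> path_fibre T ?P (par y)" using closest_point_edge[OF y x] x by (simp add: path_fibre_def)
    then show ?thesis using g(2) False ne x by (simp add: k_def)
  qed
  then show ?thesis using g(1) unfolding pointwise_stabiliser_def by blast
qed

text \<open>
  By induction on a finite subtree: the star of a vertex \<open>y\<close> of maximal level is glued to the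
  rest along the edge from \<open>par y\<close> to \<open>y\<close>, by property (P) for this edge.
\<close>

lemma local_approximation:
  assumes u: "u \<in> tree_Aut T"
    and loc: "\<And>v F. v \<in> verts T \<Longrightarrow> finite F \<Longrightarrow> F \<subseteq> {w. (v, w) \<in> adjacency T} \<Longrightarrow>
      \<exists>g\<in>G. g v = u v \<and> (\<forall>w\<in>F. g w = u w)"
  shows "u \<in> G"
proof -
  obtain base where base: "base \<in> verts T" using connected_T by (auto simp: connected_graph_def)
  obtain level par where rt: "rooted_tree T base level par" using tree_rooted[OF is_tree base] by blast
  interpret rooted_tree T base level par by (fact rt)
  \<comment> \<open>\<open>Y\<close> is a finite subtree containing the root, and \<open>F\<close> a
    finite sample of \<open>Y\<close> and the children of its vertices. The sample is needed because
    stars may be infinite, whereas \<open>loc\<close> gives agreement only on finite parts of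
    them.\<close>
  have agree: "\<exists>g\<in>G. \<forall>x\<in>F. g x = u x"
    if "finite Y" "Y \<subseteq> verts T" "base \<in> Y" "par ` Y \<subseteq> Y"
      "finite F" "F \<subseteq> verts T" "\<forall>x\<in>F. x \<in> Y \<or> par x \<in> Y" for Y F
    using that
  proof (induction "card Y" arbitrary: Y F rule: less_induct)
    case less
    note Y = less.prems(1-4) and F = less.prems(5-7)
    show ?case
    proof (cases "Y = {base}")
      case True
      have "F - {base} \<subseteq> {w. (base, w) \<in> adjacency T}"
        using F(2,3) True adj_par by fastforce
      then show ?thesis using loc[OF base, of "F - {base}"] F(1) by (metis DiffI finite_Diff singletonD)
    next
      case False
      define m where "m = Max (level ` (Y - {base}))"
      have ne: "Y - {base} \<noteq> {}" using False Y(3) by blast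
      have "m \<in> level ` (Y - {base})" unfolding m_def by (rule Max_in) (use Y(1) ne in auto)
      then obtain y where y: "y \<in> Y" "y \<noteq> base" "level y = m" by blast
      have yV: "y \<in> verts T" using y(1) Y(2) by blast
      have max: "level x \<le> level y" if "x \<in> Y" for x
      proof (cases "x = base")
        case False
        then show ?thesis unfolding y(3) m_def using that Y(1) by (intro Max_ge) auto
      qed (simp add: level_base)
      let ?Y = "Y - {y}"
      have par_ne: "par x \<noteq> y" if "x \<in> Y" for x
      proof (cases "x = base")
        case False
        then show ?thesis using level_par[of x] max[OF that] that Y(2) by auto
      qed (use y(2) par_base in simp)
      have Y': "par ` ?Y \<subseteq> ?Y" using Y(4) par_ne by blast
      have py: "par y \<in> ?Y" using Y(4) par_ne y(1) by blast
      \<comment> \<open>The part of \<open>F\<close> that hangs on \<open>y\<close>; the star of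
        \<open>y\<close> takes care of it after \<open>y\<close> is removed from
        \<open>Y\<close>.\<close>
      define C where "C = {x \<in> F. par x = y}"
      have C_base: "x \<noteq> base" if "x \<in> C" for x using that y(2) par_base by (auto simp: C_def)
      \<comment> \<open>Including \<open>y\<close> and \<open>par y\<close> makes \<open>g\<close>
        agree on this edge with the element \<open>k\<close> chosen for the star of
        \<open>y\<close>.\<close>
      let ?F = "insert y (insert (par y) (F - C))"
      have "\<exists>g\<in>G. \<forall>x\<in>?F. g x = u x"
      proof (rule less.hyps)
        show "card ?Y < card Y" by (rule card_Diff1_less[OF Y(1) y(1)])
        show "?F \<subseteq> verts T" using yV par_in[OF yV] F(2) by blast
        show "\<forall>x\<in>?F. x \<in> ?Y \<or> par x \<in> ?Y"
        proof
          fix x assume "x \<in> ?F"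
          then consider "x = y" | "x = par y" | "x \<in> F" "par x \<noteq> y" "x \<noteq> y"
            unfolding C_def by blast
          then show "x \<in> ?Y \<or> par x \<in> ?Y"
          proof cases
            case 3
            then show ?thesis using bspec[OF F(3), of x] by simp
          qed (use py in simp_all)
        qed
        show "par ` ?Y \<subseteq> ?Y" by (rule Y')
        show "?Y \<subseteq> verts T" using Y(2) by blast
      qed (use Y(1-3) F(1) y(2) in simp_all)
      then obtain g where g: "g \<in> G" "\<And>x. x \<in> ?F \<Longrightarrow> g x = u x" by blast
      have "insert (par y) C \<subseteq> {w. (y, w) \<in> adjacency T}"
        using adjacency_sym[OF wf adj_par[OF yV y(2)]] adj_par C_base F(2) unfolding C_def by blast
      then obtain k where k: "k \<in> G" "k y = u y" "\<And>w. w \<in> insert (par y) C \<Longrightarrow> k w = u w"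
        using loc[OF yV, of "insert (par y) C"] F(1) by (auto simp: C_def)
      note gB = BijD[OF G_Bij[OF g(1)]]
      \<comment> \<open>This is \<open>g^-1 k\<close>. It fixes both ends of the edge, so it can be
        cut there to an element \<open>h'\<close> that is trivial outside the subtree below
        \<open>y\<close>.\<close>
      let ?h = "compose (verts T) (restrict (inv_into (verts T) g) (verts T)) k"
      have h: "?h \<in> G" by (rule G_compose[OF G_inv[OF g(1)] k(1)])
      have gh: "g (?h x) = k x" if "x \<in> verts T" for x
        using that gB(5) G_verts[OF k(1) that] by (simp add: compose_def)
      have hV: "?h x \<in> verts T" if "x \<in> verts T" for x using G_verts[OF h that] .
      have "?h y = y" using gh[OF yV] k(2) g(2)[of y] gB(2)[OF hV[OF yV] yV] by simp
      moreover have "?h (par y) = par y"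
        using gh[OF par_in[OF yV]] k(3)[of "par y"] g(2)[of "par y"]
          gB(2)[OF hV[OF par_in[OF yV]] par_in[OF yV]] by simp
      ultimately obtain h' where h': "h' \<in> G"
          "\<And>x. x \<in> verts T \<Longrightarrow> h' x = (if x \<in> descendants y then ?h x else x)"
        using edge_split[OF rt yV y(2) h] by blast
      \<comment> \<open>The product acts as \<open>k\<close> below \<open>y\<close> and as
        \<open>g\<close> elsewhere. By maximality of the level of \<open>y\<close>, the set
        \<open>F\<close> meets the subtree below \<open>y\<close> at most in \<open>y\<close> and
        \<open>C\<close>.\<close>
      have "compose (verts T) g h' x = u x" if x: "x \<in> F" for x
      proof (cases "x \<in> C")
        case True
        then have "x \<in> descendants y"
          using descendants_par descendants_self[OF yV] F(2) unfolding C_def by blast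
        then have "g (h' x) = k x" using h'(2) gh x F(2) by (simp add: subset_iff)
        then show ?thesis using k(3)[of x] True x F(2) by (auto simp: compose_def)
      next
        case False
        have "h' x = x"
        proof (cases "x \<in> descendants y \<and> x \<noteq> y")
          case True
          then have "level y < level x" "par x \<in> descendants y"
            using level_descendants par_descendants by blast+
          moreover have "par x \<noteq> y" using False x by (simp add: C_def)
          ultimately have "level y < level x" "level y < level (par x)"
            using level_descendants by blast+
          then show ?thesis using F(3) x max by (meson leD)
        next
          case False
          then show ?thesis using h'(2)[of x] \<open>?h y = y\<close> x F(2) by auto
        qed
        then show ?thesis using g(2)[of x] False x F(2) by (auto simp: compose_def)
      qed
      then show ?thesis using G_compose[OF g(1) h'(1)] by blast
    qed
  qed
  have anc: "\<exists>Y. finite Y \<and> Y \<subseteq> verts T \<and> base \<in> Y \<and> par ` Y \<subseteq> Y \<and> x \<in> Y" if "x \<in> verts T" for x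
    using that
  proof (induction x rule: rooted_induct)
    case base
    show ?case by (rule exI[of _ "{base}"]) (simp add: par_base base_in)
  next
    case (par x)
    then obtain Y where "finite Y \<and> Y \<subseteq> verts T \<and> base \<in> Y \<and> par ` Y \<subseteq> Y \<and> par x \<in> Y" by blast
    then show ?case using par.hyps(1) by (intro exI[of _ "insert x Y"]) auto
  qed
  have "\<exists>g\<in>G. \<forall>x\<in>F. g x = u x" if F: "finite F" "F \<subseteq> verts T" for F
  proof -
    obtain A where A: "\<And>x. x \<in> F \<Longrightarrow> finite (A x) \<and> A x \<subseteq> verts T \<and> base \<in> A x \<and> par ` A x \<subseteq> A x \<and> x \<in> A x"
      using anc F(2) by (metis subsetD)
    show ?thesis
    proof (rule agree)
      show "finite (insert base (\<Union>(A ` F)))" using F(1) A by blast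
      show "par ` insert base (\<Union>(A ` F)) \<subseteq> insert base (\<Union>(A ` F))" using A par_base by fastforce
      show "\<forall>x\<in>F. x \<in> insert base (\<Union>(A ` F)) \<or> par x \<in> insert base (\<Union>(A ` F))"
        using A by blast
      show "insert base (\<Union>(A ` F)) \<subseteq> verts T" using A base by blast
    qed (use F in simp_all)
  qed
  then show ?thesis by (intro G_closed[OF u])
qed

section \<open>Orbits and the quotient graph\<close>

lemma arc_map_inv:
  assumes "g \<in> G" "a \<in> arcs T"
  shows "arc_map T (restrict (inv_into (verts T) g) (verts T)) (arc_map T g a) = a"
  using arc_map_compose[OF is_tree _ _ assms(2), of "restrict (inv_into (verts T) g) (verts T)" g]
    assms G_inv[OF assms(1)] G_Aut arc_map_id[OF is_tree assms(2)]
  by (simp add: subset_iff Bij_compose_restrict_eq[OF G_Bij[OF assms(1)]])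

lemma arc_map_G_compose:
  assumes "g \<in> G" "h \<in> G" "a \<in> arcs T"
  shows "arc_map T (compose (verts T) g h) a = arc_map T g (arc_map T h a)"
  using arc_map_compose[OF is_tree _ _ assms(3)] assms G_Aut by blast

lemma vertex_orbit_eq: "vertex_orbit T G v = {g v | g. g \<in> G}"
  by (simp add: vertex_orbit_def orbit_def)

lemma arc_orbit_eq: "arc_orbit T G a = {arc_map T g a | g. g \<in> G}"
  by (simp add: arc_orbit_def orbit_def)

lemma vertex_orbit_eqI:
  assumes "g \<in> G" "v \<in> verts T"
  shows "vertex_orbit T G (g v) = vertex_orbit T G v"
proof -
  have "\<exists>k\<in>G. h (g v) = k v" if "h \<in> G" for h
    using G_compose[OF that assms(1)] assms(2) by (intro bexI) (simp_all add: compose_def)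
  moreover have "\<exists>k\<in>G. h v = k (g v)" if "h \<in> G" for h
    using G_compose[OF that G_inv[OF assms(1)]] assms(2) G_verts[OF assms]
      BijD(4)[OF G_Bij[OF assms(1)] assms(2)]
    by (intro bexI) (simp_all add: compose_def)
  ultimately show ?thesis unfolding vertex_orbit_eq by blast
qed

lemma arc_orbit_eqI:
  assumes "g \<in> G" "a \<in> arcs T"
  shows "arc_orbit T G (arc_map T g a) = arc_orbit T G a"
proof -
  have "\<exists>k\<in>G. arc_map T h (arc_map T g a) = arc_map T k a" if "h \<in> G" for h
    using G_compose[OF that assms(1)] arc_map_G_compose[OF that assms] by metis
  moreover have "\<exists>k\<in>G. arc_map T h a = arc_map T k (arc_map T g a)" if "h \<in> G" for h
    using G_compose[OF that G_inv[OF assms(1)]]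
      arc_map_G_compose[OF that G_inv[OF assms(1)] G_arcs[OF assms]] arc_map_inv[OF assms] by metis
  ultimately show ?thesis unfolding arc_orbit_eq by blast
qed

lemma vertex_orbit_self: "v \<in> verts T \<Longrightarrow> v \<in> vertex_orbit T G v"
  unfolding vertex_orbit_eq mem_Collect_eq using G_id by (intro exI[of _ "\<lambda>x\<in>verts T. x"]) simp

lemma arc_orbit_self: "a \<in> arcs T \<Longrightarrow> a \<in> arc_orbit T G a"
  unfolding arc_orbit_eq mem_Collect_eq
  using G_id arc_map_id[OF is_tree] by (intro exI[of _ "\<lambda>x\<in>verts T. x"]) simp

lemma vertex_orbitE:
  assumes "vertex_orbit T G v = vertex_orbit T G w" "w \<in> verts T"
  obtains g where "g \<in> G" "g v = w"
proof -
  have "w \<in> vertex_orbit T G v" using vertex_orbit_self[OF assms(2)] assms(1) by simp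
  then show thesis using that unfolding vertex_orbit_eq by blast
qed

lemma arc_orbitE:
  assumes "arc_orbit T G a = arc_orbit T G b" "b \<in> arcs T"
  obtains g where "g \<in> G" "arc_map T g a = b"
proof -
  have "b \<in> arc_orbit T G a" using arc_orbit_self[OF assms(2)] assms(1) by simp
  then show thesis using that unfolding arc_orbit_eq by blast
qed

abbreviation "Q \<equiv> quotient_graph T G"

lemma quotient_graph_simps:
  shows "verts Q = vertex_orbit T G ` verts T" "arcs Q = arc_orbit T G ` arcs T"
    and "a \<in> arcs T \<Longrightarrow> orig Q (arc_orbit T G a) = vertex_orbit T G (orig T a)"
    and "a \<in> arcs T \<Longrightarrow> reversal Q (arc_orbit T G a) = arc_orbit T G (reversal T a)"
proof -
  show "verts Q = vertex_orbit T G ` verts T" "arcs Q = arc_orbit T G ` arcs T"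
    by (simp_all add: quotient_graph_def)
  assume a: "a \<in> arcs T"
  have "orig T ` {arc_map T g a | g. g \<in> G} = {orig T (arc_map T g a) | g. g \<in> G}" by blast
  also have "\<dots> = {g (orig T a) | g. g \<in> G}" using graph_isoD(3)[OF G_iso a] by metis
  finally show "orig Q (arc_orbit T G a) = vertex_orbit T G (orig T a)"
    by (simp add: quotient_graph_def arc_orbit_eq vertex_orbit_eq)
  have "reversal T ` {arc_map T g a | g. g \<in> G} = {reversal T (arc_map T g a) | g. g \<in> G}" by blast
  also have "\<dots> = {arc_map T g (reversal T a) | g. g \<in> G}" using graph_isoD(4)[OF G_iso a] by metis
  finally show "reversal Q (arc_orbit T G a) = arc_orbit T G (reversal T a)"
    by (simp add: quotient_graph_def arc_orbit_eq)
qed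

lemma wf_quotient: "wf_graph Q"
  unfolding wf_graph_def quotient_graph_simps(2)
proof
  fix A assume "A \<in> arc_orbit T G ` arcs T"
  then obtain a where a: "a \<in> arcs T" "A = arc_orbit T G a" by blast
  note r = wf_graphD[OF wf_T a(1)]
  show "orig Q A \<in> verts Q \<and> reversal Q A \<in> arc_orbit T G ` arcs T \<and> reversal Q (reversal Q A) = A"
    unfolding a(2) quotient_graph_simps(1) quotient_graph_simps(3,4)[OF a(1)]
      quotient_graph_simps(4)[OF r(3)] r(4) using r(1,3) by blast
qed

lemma terminus_quotient:
  "a \<in> arcs T \<Longrightarrow> terminus Q (arc_orbit T G a) = vertex_orbit T G (terminus T a)"
  using quotient_graph_simps(3)[OF wf_graphD(3)[OF wf_T], of a]
  unfolding terminus_def by (simp only: quotient_graph_simps(4))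

lemma connected_quotient: "connected_graph Q"
  unfolding connected_graph_def quotient_graph_simps(1)
proof (intro conjI ballI)
  show "vertex_orbit T G ` verts T \<noteq> {}" using connected_T by (simp add: connected_graph_def)
  have step: "(vertex_orbit T G x, vertex_orbit T G y) \<in> adjacency Q" if "(x, y) \<in> adjacency T" for x y
  proof -
    from that obtain a where a: "a \<in> arcs T" "orig T a = x" "terminus T a = y" by (rule adjacencyE)
    have "arc_orbit T G a \<in> arcs Q" using a(1) by (simp add: quotient_graph_simps(2))
    from adjacencyI[OF this] show ?thesis
      using quotient_graph_simps(3)[OF a(1)] terminus_quotient[OF a(1)] a by simp
  qed
  fix V W assume "V \<in> vertex_orbit T G ` verts T" "W \<in> vertex_orbit T G ` verts T"
  then obtain v w where vw: "v \<in> verts T" "w \<in> verts T" "V = vertex_orbit T G v" "W = vertex_orbit T G w"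
    by blast
  have "(v, w) \<in> (adjacency T)\<^sup>*" using connected_T vw by (simp add: connected_graph_def)
  then have "(vertex_orbit T G v, vertex_orbit T G w) \<in> (adjacency Q)\<^sup>*"
    by (induction rule: rtrancl_induct) (auto intro: rtrancl_into_rtrancl step)
  then show "(V, W) \<in> (adjacency Q)\<^sup>*" by (simp add: vw)
qed

end

section \<open>The associated local action diagram\<close>

text \<open>A product is approximated on \<open>F\<close> by approximating the second factor on
  \<open>F\<close> and the first on the image of \<open>F\<close>; an inverse is approximated on
  \<open>F\<close> by approximating \<open>g\<close> on the preimage of \<open>F\<close>.\<close>

lemma subgroup_perm_closure:
  assumes A: "subgroup A (BijGroup X)"
  shows "subgroup (perm_topology X closure_of A) (BijGroup X)"
proof -
  note A' = A[unfolded subgroup_BijGroup_iff]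
  then have AB: "A \<subseteq> Bij X" by blast
  note cl = in_perm_closure_iff[OF AB]
  let ?C = "perm_topology X closure_of A"
  have CD: "g \<in> Bij X" "\<And>F. finite F \<Longrightarrow> F \<subseteq> X \<Longrightarrow> \<exists>h\<in>A. \<forall>x\<in>F. h x = g x" if "g \<in> ?C" for g
    using that unfolding cl by simp_all
  have CI: "g \<in> ?C" if "g \<in> Bij X" "\<And>F. finite F \<Longrightarrow> F \<subseteq> X \<Longrightarrow> \<exists>h\<in>A. \<forall>x\<in>F. h x = g x" for g
    using that unfolding cl by simp
  show ?thesis
    unfolding subgroup_BijGroup_iff
  proof (intro conjI ballI)
    show "?C \<subseteq> Bij X" using CD(1) by blast
    show "(\<lambda>x\<in>X. x) \<in> ?C" by (rule CI[OF id_Bij]) (use A' in blast)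
  next
    fix g h assume g: "g \<in> ?C" and h: "h \<in> ?C"
    show "compose X g h \<in> ?C"
    proof (rule CI[OF compose_Bij[OF CD(1)[OF g] CD(1)[OF h]]])
      fix F assume F: "finite F" "F \<subseteq> X"
      obtain h' where h': "h' \<in> A" "\<forall>x\<in>F. h' x = h x" using CD(2)[OF h F] by blast
      have "h ` F \<subseteq> X" using BijD(1)[OF CD(1)[OF h]] F(2) by blast
      then obtain g' where g': "g' \<in> A" "\<forall>x\<in>h ` F. g' x = g x"
        using CD(2)[OF g, of "h ` F"] F(1) by blast
      have "compose X g' h' \<in> A" using A' g'(1) h'(1) by blast
      moreover have "compose X g' h' x = compose X g h x" if "x \<in> F" for x
        using that F(2) g'(2) h'(2) by (simp add: compose_def subset_iff)
      ultimately show "\<exists>k\<in>A. \<forall>x\<in>F. k x = compose X g h x" by blast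
    qed
  next
    fix g assume g: "g \<in> ?C"
    note gB = CD(1)[OF g]
    show "restrict (inv_into X g) X \<in> ?C"
    proof (rule CI[OF restrict_inv_into_Bij[OF gB]])
      fix F assume F: "finite F" "F \<subseteq> X"
      have "inv_into X g ` F \<subseteq> X" using BijD(6)[OF gB] F(2) by blast
      then obtain k where k: "k \<in> A" "\<forall>x\<in>inv_into X g ` F. k x = g x"
        using CD(2)[OF g, of "inv_into X g ` F"] F(1) by blast
      have "restrict (inv_into X k) X x = restrict (inv_into X g) X x" if x: "x \<in> F" for x
      proof -
        have xX: "x \<in> X" using x F(2) by blast
        have "k (inv_into X g x) = x" using k(2) x BijD(5)[OF gB xX] by simp
        then have "inv_into X k x = inv_into X g x"
          using BijD(4)[OF _ BijD(6)[OF gB xX]] k(1) AB by (metis subsetD)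
        then show ?thesis using xX by simp
      qed
      then show "\<exists>k\<in>A. \<forall>x\<in>F. k x = restrict (inv_into X g) X x"
        using A' k(1) by blast
    qed
  qed
qed

text \<open>The value at \<open>c\<close> is a condition on the finite set \<open>{c}\<close>, so
  taking the closure adds nothing to an orbit.\<close>

lemma closure_orbit:
  assumes A: "A \<subseteq> Bij X" and c: "c \<in> X"
  shows "{s c | s. s \<in> perm_topology X closure_of A} = {s c | s. s \<in> A}"
proof -
  have "\<exists>t\<in>A. s c = t c" if "s \<in> perm_topology X closure_of A" for s
  proof -
    have "\<exists>t\<in>A. \<forall>x\<in>{c}. t x = s x"
      using that[unfolded in_perm_closure_iff[OF A]] c by blast
    then show ?thesis by (metis singletonI)
  qed
  moreover have "A \<subseteq> perm_topology X closure_of A"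
    using A by (intro closure_of_subset) (simp add: topspace_perm_topology carrier_BijGroup)
  ultimately show ?thesis by blast
qed

context P_closed_action
begin

text \<open>The permutation group induced by a vertex stabiliser on the star; its closure is the
  local group of the associated diagram.\<close>

definition star_perms :: "'v \<Rightarrow> ('e \<Rightarrow> 'e) set" where
  "star_perms x = (\<lambda>g. restrict (arc_map T g) (arcs_from T x)) ` {g \<in> G. g x = x}"

lemma star_perms_bij:
  "g \<in> G \<Longrightarrow> x \<in> verts T \<Longrightarrow> bij_betw (arc_map T g) (arcs_from T x) (arcs_from T (g x))"
  by (rule graph_iso_star[OF G_iso wf_T])

lemma star_perms_Bij: "x \<in> verts T \<Longrightarrow> star_perms x \<subseteq> Bij (arcs_from T x)"
  using star_perms_bij by (fastforce simp: star_perms_def Bij_def)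

lemma subgroup_star_perms:
  assumes x: "x \<in> verts T"
  shows "subgroup (star_perms x) (BijGroup (arcs_from T x))"
  unfolding subgroup_BijGroup_iff
proof (intro conjI ballI)
  let ?X = "arcs_from T x"
  let ?r = "\<lambda>g. restrict (arc_map T g) ?X"
  have XT: "a \<in> arcs T" if "a \<in> ?X" for a using that by (simp add: arcs_from_iff)
  have starI: "?r g \<in> star_perms x" if "g \<in> G" "g x = x" for g using that by (auto simp: star_perms_def)
  show "star_perms x \<subseteq> Bij ?X" by (rule star_perms_Bij[OF x])
  have "?r (\<lambda>v\<in>verts T. v) = (\<lambda>a\<in>?X. a)"
    by (rule restrict_ext) (simp add: arc_map_id[OF is_tree] XT)
  then show "(\<lambda>a\<in>?X. a) \<in> star_perms x" using starI[OF G_id] x by simp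
  fix s assume "s \<in> star_perms x"
  then obtain g where g: "g \<in> G" "g x = x" "s = ?r g" by (auto simp: star_perms_def)
  have gX: "arc_map T g a \<in> ?X" if "a \<in> ?X" for a
    using bij_betwE[OF star_perms_bij[OF g(1) x]] that g(2) by simp
  let ?g' = "restrict (inv_into (verts T) g) (verts T)"
  have g'x: "?g' x = x" using BijD(4)[OF G_Bij[OF g(1)] x] g(2) x by simp
  have sB: "s \<in> Bij ?X" using star_perms_Bij[OF x] starI[OF g(1,2)] g(3) by blast
  have "restrict (inv_into ?X s) ?X = ?r ?g'"
  proof (rule restrict_ext)
    fix b assume b: "b \<in> ?X"
    then obtain a where a: "a \<in> ?X" "b = s a" using BijD(3)[OF sB] by blast
    then show "inv_into ?X s b = arc_map T ?g' b"
      using BijD(4)[OF sB a(1)] arc_map_inv[OF g(1) XT[OF a(1)]] g(3) by simp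
  qed
  then show "restrict (inv_into ?X s) ?X \<in> star_perms x" using starI[OF G_inv[OF g(1)] g'x] by (simp only:)
  fix t assume "t \<in> star_perms x"
  then obtain h where h: "h \<in> G" "h x = x" "t = ?r h" by (auto simp: star_perms_def)
  have hX: "arc_map T h a \<in> ?X" if "a \<in> ?X" for a
    using bij_betwE[OF star_perms_bij[OF h(1) x]] that h(2) by simp
  have "compose ?X s t = ?r (compose (verts T) g h)"
    unfolding compose_def[of ?X]
    by (rule restrict_ext) (simp add: g(3) h(3) hX arc_map_G_compose[OF g(1) h(1) XT])
  then show "compose ?X s t \<in> star_perms x"
    using starI[OF G_compose[OF g(1) h(1)]] compose_eq[OF x, of g h] g(2) h(2) by simp
qed

end

locale P_closed_action_reps = P_closed_action T G
  for T :: "('v, 'e) graph" and G :: "('v \<Rightarrow> 'v) set" +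
  fixes r :: "'v set \<Rightarrow> 'v"
  assumes reps: "orbit_representatives T G r"
begin

abbreviation "\<pi> \<equiv> vertex_orbit T G"
abbreviation "D \<equiv> associated_lad T G r"

lemma rep_in: "w \<in> verts Q \<Longrightarrow> r w \<in> verts T" and proj_rep: "w \<in> verts Q \<Longrightarrow> \<pi> (r w) = w"
  using reps by (auto simp: orbit_representatives_def)

lemma orbit_in: "v \<in> verts T \<Longrightarrow> \<pi> v \<in> verts Q" by (simp add: quotient_graph_simps(1))

lemma lad_graph_D: "lad_graph D = Q" by (simp add: associated_lad_def)

lemma colours_D: "a \<in> arcs T \<Longrightarrow>
    colours D (arc_orbit T G a) = {b \<in> arcs_from T (r (\<pi> (orig T a))). arc_orbit T G b = arc_orbit T G a}"
  by (simp add: associated_lad_def quotient_graph_simps(3))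

lemma local_group_D: "local_group D w = perm_topology (arcs_from T (r w)) closure_of star_perms (r w)"
  by (simp add: associated_lad_def star_perms_def stabilizer_def)

lemma arcs_from_Q: "w \<in> verts Q \<Longrightarrow> arcs_from Q w = arc_orbit T G ` arcs_from T (r w)"
proof -
  assume w: "w \<in> verts Q"
  have "arc_orbit T G b \<in> arcs_from Q w" if "b \<in> arcs_from T (r w)" for b
    using that quotient_graph_simps(2,3) proj_rep[OF w] by (simp add: arcs_from_iff)
  moreover have "e \<in> arc_orbit T G ` arcs_from T (r w)" if e: "e \<in> arcs_from Q w" for e
  proof -
    from e obtain a where a: "a \<in> arcs T" "e = arc_orbit T G a"
      unfolding arcs_from_iff quotient_graph_simps(2) by blast
    then have "\<pi> (orig T a) = w" using e quotient_graph_simps(3) by (simp add: arcs_from_iff)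
    then have "\<pi> (orig T a) = \<pi> (r w)" using proj_rep[OF w] by simp
    then obtain g where g: "g \<in> G" "g (orig T a) = r w" by (rule vertex_orbitE[OF _ rep_in[OF w]])
    have "arc_map T g a \<in> arcs_from T (r w)"
      using graph_isoD(3)[OF G_iso[OF g(1)] a(1)] G_arcs[OF g(1) a(1)] g(2) by (simp add: arcs_from_iff)
    moreover have "e = arc_orbit T G (arc_map T g a)" using arc_orbit_eqI[OF g(1) a(1)] a(2) by simp
    ultimately show ?thesis by blast
  qed
  ultimately show ?thesis by blast
qed

lemma colours_D_rep: "w \<in> verts Q \<Longrightarrow> b \<in> arcs_from T (r w) \<Longrightarrow>
    colours D (arc_orbit T G b) = {c \<in> arcs_from T (r w). arc_orbit T G c = arc_orbit T G b}"
  using colours_D[of b] proj_rep[of w] by (simp add: arcs_from_iff)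

lemma colours_at_D: "w \<in> verts Q \<Longrightarrow> colours_at D w = arcs_from T (r w)"
  unfolding colours_at_def lad_graph_D arcs_from_Q using colours_D_rep by auto

text \<open>An element of \<open>G\<close> that moves one arc of a star to another arc of the same
  star fixes their common origin. The stabiliser therefore has as orbits on the star the traces of
  the arc orbits of \<open>G\<close>, and closing up does not change them.\<close>

lemma orbit_D:
  assumes w: "w \<in> verts Q" and c: "c \<in> arcs_from T (r w)"
  shows "{s c | s. s \<in> local_group D w} = colours D (arc_orbit T G c)"
proof -
  have cT: "c \<in> arcs T" "orig T c = r w" using c by (simp_all add: arcs_from_iff)
  have "{s c | s. s \<in> local_group D w} = {s c | s. s \<in> star_perms (r w)}"
    unfolding local_group_D by (rule closure_orbit[OF star_perms_Bij[OF rep_in[OF w]] c])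
  also have "\<dots> = {b \<in> arcs_from T (r w). arc_orbit T G b = arc_orbit T G c}"
  proof (intro equalityI subsetI)
    fix b assume "b \<in> {s c | s. s \<in> star_perms (r w)}"
    then obtain g where g: "g \<in> G" "g (r w) = r w" "b = arc_map T g c"
      using c by (auto simp: star_perms_def)
    then show "b \<in> {b \<in> arcs_from T (r w). arc_orbit T G b = arc_orbit T G c}"
      using bij_betwE[OF star_perms_bij[OF g(1) rep_in[OF w]]] c arc_orbit_eqI[OF g(1) cT(1)] by simp
  next
    fix b assume b: "b \<in> {b \<in> arcs_from T (r w). arc_orbit T G b = arc_orbit T G c}"
    then have bT: "b \<in> arcs T" "orig T b = r w" by (simp_all add: arcs_from_iff)
    have "arc_orbit T G c = arc_orbit T G b" using b by simp
    then obtain g where g: "g \<in> G" "arc_map T g c = b" by (rule arc_orbitE[OF _ bT(1)])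
    have "g (r w) = r w" using graph_isoD(3)[OF G_iso[OF g(1)] cT(1)] cT bT g(2) by simp
    then have "restrict (arc_map T g) (arcs_from T (r w)) \<in> star_perms (r w)"
      using g(1) by (auto simp: star_perms_def)
    moreover have "b = restrict (arc_map T g) (arcs_from T (r w)) c" using g(2) c by simp
    ultimately show "b \<in> {s c | s. s \<in> star_perms (r w)}" by blast
  qed
  finally show ?thesis using colours_D_rep[OF w c] by simp
qed

theorem associated_lad_in: "D \<in> local_action_diagrams"
  unfolding local_action_diagrams_def mem_Collect_eq lad_graph_D
proof (intro conjI ballI impI)
  show "wf_graph Q" "connected_graph Q" by (rule wf_quotient, rule connected_quotient)
  fix e assume e: "e \<in> arcs Q"
  define w where "w = orig Q e"
  have w: "w \<in> verts Q" using wf_graphD(1)[OF wf_quotient e] by (simp add: w_def)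
  have "e \<in> arcs_from Q w" using e by (simp add: arcs_from_iff w_def)
  then obtain b where b: "b \<in> arcs_from T (r w)" "e = arc_orbit T G b"
    unfolding arcs_from_Q[OF w] by blast
  then show "colours D e \<noteq> {}" using colours_D_rep[OF w b(1)] by blast
  fix e' assume e': "e' \<in> arcs Q" "e \<noteq> e'"
  then obtain b' where b': "b' \<in> arcs T" "e' = arc_orbit T G b'" unfolding quotient_graph_simps(2) by blast
  show "colours D e \<inter> colours D e' = {}"
    using e'(2) unfolding b(2) colours_D_rep[OF w b(1)] b'(2) colours_D[OF b'(1)] by blast
next
  fix w assume w: "w \<in> verts Q"
  show "subgroup (local_group D w) (BijGroup (colours_at D w))"
    unfolding colours_at_D[OF w] local_group_D
    by (rule subgroup_perm_closure[OF subgroup_star_perms[OF rep_in[OF w]]])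
  show "closedin (perm_topology (colours_at D w)) (local_group D w)"
    unfolding colours_at_D[OF w] local_group_D by (rule closedin_closure_of)
  have "orbits (perm_group (colours_at D w) (local_group D w)) (colours_at D w) (\<lambda>g. g)
      = (\<lambda>c. {s c | s. s \<in> local_group D w}) ` arcs_from T (r w)"
    unfolding orbits_def orbit_def colours_at_D[OF w] by auto
  also have "\<dots> = (\<lambda>c. colours D (arc_orbit T G c)) ` arcs_from T (r w)"
    by (rule image_cong[OF refl]) (rule orbit_D[OF w])
  finally show "orbits (perm_group (colours_at D w) (local_group D w)) (colours_at D w) (\<lambda>g. g) =
      colours D ` arcs_from Q w"
    unfolding arcs_from_Q[OF w] image_image .
qed

section \<open>Labelling a tree by its associated diagram\<close>

sublocale action_diagram D
  by unfold_locales (rule associated_lad_in)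

definition \<gamma> :: "'v \<Rightarrow> 'v \<Rightarrow> 'v" where
  "\<gamma> v = (SOME g. g \<in> G \<and> g v = r (\<pi> v))"

lemma \<gamma>:
  assumes "v \<in> verts T"
  shows "\<gamma> v \<in> G" "\<gamma> v v = r (\<pi> v)"
proof -
  have "\<exists>g. g \<in> G \<and> g v = r (\<pi> v)"
    using vertex_orbitE[of v "r (\<pi> v)"] proj_rep[OF orbit_in[OF assms]] rep_in[OF orbit_in[OF assms]]
    by metis
  from someI_ex[OF this] show "\<gamma> v \<in> G" "\<gamma> v v = r (\<pi> v)" by (simp_all add: \<gamma>_def)
qed

text \<open>An arc is labelled by a translate in the star of the orbit representative. Another
  choice of \<open>\<gamma>\<close> would change the labels in a star by a permutation induced by
  the stabiliser of the representative, hence by an element of the local group.\<close>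

definition L :: "'e \<Rightarrow> 'e" where
  "L a = arc_map T (\<gamma> (orig T a)) a"

lemma L_bij:
  assumes v: "v \<in> verts T"
  shows "bij_betw L (arcs_from T v) (arcs_from T (r (\<pi> v)))"
proof -
  have "bij_betw (arc_map T (\<gamma> v)) (arcs_from T v) (arcs_from T (r (\<pi> v)))"
    using star_perms_bij[OF \<gamma>(1)[OF v] v] \<gamma>(2)[OF v] by simp
  then show ?thesis by (rule bij_betw_cong[THEN iffD1, rotated]) (simp add: L_def arcs_from_iff)
qed

lemma L_in: "a \<in> arcs T \<Longrightarrow> L a \<in> arcs_from T (r (\<pi> (orig T a)))"
  using bij_betwE[OF L_bij[OF wf_graphD(1)[OF wf_T]]] by (simp add: arcs_from_iff)

lemma arc_of_L: "a \<in> arcs T \<Longrightarrow> arc_of D (L a) = arc_orbit T G a"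
proof -
  assume a: "a \<in> arcs T"
  have "arc_orbit T G (L a) = arc_orbit T G a"
    unfolding L_def by (rule arc_orbit_eqI[OF \<gamma>(1)[OF wf_graphD(1)[OF wf_T a]] a])
  then have "L a \<in> colours D (arc_orbit T G a)" using colours_D[OF a] L_in[OF a] by simp
  moreover have "arc_orbit T G a \<in> arcs (lad_graph D)"
    unfolding lad_graph_D using a by (simp add: quotient_graph_simps(2))
  ultimately show ?thesis by (intro arc_of_eq)
qed

lemma delta_tree_D: "delta_tree D T \<pi> L"
  unfolding delta_tree_def
proof (intro conjI ballI)
  fix v assume v: "v \<in> verts T"
  show "\<pi> v \<in> verts (lad_graph D)" unfolding lad_graph_D by (rule orbit_in[OF v])
  show "bij_betw L (arcs_from T v) (colours_at D (\<pi> v))"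
    unfolding colours_at_D[OF orbit_in[OF v]] by (rule L_bij[OF v])
next
  fix a assume a: "a \<in> arcs T"
  show "arc_of D (L (reversal T a)) = reversal (lad_graph D) (arc_of D (L a))"
    unfolding arc_of_L[OF a] arc_of_L[OF wf_graphD(3)[OF wf_T a]] lad_graph_D
    by (simp only: quotient_graph_simps(4)[OF a])
qed (rule is_tree)

sublocale labelled_tree D T \<pi> L
  by unfold_locales (rule delta_tree_D)

lemma star_perms_local_group: "w \<in> verts Q \<Longrightarrow> star_perms (r w) \<subseteq> local_group D w"
  unfolding local_group_D using star_perms_Bij[OF rep_in]
  by (intro closure_of_subset) (simp add: topspace_perm_topology carrier_BijGroup)

text \<open>Local groups are closures, so an element of the universal group need not act on a star
  like any single element of \<open>G\<close>. It does so on finite parts of the star, which is all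
  that \<open>local_approximation\<close> asks for.\<close>

theorem G_eq_universal_group: "G = universal_group D T \<pi> L"
proof (intro equalityI subsetI)
  fix g assume g: "g \<in> G"
  have "\<pi> (g v) = \<pi> v \<and> (\<exists>s\<in>local_group D (\<pi> v). \<forall>a\<in>arcs_from T v. L (arc_map T g a) = s (L a))"
    if v: "v \<in> verts T" for v
  proof -
    have gv: "g v \<in> verts T" by (rule G_verts[OF g v])
    have \<pi>: "\<pi> (g v) = \<pi> v" by (rule vertex_orbit_eqI[OF g v])
    let ?i = "restrict (inv_into (verts T) (\<gamma> v)) (verts T)"
    let ?m = "compose (verts T) (\<gamma> (g v)) g"
    \<comment> \<open>This is \<open>\<gamma> (g v) g (\<gamma> v)^-1\<close>. It fixes the
      representative, and its action on the star there is the local action of \<open>g\<close> at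
      \<open>v\<close>.\<close>
    let ?k = "compose (verts T) ?m ?i"
    have m: "?m \<in> G" by (rule G_compose[OF \<gamma>(1)[OF gv] g])
    have i: "?i \<in> G" by (rule G_inv[OF \<gamma>(1)[OF v]])
    have k: "?k \<in> G" by (rule G_compose[OF m i])
    have rv: "r (\<pi> v) \<in> verts T" by (rule rep_in[OF orbit_in[OF v]])
    have "?i (r (\<pi> v)) = v" using BijD(4)[OF G_Bij[OF \<gamma>(1)[OF v]] v] \<gamma>(2)[OF v] rv by simp
    then have "?k (r (\<pi> v)) = r (\<pi> v)" using \<gamma>(2)[OF gv] \<pi> v rv by (simp add: compose_def)
    then have s: "restrict (arc_map T ?k) (arcs_from T (r (\<pi> v))) \<in> local_group D (\<pi> v)"
      using star_perms_local_group[OF orbit_in[OF v]] k unfolding star_perms_def by blast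
    have "L (arc_map T g a) = restrict (arc_map T ?k) (arcs_from T (r (\<pi> v))) (L a)"
      if a: "a \<in> arcs_from T v" for a
    proof -
      have aT: "a \<in> arcs T" "orig T a = v" using a by (simp_all add: arcs_from_iff)
      have La: "L a \<in> arcs_from T (r (\<pi> v))" using L_in[OF aT(1)] aT(2) by simp
      have "arc_map T ?i (L a) = a" using arc_map_inv[OF \<gamma>(1)[OF v] aT(1)] aT(2) by (simp add: L_def)
      then have "arc_map T ?k (L a) = arc_map T ?m a"
        using arc_map_G_compose[OF m i, of "L a"] La by (simp add: arcs_from_iff)
      also have "\<dots> = arc_map T (\<gamma> (g v)) (arc_map T g a)"
        by (rule arc_map_G_compose[OF \<gamma>(1)[OF gv] g aT(1)])
      also have "\<dots> = L (arc_map T g a)"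
        unfolding L_def using graph_isoD(3)[OF G_iso[OF g] aT(1)] aT(2) by simp
      finally show ?thesis using La by simp
    qed
    then show ?thesis using \<pi> s by blast
  qed
  then show "g \<in> universal_group D T \<pi> L"
    using g G_Aut G_iso[OF g] by (auto simp: universal_group_def delta_iso_def)
next
  fix u assume u: "u \<in> universal_group D T \<pi> L"
  note uD = universal_groupD[OF u]
  show "u \<in> G"
  proof (rule local_approximation[OF uD(1)])
    fix v F assume v: "v \<in> verts T" and F: "finite F" "F \<subseteq> {w. (v, w) \<in> adjacency T}"
    note u_iso = tree_Aut_iso[OF is_tree uD(1)]
    have uv: "u v \<in> verts T" by (rule graph_iso_in(1)[OF u_iso v])
    have \<pi>: "\<pi> (u v) = \<pi> v" using delta_isoD(2)[OF uD(2) v] .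
    have "\<forall>w\<in>F. \<exists>a. a \<in> arcs T \<and> orig T a = v \<and> terminus T a = w"
      using F(2) by (auto elim!: adjacencyE)
    then obtain e where e: "\<And>w. w \<in> F \<Longrightarrow> e w \<in> arcs T" "\<And>w. w \<in> F \<Longrightarrow> orig T (e w) = v"
        "\<And>w. w \<in> F \<Longrightarrow> terminus T (e w) = w"
      by metis
    obtain s where s: "s \<in> local_group D (\<pi> v)" "\<forall>a\<in>arcs_from T v. L (arc_map T u a) = s (L a)"
      using delta_isoD(3)[OF uD(2) v] by blast
    let ?X = "arcs_from T (r (\<pi> v))"
    have rv: "r (\<pi> v) \<in> verts T" by (rule rep_in[OF orbit_in[OF v]])
    have "(\<lambda>w. L (e w)) ` F \<subseteq> ?X" using L_in[OF e(1)] e(2) by auto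
    then have "\<exists>t\<in>star_perms (r (\<pi> v)). \<forall>c\<in>(\<lambda>w. L (e w)) ` F. t c = s c"
      using s(1)[unfolded local_group_D in_perm_closure_iff[OF star_perms_Bij[OF rv]]] F(1) by blast
    then obtain k where k: "k \<in> G" "k (r (\<pi> v)) = r (\<pi> v)"
        "\<forall>w\<in>F. restrict (arc_map T k) ?X (L (e w)) = s (L (e w))"
      unfolding star_perms_def by blast
    \<comment> \<open>The preceding translation is undone:
      \<open>(\<gamma> (u v))^-1 k \<gamma> v\<close> lies in \<open>G\<close> and agrees with
      \<open>u\<close> on \<open>v\<close> and \<open>F\<close>, because \<open>k\<close> has the
      values of \<open>s\<close> on the labels of the arcs to \<open>F\<close>.\<close>
    let ?i = "restrict (inv_into (verts T) (\<gamma> (u v))) (verts T)"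
    let ?m = "compose (verts T) k (\<gamma> v)"
    let ?g = "compose (verts T) ?i ?m"
    have i: "?i \<in> G" by (rule G_inv[OF \<gamma>(1)[OF uv]])
    have m: "?m \<in> G" by (rule G_compose[OF k(1) \<gamma>(1)[OF v]])
    have g: "?g \<in> G" by (rule G_compose[OF i m])
    have "?m v = \<gamma> (u v) (u v)" using \<gamma>(2)[OF v] \<gamma>(2)[OF uv] \<pi> k(2) v by (simp add: compose_def)
    then have gv: "?g v = u v"
      using BijD(1,4)[OF G_Bij[OF \<gamma>(1)[OF uv]] uv] v by (simp add: compose_def)
    have "?g w = u w" if w: "w \<in> F" for w
    proof -
      note a = e(1)[OF w]
      have La: "L (e w) \<in> ?X" using L_in[OF a] e(2)[OF w] by simp
      have ua: "arc_map T u (e w) \<in> arcs T" "orig T (arc_map T u (e w)) = u v"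
        using graph_iso_in(2)[OF u_iso a] graph_isoD(3)[OF u_iso a] e(2)[OF w] by simp_all
      have "arc_map T ?m (e w) = arc_map T k (L (e w))"
        using arc_map_G_compose[OF k(1) \<gamma>(1)[OF v] a] e(2)[OF w] by (simp add: L_def)
      also have "\<dots> = L (arc_map T u (e w))"
        using bspec[OF k(3) w] bspec[OF s(2), of "e w"] La a e(2)[OF w] by (simp add: arcs_from_iff)
      also have "\<dots> = arc_map T (\<gamma> (u v)) (arc_map T u (e w))" using ua(2) by (simp add: L_def)
      finally have "arc_map T ?g (e w) = arc_map T u (e w)"
        using arc_map_G_compose[OF i m a] arc_map_inv[OF \<gamma>(1)[OF uv] ua(1)] by simp
      then show ?thesis
        using graph_iso_terminus[OF G_iso[OF g] wf_T a] graph_iso_terminus[OF u_iso wf_T a] e(3)[OF w]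
        by simp
    qed
    then show "\<exists>g\<in>G. g v = u v \<and> (\<forall>w\<in>F. g w = u w)" using g gv by blast
  qed
qed

end

section \<open>Isomorphism classes and conjugacy classes\<close>

lemma conjugate_by_apply: "y \<in> Y \<Longrightarrow> conjugate_by X Y f g y = f (g (inv_into X f y))"
  by (simp add: conjugate_by_def)

lemma conjugate_by_inv:
  assumes f: "bij_betw f X Y" and g: "g \<in> Bij Y"
  shows "conjugate_by X Y f (conjugate_by Y X (inv_into X f) g) = g"
proof (rule extensionalityI[of _ Y])
  show "conjugate_by X Y f (conjugate_by Y X (inv_into X f) g) \<in> extensional Y"
    by (simp add: conjugate_by_def)
  show "g \<in> extensional Y" by (rule Bij_imp_extensional[OF g])
  fix y assume y: "y \<in> Y"
  have iy: "inv_into X f y \<in> X" using bij_betwE[OF bij_betw_inv_into[OF f]] y by blast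
  have "inv_into Y (inv_into X f) (inv_into X f y) = y"
    by (rule inv_into_f_f[OF bij_betw_imp_inj_on[OF bij_betw_inv_into[OF f]] y])
  then show "conjugate_by X Y f (conjugate_by Y X (inv_into X f) g) y = g y"
    using bij_betw_inv_into_right[OF f BijD(1)[OF g y]] iy y by (simp add: conjugate_by_def)
qed

context labelled_tree_pair
begin

lemma conjugate_universal_group_le:
  assumes f: "delta_iso \<Delta> T \<pi> L T' \<pi>' L' f h" and g: "g \<in> U"
  shows "conjugate_by (verts T) (verts T') f g \<in> T'.U"
  unfolding conjugate_by_def
  by (rule T'.universal_groupI[OF T'.delta_iso_comp[OF delta_iso_inv[OF f]
      delta_iso_comp[OF universal_groupD(2)[OF g] f]]])

lemma conjugate_universal_group:
  assumes f: "delta_iso \<Delta> T \<pi> L T' \<pi>' L' f h"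
  shows "conjugate_by (verts T) (verts T') f ` U = T'.U"
proof (intro equalityI subsetI)
  fix g assume "g \<in> conjugate_by (verts T) (verts T') f ` U"
  then show "g \<in> T'.U" using conjugate_universal_group_le[OF f] by blast
next
  fix g assume g: "g \<in> T'.U"
  interpret inv: labelled_tree_pair \<Delta> T' \<pi>' L' T \<pi> L ..
  have "g \<in> Bij (verts T')" using T'.universal_groupD(1)[OF g] by (rule tree_Aut_Bij)
  from conjugate_by_inv[OF graph_isoD(1)[OF delta_isoD(1)[OF f]] this]
    inv.conjugate_universal_group_le[OF delta_iso_inv[OF f] g]
  show "g \<in> conjugate_by (verts T) (verts T') f ` U" by (metis imageI)
qed

text \<open>The identity is a local action between any two vertices over the same point. It extends
  to an isomorphism of labelled trees, which carries one universal group to the other.\<close>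

lemma conjugate_universal_groups: "conjugate_actions (T, U) (T', T'.U)"
proof -
  obtain v where v: "v \<in> verts T" using connected_T by (auto simp: connected_graph_def)
  obtain v' where v': "v' \<in> verts T'" "\<pi>' v' = \<pi> v" using T'.proj_surj[OF proj_in[OF v]] by blast
  obtain f h where f: "delta_iso \<Delta> T \<pi> L T' \<pi>' L' f h"
    using extend_local_action[OF v v' local_group_id[OF proj_in[OF v]]] by blast
  show ?thesis
    unfolding conjugate_actions_def prod.case
    using delta_isoD(1)[OF f] conjugate_universal_group[OF f] by blast
qed

end

section \<open>Transport of labellings, and the orbits of the universal group\<close>

context labelled_tree
begin

text \<open>Serves two purposes: to label the tree of a conjugate action, and to copy a constructed
  tree into another type.\<close>

lemma transport:
  assumes iso: "graph_iso T T' f h"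
  defines "\<pi>' \<equiv> \<pi> \<circ> inv_into (verts T) f" and "L' \<equiv> L \<circ> inv_into (arcs T) h"
  shows "delta_tree \<Delta> T' \<pi>' L'" "delta_iso \<Delta> T \<pi> L T' \<pi>' L' f h"
proof -
  note fb = graph_isoD(1)[OF iso] and hb = graph_isoD(2)[OF iso]
  have \<pi>': "\<pi>' (f v) = \<pi> v" if "v \<in> verts T" for v
    using bij_betw_inv_into_left[OF fb that] by (simp add: \<pi>'_def)
  have L': "L' (h a) = L a" if "a \<in> arcs T" for a
    using bij_betw_inv_into_left[OF hb that] by (simp add: L'_def)
  show "delta_iso \<Delta> T \<pi> L T' \<pi>' L' f h"
    unfolding delta_iso_def
  proof (intro conjI ballI)
    show "graph_iso T T' f h" by (rule iso)
    fix v assume v: "v \<in> verts T"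
    show "\<pi>' (f v) = \<pi> v" by (rule \<pi>'[OF v])
    show "\<exists>s\<in>local_group \<Delta> (\<pi> v). \<forall>a\<in>arcs_from T v. L' (h a) = s (L a)"
      by (rule bexI[OF _ local_group_id[OF proj_in[OF v]]]) (auto simp: arcs_from_iff label_in L')
  qed
  show "delta_tree \<Delta> T' \<pi>' L'"
    unfolding delta_tree_def
  proof (intro conjI ballI)
    show "tree T'" by (rule tree_iso[OF iso is_tree])
    fix v' assume "v' \<in> verts T'"
    then obtain v where v: "v \<in> verts T" "v' = f v" using fb unfolding bij_betw_def by blast
    show "\<pi>' v' \<in> verts \<Gamma>" using proj_in[OF v(1)] \<pi>'[OF v(1)] v(2) by simp
    have "bij_betw (L \<circ> inv_into (arcs_from T v) h) (arcs_from T' (f v)) (colours_at \<Delta> (\<pi> v))"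
      by (rule bij_betw_trans[OF bij_betw_inv_into[OF graph_iso_star[OF iso wf_T v(1)]] label_bij[OF v(1)]])
    moreover have "L' b = (L \<circ> inv_into (arcs_from T v) h) b" if b: "b \<in> arcs_from T' (f v)" for b
    proof -
      note star = graph_iso_star[OF iso wf_T v(1)]
      obtain a where a: "a \<in> arcs_from T v" "b = h a" using star b unfolding bij_betw_def by blast
      then show ?thesis using L' bij_betw_inv_into_left[OF star a(1)] by (simp add: arcs_from_iff)
    qed
    ultimately show "bij_betw L' (arcs_from T' v') (colours_at \<Delta> (\<pi>' v'))"
      unfolding v(2) \<pi>'[OF v(1)] by (simp cong: bij_betw_cong)
  next
    fix b assume "b \<in> arcs T'"
    then obtain a where a: "a \<in> arcs T" "b = h a" using hb unfolding bij_betw_def by blast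
    show "arc_of \<Delta> (L' (reversal T' b)) = reversal \<Gamma> (arc_of \<Delta> (L' b))"
      unfolding a(2) graph_isoD(4)[OF iso a(1)] L'[OF a(1)] L'[OF wf_graphD(3)[OF wf_T a(1)]]
      by (rule arc_of_rev[OF a(1)])
  qed
qed

text \<open>Extension of local actions from \<open>T\<close> to itself. Vertices over the same point
  are in one orbit, and the stabiliser of \<open>v\<close> induces the full local group on its star,
  with no closure to be taken; this is how a diagram can be recovered from its universal
  group.\<close>

lemma universal_group_transitive:
  assumes "v \<in> verts T" "w \<in> verts T" "\<pi> v = \<pi> w" "s \<in> local_group \<Delta> (\<pi> v)"
  shows "\<exists>g\<in>U. g v = w \<and> (\<forall>a\<in>arcs_from T v. L (arc_map T g a) = s (L a))"
proof -
  interpret self: labelled_tree_pair \<Delta> T \<pi> L T \<pi> L ..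
  obtain f h where f: "delta_iso \<Delta> T \<pi> L T \<pi> L f h" "f v = w" "\<forall>a\<in>arcs_from T v. L (h a) = s (L a)"
    using self.extend_local_action[OF assms(1,2) assms(3)[symmetric] assms(4)] by blast
  let ?g = "restrict f (verts T)"
  have iso: "graph_iso T T ?g h" by (rule graph_iso_cong[OF delta_isoD(1)[OF f(1)] wf_T]) simp_all
  have "?g v = w" using f(2) assms(1) by simp
  moreover have "\<forall>a\<in>arcs_from T v. L (arc_map T ?g a) = s (L a)"
    using f(3) arc_map_eq[OF is_tree iso] by (simp add: arcs_from_iff)
  ultimately show ?thesis using universal_groupI[OF f(1)] by blast
qed

lemma arc_of_universal_group:
  assumes g: "g \<in> U" and a: "a \<in> arcs T"
  shows "arc_of \<Delta> (L (arc_map T g a)) = arc_of \<Delta> (L a)"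
proof -
  have v: "orig T a \<in> verts T" by (rule wf_graphD(1)[OF wf_T a])
  obtain s where "s \<in> local_group \<Delta> (\<pi> (orig T a))" "L (arc_map T g a) = s (L a)"
    using delta_isoD(3)[OF universal_groupD(2)[OF g] v] a by (auto simp: arcs_from_iff)
  then show ?thesis using arc_of_local_group[OF proj_in[OF v] label_in[OF a]] by simp
qed

lemma universal_group_arc_transitive:
  assumes a: "a \<in> arcs T" and b: "b \<in> arcs T" and eq: "arc_of \<Delta> (L a) = arc_of \<Delta> (L b)"
  shows "\<exists>g\<in>U. arc_map T g a = b"
proof -
  have v: "orig T a \<in> verts T" "orig T b \<in> verts T" using wf_graphD(1)[OF wf_T] a b by blast+
  have \<pi>: "\<pi> (orig T a) = \<pi> (orig T b)" using arc_of_label(2)[OF a] arc_of_label(2)[OF b] eq by simp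
  obtain s where s: "s \<in> local_group \<Delta> (\<pi> (orig T a))" "s (L a) = L b"
    using local_group_transitive[OF proj_in[OF v(1)] label_in[OF a] _ eq] label_in[OF b] \<pi> by auto
  obtain g where g: "g \<in> U" "g (orig T a) = orig T b" "\<forall>a'\<in>arcs_from T (orig T a). L (arc_map T g a') = s (L a')"
    using universal_group_transitive[OF v \<pi> s(1)] by blast
  have iso: "graph_iso T T g (arc_map T g)" by (rule delta_isoD(1)[OF universal_groupD(2)[OF g(1)]])
  have "arc_map T g a = b"
    using graph_iso_in(2)[OF iso a] b graph_isoD(3)[OF iso a] g(2,3) s(2) a
    by (intro label_inj) (simp_all add: arcs_from_iff)
  then show ?thesis using g(1) by blast
qed

lemma arc_surj:
  assumes e: "e \<in> arcs \<Gamma>"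
  shows "\<exists>a\<in>arcs T. arc_of \<Delta> (L a) = e"
proof -
  obtain c where c: "c \<in> colours \<Delta> e" using colours_nonempty[OF e] by blast
  obtain v where v: "v \<in> verts T" "\<pi> v = orig \<Gamma> e" using proj_surj[OF wf_graphD(1)[OF wf_lad e]] by blast
  then obtain a where "a \<in> arcs T" "L a = c"
    using label_surj[OF v(1)] colours_atI[OF e c] by metis
  then show ?thesis using arc_of_eq[OF e c] by blast
qed

end

section \<open>The realisation relation, conjugacy of actions and isomorphism of diagrams\<close>

definition realises :: "('w, 'f, 'c) lad \<Rightarrow> ('v, 'e) graph \<Rightarrow> ('v \<Rightarrow> 'v) set \<Rightarrow> bool" where
  "realises \<Delta> T G \<longleftrightarrow> (\<exists>\<pi> L. delta_tree \<Delta> T \<pi> L \<and> G = universal_group \<Delta> T \<pi> L)"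

lemma labelled_treeI: "\<Delta> \<in> local_action_diagrams \<Longrightarrow> delta_tree \<Delta> T \<pi> L \<Longrightarrow> labelled_tree \<Delta> T \<pi> L"
  by (simp add: labelled_tree_def action_diagram_def labelled_tree_axioms_def)

lemma realises_P_closed:
  "\<Delta> \<in> local_action_diagrams \<Longrightarrow> realises \<Delta> T G \<Longrightarrow> (T, G) \<in> P_closed_actions"
  unfolding realises_def using labelled_tree.universal_group_P_closed[OF labelled_treeI] by blast

lemma realises_conjugate:
  assumes "\<Delta> \<in> local_action_diagrams" "realises \<Delta> T G" "realises \<Delta> T' G'"
  shows "conjugate_actions (T, G) (T', G')"
proof -
  obtain \<pi> L where 1: "delta_tree \<Delta> T \<pi> L" "G = universal_group \<Delta> T \<pi> L"
    using assms(2) unfolding realises_def by blast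
  obtain \<pi>' L' where 2: "delta_tree \<Delta> T' \<pi>' L'" "G' = universal_group \<Delta> T' \<pi>' L'"
    using assms(3) unfolding realises_def by blast
  interpret labelled_tree_pair \<Delta> T \<pi> L T' \<pi>' L'
    unfolding labelled_tree_pair_def by (intro conjI labelled_treeI[OF assms(1)] 1(1) 2(1))
  show ?thesis unfolding 1(2) 2(2) by (rule conjugate_universal_groups)
qed

lemma realises_conjugation:
  assumes D: "\<Delta> \<in> local_action_diagrams" and T: "realises \<Delta> T G" and conj: "conjugate_actions (T, G) (T', G')"
  shows "realises \<Delta> T' G'"
proof -
  obtain \<pi> L where 1: "delta_tree \<Delta> T \<pi> L" "G = universal_group \<Delta> T \<pi> L"
    using T unfolding realises_def by blast
  obtain f h where f: "graph_iso T T' f h" "conjugate_by (verts T) (verts T') f ` G = G'"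
    using conj unfolding conjugate_actions_def by auto
  interpret T: labelled_tree \<Delta> T \<pi> L by (rule labelled_treeI[OF D 1(1)])
  let ?\<pi>' = "\<pi> \<circ> inv_into (verts T) f" and ?L' = "L \<circ> inv_into (arcs T) h"
  note tr = T.transport[OF f(1)]
  interpret labelled_tree_pair \<Delta> T \<pi> L T' ?\<pi>' ?L'
    unfolding labelled_tree_pair_def by (intro conjI T.labelled_tree_axioms labelled_treeI[OF D tr(1)])
  show ?thesis
    unfolding realises_def using tr(1) conjugate_universal_group[OF tr(2)] 1(2) f(2) by blast
qed

text \<open>The tree stays fixed and its labels are pushed through \<open>\<theta>X\<close>. The
  local actions of an automorphism are conjugated by \<open>\<theta>X\<close>, as are the local
  groups, so the same automorphisms qualify.\<close>

lemma realises_isomorphic_lads: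
  fixes \<Delta> :: "('w, 'f, 'c) lad" and \<Delta>' :: "('w1, 'f1, 'c1) lad"
  assumes D: "\<Delta> \<in> local_action_diagrams" and D': "\<Delta>' \<in> local_action_diagrams"
    and iso: "isomorphic_lads \<Delta> \<Delta>'" and T: "realises \<Delta> T G"
  shows "realises \<Delta>' T G"
proof -
  obtain \<pi> L where 1: "delta_tree \<Delta> T \<pi> L" "G = universal_group \<Delta> T \<pi> L"
    using T unfolding realises_def by blast
  interpret labelled_tree \<Delta> T \<pi> L by (rule labelled_treeI[OF D 1(1)])
  interpret D': action_diagram \<Delta>' by (rule action_diagram.intro[OF D'])
  obtain \<theta> \<theta>A \<theta>X where \<theta>: "graph_iso \<Gamma> D'.\<Gamma> \<theta> \<theta>A"
    and X: "\<forall>w\<in>verts \<Gamma>. bij_betw (\<theta>X w) (colours_at \<Delta> w) (colours_at \<Delta>' (\<theta> w)) \<and>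
          (\<forall>e\<in>arcs_from \<Gamma> w. bij_betw (\<theta>X w) (colours \<Delta> e) (colours \<Delta>' (\<theta>A e))) \<and>
          conjugate_by (colours_at \<Delta> w) (colours_at \<Delta>' (\<theta> w)) (\<theta>X w) ` local_group \<Delta> w =
            local_group \<Delta>' (\<theta> w)"
    using iso unfolding isomorphic_lads_def by blast
  have X1: "bij_betw (\<theta>X w) (colours_at \<Delta> w) (colours_at \<Delta>' (\<theta> w))"
    and X2: "e \<in> arcs_from \<Gamma> w \<Longrightarrow> bij_betw (\<theta>X w) (colours \<Delta> e) (colours \<Delta>' (\<theta>A e))"
    and X3: "conjugate_by (colours_at \<Delta> w) (colours_at \<Delta>' (\<theta> w)) (\<theta>X w) ` local_group \<Delta> w =
            local_group \<Delta>' (\<theta> w)" if "w \<in> verts \<Gamma>" for w e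
    using X that by blast+
  define \<pi>' where "\<pi>' v = \<theta> (\<pi> v)" for v
  define L' where "L' a = \<theta>X (\<pi> (orig T a)) (L a)" for a
  have arc: "arc_of \<Delta>' (L' a) = \<theta>A (arc_of \<Delta> (L a))" if a: "a \<in> arcs T" for a
  proof (rule D'.arc_of_eq)
    note c = arc_of_colours_at[OF label_in[OF a]]
    show "\<theta>A (arc_of \<Delta> (L a)) \<in> arcs D'.\<Gamma>" by (rule graph_iso_in(2)[OF \<theta> c(1)])
    have "arc_of \<Delta> (L a) \<in> arcs_from \<Gamma> (\<pi> (orig T a))" using c by (simp add: arcs_from_iff)
    from bij_betwE[OF X2[OF proj_in[OF wf_graphD(1)[OF wf_T a]] this]] c(3)
    show "L' a \<in> colours \<Delta>' (\<theta>A (arc_of \<Delta> (L a)))" by (simp add: L'_def)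
  qed
  have dt: "delta_tree \<Delta>' T \<pi>' L'"
    unfolding delta_tree_def
  proof (intro conjI ballI)
    fix v assume v: "v \<in> verts T"
    show "\<pi>' v \<in> verts D'.\<Gamma>" unfolding \<pi>'_def by (rule graph_iso_in(1)[OF \<theta> proj_in[OF v]])
    have "bij_betw (\<theta>X (\<pi> v) \<circ> L) (arcs_from T v) (colours_at \<Delta>' (\<pi>' v))"
      unfolding \<pi>'_def by (rule bij_betw_trans[OF label_bij[OF v] X1[OF proj_in[OF v]]])
    then show "bij_betw L' (arcs_from T v) (colours_at \<Delta>' (\<pi>' v))"
      by (rule bij_betw_cong[THEN iffD1, rotated]) (simp add: L'_def arcs_from_iff)
  next
    fix a assume a: "a \<in> arcs T"
    show "arc_of \<Delta>' (L' (reversal T a)) = reversal D'.\<Gamma> (arc_of \<Delta>' (L' a))"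
      unfolding arc[OF a] arc[OF wf_graphD(3)[OF wf_T a]] arc_of_rev[OF a]
        graph_isoD(4)[OF \<theta> arc_of_label(1)[OF a]] ..
  qed (rule is_tree)
  interpret L': labelled_tree \<Delta>' T \<pi>' L' by (rule labelled_treeI[OF D' dt])
  have "(\<pi>' (g v) = \<pi>' v \<and> (\<exists>s\<in>local_group \<Delta>' (\<pi>' v). \<forall>a\<in>arcs_from T v. L' (arc_map T g a) = s (L' a))) \<longleftrightarrow>
      (\<pi> (g v) = \<pi> v \<and> (\<exists>s\<in>local_group \<Delta> (\<pi> v). \<forall>a\<in>arcs_from T v. L (arc_map T g a) = s (L a)))"
    if g: "g \<in> tree_Aut T" and v: "v \<in> verts T" for g v
  proof -
    note g_iso = tree_Aut_iso[OF is_tree g]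
    let ?w = "\<pi> v"
    let ?X = "colours_at \<Delta> ?w" and ?X' = "colours_at \<Delta>' (\<theta> ?w)"
    have w: "?w \<in> verts \<Gamma>" "\<pi> (g v) \<in> verts \<Gamma>" using proj_in v graph_iso_in(1)[OF g_iso v] by blast+
    have "\<pi>' (g v) = \<pi>' v \<longleftrightarrow> \<pi> (g v) = \<pi> v"
      unfolding \<pi>'_def using bij_betw_imp_inj_on[OF graph_isoD(1)[OF \<theta>]] w by (simp add: inj_on_eq_iff)
    moreover have "(\<exists>s\<in>local_group \<Delta>' (\<pi>' v). \<forall>a\<in>arcs_from T v. L' (arc_map T g a) = s (L' a)) \<longleftrightarrow>
        (\<exists>s\<in>local_group \<Delta> ?w. \<forall>a\<in>arcs_from T v. L (arc_map T g a) = s (L a))"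
      if gv: "\<pi> (g v) = \<pi> v"
    proof -
      have "L' (arc_map T g a) = conjugate_by ?X ?X' (\<theta>X ?w) s (L' a) \<longleftrightarrow> L (arc_map T g a) = s (L a)"
        if a: "a \<in> arcs_from T v" and s: "s \<in> local_group \<Delta> ?w" for a s
      proof -
        have aT: "a \<in> arcs T" "orig T a = v" using a by (simp_all add: arcs_from_iff)
        have ga: "arc_map T g a \<in> arcs T" "orig T (arc_map T g a) = g v"
          using graph_iso_in(2)[OF g_iso aT(1)] graph_isoD(3)[OF g_iso aT(1)] aT(2) by simp_all
        have La: "L a \<in> ?X" "L (arc_map T g a) \<in> ?X" using label_in[OF aT(1)] label_in[OF ga(1)] aT ga gv by simp_all
        have sa: "s (L a) \<in> ?X" by (rule BijD(1)[OF local_group_Bij[OF w(1) s] La(1)])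
        have L'a: "L' a = \<theta>X ?w (L a)" "L' (arc_map T g a) = \<theta>X ?w (L (arc_map T g a))"
          using aT ga gv by (simp_all add: L'_def)
        have "\<theta>X ?w (L a) \<in> ?X'" using bij_betwE[OF X1[OF w(1)]] La(1) by blast
        then have "conjugate_by ?X ?X' (\<theta>X ?w) s (L' a) = \<theta>X ?w (s (L a))"
          using bij_betw_inv_into_left[OF X1[OF w(1)] La(1)] by (simp add: conjugate_by_apply L'a(1))
        then show ?thesis
          using inj_on_eq_iff[OF bij_betw_imp_inj_on[OF X1[OF w(1)]] La(2) sa] by (simp add: L'a(2))
      qed
      then show ?thesis unfolding \<pi>'_def X3[OF w(1), symmetric] by auto
    qed
    ultimately show ?thesis by blast
  qed
  note eq = this
  have "delta_iso \<Delta>' T \<pi>' L' T \<pi>' L' g (arc_map T g) \<longleftrightarrow> delta_iso \<Delta> T \<pi> L T \<pi> L g (arc_map T g)"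
    if "g \<in> tree_Aut T" for g
    unfolding delta_iso_def by (rule arg_cong2[where f = "(\<and>)", OF refl ball_cong[OF refl eq[OF that]]])
  then have "universal_group \<Delta>' T \<pi>' L' = G"
    unfolding 1(2) universal_group_def by blast
  then show ?thesis unfolding realises_def using dt by blast
qed

section \<open>Diagrams realised by the same action\<close>

locale two_labellings = L: labelled_tree \<Delta> T \<pi> L + L': labelled_tree \<Delta>' T \<pi>' L'
  for \<Delta> :: "('w, 'f, 'c) lad" and T :: "('v, 'e) graph" and \<pi> L
    and \<Delta>' :: "('w1, 'f1, 'c1) lad" and \<pi>' L' +
  assumes same_group: "universal_group \<Delta> T \<pi> L = universal_group \<Delta>' T \<pi>' L'"
begin

text \<open>An element of the common group moves \<open>v\<close> to \<open>w\<close>, and this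
  group also preserves \<open>\<pi>'\<close>.\<close>

lemma proj_transfer:
  assumes "v \<in> verts T" "w \<in> verts T" "\<pi> v = \<pi> w"
  shows "\<pi>' v = \<pi>' w"
proof -
  obtain g where "g \<in> L.U" "g v = w"
    using L.universal_group_transitive[OF assms L.local_group_id[OF L.proj_in[OF assms(1)]]] by blast
  then show ?thesis
    using delta_isoD(2)[OF L'.universal_groupD(2) assms(1), of g] same_group by simp
qed

lemma arc_transfer:
  assumes "a \<in> arcs T" "b \<in> arcs T" "arc_of \<Delta> (L a) = arc_of \<Delta> (L b)"
  shows "arc_of \<Delta>' (L' a) = arc_of \<Delta>' (L' b)"
proof -
  obtain g where "g \<in> L.U" "arc_map T g a = b" using L.universal_group_arc_transitive[OF assms] by blast
  then show ?thesis using L'.arc_of_universal_group[of g a] assms(1) same_group by simp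
qed

lemma two_labellings_sym: "two_labellings \<Delta>' T \<pi>' L' \<Delta> \<pi> L"
  by (simp add: two_labellings_def two_labellings_axioms_def L.labelled_tree_axioms L'.labelled_tree_axioms same_group)

text \<open>Vertices and arcs of either graph stand for the orbits of one and the same group on
  \<open>T\<close>, which gives \<open>\<theta>\<close> and \<open>\<theta>A\<close>. Colours are
  matched by comparing the two labellings of a single star over each vertex.\<close>

lemma isomorphic_lads: "isomorphic_lads \<Delta> \<Delta>'"
proof -
  \<comment> \<open>With the diagrams exchanged, the transfer lemmas yield injectivity of
    \<open>\<theta>\<close> and \<open>\<theta>A\<close>.\<close>
  interpret inv: two_labellings \<Delta>' T \<pi>' L' \<Delta> \<pi> L by (rule two_labellings_sym)
  define vx where "vx w = (SOME v. v \<in> verts T \<and> \<pi> v = w)" for w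
  have vx: "vx w \<in> verts T" "\<pi> (vx w) = w" if w: "w \<in> verts L.\<Gamma>" for w
  proof -
    have "\<exists>v. v \<in> verts T \<and> \<pi> v = w" using L.proj_surj[OF w] by blast
    from someI_ex[OF this] show "vx w \<in> verts T" "\<pi> (vx w) = w" by (simp_all add: vx_def)
  qed
  define ax where "ax e = (SOME a. a \<in> arcs T \<and> arc_of \<Delta> (L a) = e)" for e
  have ax: "ax e \<in> arcs T" "arc_of \<Delta> (L (ax e)) = e" if e: "e \<in> arcs L.\<Gamma>" for e
  proof -
    have "\<exists>a. a \<in> arcs T \<and> arc_of \<Delta> (L a) = e" using L.arc_surj[OF e] by blast
    from someI_ex[OF this] show "ax e \<in> arcs T" "arc_of \<Delta> (L (ax e)) = e" by (simp_all add: ax_def)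
  qed
  define \<theta> where "\<theta> w = \<pi>' (vx w)" for w
  define \<theta>A where "\<theta>A e = arc_of \<Delta>' (L' (ax e))" for e
  have \<theta>: "\<theta> (\<pi> v) = \<pi>' v" if v: "v \<in> verts T" for v
    unfolding \<theta>_def using vx[OF L.proj_in[OF v]] v by (intro proj_transfer) simp_all
  have \<theta>A: "\<theta>A (arc_of \<Delta> (L a)) = arc_of \<Delta>' (L' a)" if a: "a \<in> arcs T" for a
    unfolding \<theta>A_def using ax[OF L.arc_of_label(1)[OF a]] a by (intro arc_transfer) simp_all
  have \<theta>_bij: "bij_betw \<theta> (verts L.\<Gamma>) (verts L'.\<Gamma>)"
    unfolding bij_betw_def
  proof
    show "inj_on \<theta> (verts L.\<Gamma>)"
    proof (rule inj_onI)
      fix x y assume xy: "x \<in> verts L.\<Gamma>" "y \<in> verts L.\<Gamma>" "\<theta> x = \<theta> y"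
      then have "\<pi> (vx x) = \<pi> (vx y)" unfolding \<theta>_def using vx(1) by (intro inv.proj_transfer) simp_all
      then show "x = y" using vx(2) xy by simp
    qed
    have "\<theta> w \<in> verts L'.\<Gamma>" if "w \<in> verts L.\<Gamma>" for w
      unfolding \<theta>_def by (rule L'.proj_in[OF vx(1)[OF that]])
    moreover have "w' \<in> \<theta> ` verts L.\<Gamma>" if w': "w' \<in> verts L'.\<Gamma>" for w'
    proof -
      obtain v where v: "v \<in> verts T" "\<pi>' v = w'" using L'.proj_surj[OF w'] by blast
      then show ?thesis using \<theta>[OF v(1)] L.proj_in[OF v(1)] by (metis imageI)
    qed
    ultimately show "\<theta> ` verts L.\<Gamma> = verts L'.\<Gamma>" by blast
  qed
  have \<theta>A_inj: "arc_of \<Delta> (L a) = e" if "a \<in> arcs T" "e \<in> arcs L.\<Gamma>" "arc_of \<Delta>' (L' a) = \<theta>A e" for a e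
    using inv.arc_transfer[of a "ax e"] ax[OF that(2)] that unfolding \<theta>A_def by simp
  have \<theta>A_bij: "bij_betw \<theta>A (arcs L.\<Gamma>) (arcs L'.\<Gamma>)"
    unfolding bij_betw_def
  proof
    show "inj_on \<theta>A (arcs L.\<Gamma>)"
    proof (rule inj_onI)
      fix x y assume xy: "x \<in> arcs L.\<Gamma>" "y \<in> arcs L.\<Gamma>" "\<theta>A x = \<theta>A y"
      then have "arc_of \<Delta>' (L' (ax x)) = \<theta>A y" by (simp add: \<theta>A_def)
      then show "x = y" using \<theta>A_inj[OF ax(1)[OF xy(1)] xy(2)] ax(2)[OF xy(1)] by simp
    qed
    have "\<theta>A e \<in> arcs L'.\<Gamma>" if "e \<in> arcs L.\<Gamma>" for e
      unfolding \<theta>A_def by (rule L'.arc_of_label(1)[OF ax(1)[OF that]])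
    moreover have "e' \<in> \<theta>A ` arcs L.\<Gamma>" if e': "e' \<in> arcs L'.\<Gamma>" for e'
    proof -
      obtain a where a: "a \<in> arcs T" "arc_of \<Delta>' (L' a) = e'" using L'.arc_surj[OF e'] by blast
      then show ?thesis using \<theta>A[OF a(1)] L.arc_of_label(1)[OF a(1)] by (metis imageI)
    qed
    ultimately show "\<theta>A ` arcs L.\<Gamma> = arcs L'.\<Gamma>" by blast
  qed
  have "graph_iso L.\<Gamma> L'.\<Gamma> \<theta> \<theta>A"
    unfolding graph_iso_def
  proof (intro conjI ballI \<theta>_bij \<theta>A_bij)
    fix e assume "e \<in> arcs L.\<Gamma>"
    then obtain a where a: "a \<in> arcs T" "arc_of \<Delta> (L a) = e" using L.arc_surj by blast
    note V = wf_graphD(1)[OF L.wf_T a(1)] and R = wf_graphD(3)[OF L.wf_T a(1)]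
    show "orig L'.\<Gamma> (\<theta>A e) = \<theta> (orig L.\<Gamma> e)"
      unfolding a(2)[symmetric] \<theta>A[OF a(1)] L.arc_of_label(2)[OF a(1)] L'.arc_of_label(2)[OF a(1)] \<theta>[OF V] ..
    show "reversal L'.\<Gamma> (\<theta>A e) = \<theta>A (reversal L.\<Gamma> e)"
      unfolding a(2)[symmetric] \<theta>A[OF a(1)] L.arc_of_rev[OF a(1), symmetric]
        L'.arc_of_rev[OF a(1), symmetric] \<theta>A[OF R] ..
  qed
  \<comment> \<open>Sends the colour of an arc at \<open>vx w\<close> in the first labelling to its
    colour in the second.\<close>
  moreover define \<theta>X where "\<theta>X w = L' \<circ> inv_into (arcs_from T (vx w)) L" for w
  have "bij_betw (\<theta>X w) (colours_at \<Delta> w) (colours_at \<Delta>' (\<theta> w)) \<and>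
          (\<forall>e\<in>arcs_from L.\<Gamma> w. bij_betw (\<theta>X w) (colours \<Delta> e) (colours \<Delta>' (\<theta>A e))) \<and>
          conjugate_by (colours_at \<Delta> w) (colours_at \<Delta>' (\<theta> w)) (\<theta>X w) ` local_group \<Delta> w =
            local_group \<Delta>' (\<theta> w)" if w: "w \<in> verts L.\<Gamma>" for w
  proof (intro conjI ballI)
    let ?v = "vx w" and ?X = "colours_at \<Delta> w" and ?X' = "colours_at \<Delta>' (\<theta> w)"
    note v = vx[OF w]
    have Lb: "bij_betw L (arcs_from T ?v) ?X" using L.label_bij[OF v(1)] v(2) by simp
    have Lb': "bij_betw L' (arcs_from T ?v) ?X'" using L'.label_bij[OF v(1)] by (simp add: \<theta>_def)
    have pre: "\<exists>a. a \<in> arcs_from T ?v \<and> L a = c" if "c \<in> ?X" for c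
    proof -
      have "c \<in> L ` arcs_from T ?v" unfolding bij_betw_imp_surj_on[OF Lb] by (rule that)
      then show ?thesis by blast
    qed
    have pre': "\<exists>a. a \<in> arcs_from T ?v \<and> L' a = c" if "c \<in> ?X'" for c
    proof -
      have "c \<in> L' ` arcs_from T ?v" unfolding bij_betw_imp_surj_on[OF Lb'] by (rule that)
      then show ?thesis by blast
    qed
    show Xb: "bij_betw (\<theta>X w) ?X ?X'"
      unfolding \<theta>X_def by (rule bij_betw_trans[OF bij_betw_inv_into[OF Lb] Lb'])
    have XL: "\<theta>X w (L a) = L' a" if "a \<in> arcs_from T ?v" for a
      using bij_betw_inv_into_left[OF Lb that] by (simp add: \<theta>X_def)
    show "bij_betw (\<theta>X w) (colours \<Delta> e) (colours \<Delta>' (\<theta>A e))" if e: "e \<in> arcs_from L.\<Gamma> w" for e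
    proof -
      have eG: "e \<in> arcs L.\<Gamma>" "orig L.\<Gamma> e = w" using e by (simp_all add: arcs_from_iff)
      have sub: "colours \<Delta> e \<subseteq> ?X" using L.colours_atI[OF eG(1)] eG(2) by blast
      have e': "\<theta>A e \<in> arcs L'.\<Gamma>" "orig L'.\<Gamma> (\<theta>A e) = \<theta> w"
        using graph_iso_in(2)[OF \<open>graph_iso L.\<Gamma> L'.\<Gamma> \<theta> \<theta>A\<close> eG(1)]
          graph_isoD(3)[OF \<open>graph_iso L.\<Gamma> L'.\<Gamma> \<theta> \<theta>A\<close> eG(1)] eG(2) by simp_all
      have sub': "colours \<Delta>' (\<theta>A e) \<subseteq> ?X'" using L'.colours_atI[OF e'(1)] unfolding e'(2) by blast
      have "\<theta>X w c \<in> colours \<Delta>' (\<theta>A e)" if c: "c \<in> colours \<Delta> e" for c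
      proof -
        obtain a where a: "a \<in> arcs_from T ?v" "L a = c"
          using pre[OF subsetD[OF sub c]] by blast
        have aT: "a \<in> arcs T" using a(1) by (simp add: arcs_from_iff)
        have "\<theta>A e = arc_of \<Delta>' (L' a)" using \<theta>A[OF aT] a(2) L.arc_of_eq[OF eG(1) c] by simp
        then show ?thesis using L'.arc_of_colours_at(3)[OF L'.label_in[OF aT]] XL[OF a(1)] a(2) by simp
      qed
      moreover have "c' \<in> \<theta>X w ` colours \<Delta> e" if c': "c' \<in> colours \<Delta>' (\<theta>A e)" for c'
      proof -
        obtain a where a: "a \<in> arcs_from T ?v" "L' a = c'"
          using pre'[OF subsetD[OF sub' c']] by blast
        have aT: "a \<in> arcs T" using a(1) by (simp add: arcs_from_iff)
        have "arc_of \<Delta>' (L' a) = \<theta>A e"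
          using L'.arc_of_eq[OF e'(1) c'] a(2) by simp
        then have "arc_of \<Delta> (L a) = e" by (rule \<theta>A_inj[OF aT eG(1)])
        then have "L a \<in> colours \<Delta> e" using L.arc_of_colours_at(3)[OF L.label_in[OF aT]] by simp
        then show ?thesis using XL[OF a(1)] a(2) by (metis imageI)
      qed
      ultimately show ?thesis
        unfolding bij_betw_def using inj_on_subset[OF bij_betw_imp_inj_on[OF Xb] sub] by blast
    qed
    \<comment> \<open>The elements \<open>s\<close> and \<open>s'\<close> describe the same
      permutation of the star of \<open>vx w\<close>, that of \<open>g\<close>, in the two
      labellings; \<open>\<theta>X w\<close> translates between these.\<close>
    have key: "conjugate_by ?X ?X' (\<theta>X w) s = s'"
      if s: "s \<in> local_group \<Delta> w" and s': "s' \<in> local_group \<Delta>' (\<theta> w)" and g: "g \<in> L.U" "g ?v = ?v"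
        "\<forall>a\<in>arcs_from T ?v. L (arc_map T g a) = s (L a)" "\<forall>a\<in>arcs_from T ?v. L' (arc_map T g a) = s' (L' a)"
      for s s' g
    proof (rule extensionalityI[of _ ?X'])
      show "conjugate_by ?X ?X' (\<theta>X w) s \<in> extensional ?X'" by (simp add: conjugate_by_def)
      have "\<theta> w \<in> verts L'.\<Gamma>" using bij_betwE[OF \<theta>_bij] w by blast
      then show "s' \<in> extensional ?X'" using L'.local_group_Bij[OF _ s'] Bij_imp_extensional by blast
      fix c' assume c': "c' \<in> ?X'"
      then obtain a where a: "a \<in> arcs_from T ?v" "L' a = c'" using pre' by blast
      have La: "L a \<in> ?X" using bij_betwE[OF Lb] a(1) by blast
      have "inv_into ?X (\<theta>X w) c' = L a" using bij_betw_inv_into_left[OF Xb La] XL[OF a(1)] a(2) by simp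
      then have "conjugate_by ?X ?X' (\<theta>X w) s c' = \<theta>X w (L (arc_map T g a))"
        using c' g(3) a(1) by (simp add: conjugate_by_apply)
      also have "arc_map T g a \<in> arcs_from T ?v"
        using bij_betwE[OF graph_iso_star[OF delta_isoD(1)[OF L.universal_groupD(2)[OF g(1)]] L.wf_T v(1)]]
          a(1) g(2) by simp
      then have "\<theta>X w (L (arc_map T g a)) = L' (arc_map T g a)" by (rule XL)
      also have "\<dots> = s' c'" using g(4) a by simp
      finally show "conjugate_by ?X ?X' (\<theta>X w) s c' = s' c'" .
    qed
    have \<theta>w: "\<pi>' ?v = \<theta> w" by (simp add: \<theta>_def)
    show "conjugate_by ?X ?X' (\<theta>X w) ` local_group \<Delta> w = local_group \<Delta>' (\<theta> w)"
    proof (intro equalityI subsetI)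
      fix t assume "t \<in> conjugate_by ?X ?X' (\<theta>X w) ` local_group \<Delta> w"
      then obtain s where s: "s \<in> local_group \<Delta> w" "t = conjugate_by ?X ?X' (\<theta>X w) s" by blast
      obtain g where g: "g \<in> L.U" "g ?v = ?v" "\<forall>a\<in>arcs_from T ?v. L (arc_map T g a) = s (L a)"
        using L.universal_group_transitive[OF v(1) v(1) refl, of s] s(1) v(2) by auto
      obtain s' where s': "s' \<in> local_group \<Delta>' (\<theta> w)" "\<forall>a\<in>arcs_from T ?v. L' (arc_map T g a) = s' (L' a)"
        using delta_isoD(3)[OF L'.universal_groupD(2) v(1), of g] g(1) same_group \<theta>w by auto
      show "t \<in> local_group \<Delta>' (\<theta> w)" using key[OF s(1) s'(1) g s'(2)] s(2) s'(1) by simp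
    next
      fix s' assume s': "s' \<in> local_group \<Delta>' (\<theta> w)"
      obtain g where g: "g \<in> L'.U" "g ?v = ?v" "\<forall>a\<in>arcs_from T ?v. L' (arc_map T g a) = s' (L' a)"
        using L'.universal_group_transitive[OF v(1) v(1) refl, of s'] s' \<theta>w by auto
      have gU: "g \<in> L.U" using g(1) same_group by simp
      obtain s where s: "s \<in> local_group \<Delta> w" "\<forall>a\<in>arcs_from T ?v. L (arc_map T g a) = s (L a)"
        using delta_isoD(3)[OF L.universal_groupD(2)[OF gU] v(1)] v(2) by auto
      show "s' \<in> conjugate_by ?X ?X' (\<theta>X w) ` local_group \<Delta> w"
        using key[OF s(1) s' gU g(2) s(2) g(3)] s(1) by blast
    qed
  qed
  ultimately show ?thesis unfolding isomorphic_lads_def by blast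
qed

end

lemma realises_unique:
  assumes "\<Delta> \<in> local_action_diagrams" "\<Delta>' \<in> local_action_diagrams" "realises \<Delta> T G" "realises \<Delta>' T G"
  shows "isomorphic_lads \<Delta> \<Delta>'"
proof -
  obtain \<pi> L where 1: "delta_tree \<Delta> T \<pi> L" "G = universal_group \<Delta> T \<pi> L"
    using assms(3) unfolding realises_def by blast
  obtain \<pi>' L' where 2: "delta_tree \<Delta>' T \<pi>' L'" "G = universal_group \<Delta>' T \<pi>' L'"
    using assms(4) unfolding realises_def by blast
  have "two_labellings \<Delta> T \<pi> L \<Delta>' \<pi>' L'"
    unfolding two_labellings_def two_labellings_axioms_def
    using labelled_treeI[OF assms(1) 1(1)] labelled_treeI[OF assms(2) 2(1)] 1(2) 2(2) by simp
  then show ?thesis by (rule two_labellings.isomorphic_lads)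
qed

section \<open>Existence of labelled trees\<close>

text \<open>
  A vertex of the tree is the reversed list of colours read along the path from the base vertex.
  The arc back to the parent is labelled by a fixed colour of the reverse of the last arc.
\<close>

context action_diagram
begin

definition back_colour :: "'c \<Rightarrow> 'c" where
  "back_colour c = (SOME c'. c' \<in> colours \<Delta> (reversal \<Gamma> (arc_of \<Delta> c)))"

primrec end_vertex :: "'w \<Rightarrow> 'c list \<Rightarrow> 'w" where
  "end_vertex w [] = w"
| "end_vertex w (c # l) = terminus \<Gamma> (arc_of \<Delta> c)"

text \<open>The head of the list is the colour read last. Backtracking excludes one colour of the
  reverse arc and not the whole arc: its other colours lead to new vertices, since each colour has
  to occur once in a star.\<close>

primrec reduced :: "'w \<Rightarrow> 'c list \<Rightarrow> bool" where
  "reduced w [] = True"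
| "reduced w (c # l) = (reduced w l \<and> c \<in> colours_at \<Delta> (end_vertex w l) \<and> (l \<noteq> [] \<longrightarrow> c \<noteq> back_colour (hd l)))"

text \<open>An arc is coded by its origin and its label, so that a star carries each colour once by
  construction.\<close>

definition colour_tree :: "'w \<Rightarrow> ('c list, 'c list \<times> 'c) graph" where
  "colour_tree w = \<lparr>verts = {l. reduced w l}, arcs = {(l, c). reduced w l \<and> c \<in> colours_at \<Delta> (end_vertex w l)},
     orig = fst,
     reversal = (\<lambda>(l, c). if l \<noteq> [] \<and> c = back_colour (hd l) then (tl l, hd l) else (c # l, back_colour c))\<rparr>"

lemma back_colour:
  assumes "c \<in> colours_at \<Delta> v"
  shows "back_colour c \<in> colours_at \<Delta> (terminus \<Gamma> (arc_of \<Delta> c))"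
    "arc_of \<Delta> (back_colour c) = reversal \<Gamma> (arc_of \<Delta> c)"
proof -
  note e = arc_of_colours_at(1)[OF assms]
  note r = wf_graphD(3)[OF wf_lad e]
  have "\<exists>c'. c' \<in> colours \<Delta> (reversal \<Gamma> (arc_of \<Delta> c))" using colours_nonempty[OF r] by blast
  from someI_ex[OF this] have "back_colour c \<in> colours \<Delta> (reversal \<Gamma> (arc_of \<Delta> c))"
    unfolding back_colour_def .
  from colours_atI[OF r this] arc_of_eq[OF r this]
  show "back_colour c \<in> colours_at \<Delta> (terminus \<Gamma> (arc_of \<Delta> c))"
    "arc_of \<Delta> (back_colour c) = reversal \<Gamma> (arc_of \<Delta> c)"
    by (simp_all only: terminus_def)
qed

lemma colour_tree_simps:
  "verts (colour_tree w) = {l. reduced w l}"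
  "(l, c) \<in> arcs (colour_tree w) \<longleftrightarrow> reduced w l \<and> c \<in> colours_at \<Delta> (end_vertex w l)"
  "orig (colour_tree w) (l, c) = l"
  "reversal (colour_tree w) (l, c) =
     (if l \<noteq> [] \<and> c = back_colour (hd l) then (tl l, hd l) else (c # l, back_colour c))"
  "terminus (colour_tree w) (l, c) = (if l \<noteq> [] \<and> c = back_colour (hd l) then tl l else c # l)"
  by (simp_all add: colour_tree_def terminus_def)

lemma colour_tree_rooted: "rooted_tree (colour_tree w) [] length tl"
proof
  let ?T = "colour_tree w"
  show "wf_graph ?T"
    unfolding wf_graph_def
  proof (clarify)
    fix l c assume a: "(l, c) \<in> arcs ?T"
    then have lc: "reduced w l" "c \<in> colours_at \<Delta> (end_vertex w l)" by (simp_all add: colour_tree_simps)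
    show "orig ?T (l, c) \<in> verts ?T \<and> reversal ?T (l, c) \<in> arcs ?T \<and> reversal ?T (reversal ?T (l, c)) = (l, c)"
    proof (cases "l \<noteq> [] \<and> c = back_colour (hd l)")
      case True
      \<comment> \<open>As \<open>d # l'\<close> is reduced, the arc \<open>(l', d)\<close> falls
        under the other case of \<open>reversal\<close>, which leads back to
        \<open>(d # l', back_colour d)\<close>; this makes reversal an involution.\<close>
      then obtain d l' where l: "l = d # l'" "c = back_colour d" by (cases l) auto
      then show ?thesis using lc by (auto simp: colour_tree_simps)
    next
      case False
      then show ?thesis using lc back_colour(1)[OF lc(2)] by (auto simp: colour_tree_simps)
    qed
  qed
  show "simple_graph ?T"
    unfolding simple_graph_def
  proof (intro conjI)
    show "\<forall>a\<in>arcs ?T. orig ?T a \<noteq> terminus ?T a"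
    proof clarify
      fix l c assume "(l, c) \<in> arcs ?T" "orig ?T (l, c) = terminus ?T (l, c)"
      then show False by (cases l) (auto simp: colour_tree_simps split: if_splits)
    qed
    show "inj_on (\<lambda>a. (orig ?T a, terminus ?T a)) (arcs ?T)"
    proof (rule inj_onI, clarify)
      fix l c l' c' assume "orig ?T (l, c) = orig ?T (l', c')" "terminus ?T (l, c) = terminus ?T (l', c')"
      then show "l = l' \<and> c = c'"
        \<comment> \<open>Comparing lengths separates the arc to the parent from the arcs to
          children.\<close>
        by (cases l) (auto simp: colour_tree_simps split: if_splits dest: arg_cong[where f = length])
    qed
  qed
  show "[] \<in> verts ?T" by (simp add: colour_tree_simps)
  show "length [] = 0" "tl [] = []" by simp_all
  fix v assume v: "v \<in> verts ?T" "v \<noteq> []"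
  then obtain c l where cl: "v = c # l" by (cases v) auto
  then have a: "(l, c) \<in> arcs ?T" "terminus ?T (l, c) = v" using v by (auto simp: colour_tree_simps)
  show "(tl v, v) \<in> adjacency ?T" using adjacencyI[OF a(1)] a(2) cl by (simp add: colour_tree_simps)
  show "length v = Suc (length (tl v))" using cl by simp
next
  fix x y assume "(x, y) \<in> adjacency (colour_tree w)"
  then obtain a where a: "orig (colour_tree w) a = x" "terminus (colour_tree w) a = y"
    by (rule adjacencyE)
  obtain l c where "a = (l, c)" by (cases a)
  then have "y = terminus (colour_tree w) (x, c)" using a by (simp add: colour_tree_simps)
  then show "x \<noteq> [] \<and> y = tl x \<or> y \<noteq> [] \<and> x = tl y" by (auto simp: colour_tree_simps)
qed

lemma delta_tree_colour_tree:
  assumes w: "w \<in> verts \<Gamma>"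
  shows "delta_tree \<Delta> (colour_tree w) (end_vertex w) snd"
  unfolding delta_tree_def
proof (intro conjI ballI)
  show "tree (colour_tree w)" by (rule rooted_tree.is_tree[OF colour_tree_rooted])
  fix l assume "l \<in> verts (colour_tree w)"
  then have l: "reduced w l" by (simp add: colour_tree_simps)
  show "end_vertex w l \<in> verts \<Gamma>"
  proof (cases l)
    case (Cons c l')
    then show ?thesis
      using l wf_graphD(2)[OF wf_lad arc_of_colours_at(1)[of c "end_vertex w l'"]] by simp
  qed (simp add: w)
  have "arcs_from (colour_tree w) l = Pair l ` colours_at \<Delta> (end_vertex w l)"
    using l by (auto simp: arcs_from_def colour_tree_simps)
  then show "bij_betw snd (arcs_from (colour_tree w) l) (colours_at \<Delta> (end_vertex w l))"
    by (auto simp: bij_betw_def inj_on_def image_image)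
next
  fix a assume "a \<in> arcs (colour_tree w)"
  then obtain l c where a: "a = (l, c)" "reduced w l" "c \<in> colours_at \<Delta> (end_vertex w l)"
    by (cases a) (auto simp: colour_tree_simps)
  show "arc_of \<Delta> (snd (reversal (colour_tree w) a)) = reversal \<Gamma> (arc_of \<Delta> (snd a))"
  proof (cases "l \<noteq> [] \<and> c = back_colour (hd l)")
    case True
    then obtain d l' where l: "l = d # l'" "c = back_colour d" by (cases l) auto
    then have d: "d \<in> colours_at \<Delta> (end_vertex w l')" using a(2) by simp
    have "reversal \<Gamma> (arc_of \<Delta> c) = arc_of \<Delta> d"
      unfolding l(2) back_colour(2)[OF d] by (rule wf_graphD(4)[OF wf_lad arc_of_colours_at(1)[OF d]])
    then show ?thesis using True l by (simp add: a(1) colour_tree_simps)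
  next
    case False
    then show ?thesis using back_colour(2)[OF a(3)] by (auto simp: a(1) colour_tree_simps)
  qed
qed

end

section \<open>Copying a tree into the type of colours\<close>

lemma graph_iso_image:
  assumes wf: "wf_graph T" and e: "inj_on e (verts T)" and e': "inj_on e' (arcs T)"
  shows "graph_iso T \<lparr>verts = e ` verts T, arcs = e' ` arcs T,
    orig = e \<circ> orig T \<circ> inv_into (arcs T) e', reversal = e' \<circ> reversal T \<circ> inv_into (arcs T) e'\<rparr> e e'"
  using e e' by (simp add: graph_iso_def inj_on_imp_bij_betw)

text \<open>An infinite type has a pairing function \<open>p\<close>, and lists are encoded by
  folding it. The code \<open>enc\<close> is shown injective only among lists of equal length, so
  \<open>e\<close> stores the length too.\<close>

lemma inj_list_of_infinite:
  assumes "infinite (UNIV :: 'u set)"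
  shows "\<exists>(e :: 'u list \<Rightarrow> 'u) (e' :: 'u list \<times> 'u \<Rightarrow> 'u). inj e \<and> inj e'"
proof -
  obtain p :: "'u \<times> 'u \<Rightarrow> 'u" where "bij_betw p (UNIV \<times> UNIV) UNIV"
    using card_of_Times_same_infinite[OF assms] unfolding card_of_ordIso[symmetric] by (elim exE)
  then have "inj p" unfolding UNIV_Times_UNIV by (rule bij_betw_imp_inj_on)
  then have p: "p (a, b) = p (c, d) \<longleftrightarrow> a = c \<and> b = d" for a b c d
    by (simp add: inj_eq)
  obtain i :: "nat \<Rightarrow> 'u" where i: "inj i" using infinite_countable_subset[OF assms] by blast
  define enc where "enc = rec_list (i 0) (\<lambda>x _ y. p (x, y))"
  have enc: "enc (x # l) = p (x, enc l)" for x l by (simp add: enc_def)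
  have enc_inj: "length l = length l' \<Longrightarrow> enc l = enc l' \<Longrightarrow> l = l'" for l l'
    by (induction l l' rule: list_induct2) (simp_all add: enc p)
  define e where "e l = p (i (length l), enc l)" for l
  have "inj e"
    by (rule injI) (auto simp: e_def p inj_eq[OF i] intro: enc_inj)
  moreover then have "inj (\<lambda>(l, c). p (e l, c))" by (auto simp: inj_on_def p)
  ultimately show ?thesis by blast
qed

text \<open>The size of the colour tree is bounded by the colours alone: its vertices are lists of
  colours and its arcs such lists with one more colour. Hence a copy fits into \<open>'u\<close>,
  although the graph of \<open>\<Delta>\<close> may live in other types.\<close>

lemma realisation_exists:
  fixes \<Delta> :: "('w, 'f, 'u) lad"
  assumes D: "\<Delta> \<in> local_action_diagrams" and inf: "infinite (UNIV :: 'u set)"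
  shows "\<exists>(T :: ('u, 'u) graph) G. realises \<Delta> T G"
proof -
  interpret action_diagram \<Delta> by (rule action_diagram.intro[OF D])
  obtain w where w: "w \<in> verts \<Gamma>" using connected_lad by (auto simp: connected_graph_def)
  interpret labelled_tree \<Delta> "colour_tree w" "end_vertex w" snd
    by (rule labelled_treeI[OF D delta_tree_colour_tree[OF w]])
  obtain e :: "'u list \<Rightarrow> 'u" and e' :: "'u list \<times> 'u \<Rightarrow> 'u" where e: "inj e" "inj e'"
    using inj_list_of_infinite[OF inf] by blast
  from transport(1)[OF graph_iso_image[OF wf_T inj_on_subset[OF e(1) subset_UNIV] inj_on_subset[OF e(2) subset_UNIV]]]
  show ?thesis unfolding realises_def by blast
qed

section \<open>The correspondence\<close>

lemma realises_associated_lad: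
  assumes "(T, G) \<in> P_closed_actions" "orbit_representatives T G r"
  shows "associated_lad T G r \<in> local_action_diagrams" "realises (associated_lad T G r) T G"
proof -
  interpret P_closed_action_reps T G r
    using assms by unfold_locales
  show "associated_lad T G r \<in> local_action_diagrams" by (rule associated_lad_in)
  show "realises (associated_lad T G r) T G"
    unfolding realises_def using delta_tree_D G_eq_universal_group by blast
qed

lemma orbit_representatives_exist: "\<exists>r. orbit_representatives T G r"
proof -
  have "\<forall>w\<in>verts (quotient_graph T G). \<exists>v. v \<in> verts T \<and> vertex_orbit T G v = w"
    by (auto simp: quotient_graph_def)
  then show ?thesis unfolding orbit_representatives_def by (rule bchoice)
qed

lemma realising_lad_exists:
  assumes "(T, G) \<in> P_closed_actions"
  shows "\<exists>\<Delta>\<in>local_action_diagrams. realises (\<Delta> :: ('v set, 'e set, 'e) lad) (T :: ('v, 'e) graph) G"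
  using realises_associated_lad[OF assms] orbit_representatives_exist by blast

lemma conjugate_actions_iff:
  assumes "(T, G) \<in> P_closed_actions" "\<Delta> \<in> local_action_diagrams" "realises \<Delta> T G"
  shows "conjugate_actions (T, G) (T', G') \<longleftrightarrow> realises \<Delta> T' G'"
  using realises_conjugate[OF assms(2,3)] realises_conjugation[OF assms(2,3)] by blast

text \<open>Diagrams have graphs over \<open>'u set\<close> because vertices and arcs of a quotient
  graph are orbits. Quantifying over all \<open>r\<close> makes independence of the orbit
  representatives part of the claim.\<close>

theorem theorem1p2:
  assumes "infinite (UNIV :: 'u set)"
  shows "equiv P_closed_actions (conjugacy ::
           ((('u, 'u) graph \<times> ('u \<Rightarrow> 'u) set) \<times> (('u, 'u) graph \<times> ('u \<Rightarrow> 'u) set)) set) \<and>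
         equiv local_action_diagrams (lad_isomorphism ::
           (('u set, 'u set, 'u) lad \<times> ('u set, 'u set, 'u) lad) set) \<and>
         (\<exists>\<Phi> :: (('u, 'u) graph \<times> ('u \<Rightarrow> 'u) set) set \<Rightarrow> ('u set, 'u set, 'u) lad set.
           (\<forall>(T, G)\<in>P_closed_actions. \<forall>r. orbit_representatives T G r \<longrightarrow>
              associated_lad T G r \<in> local_action_diagrams \<and>
              \<Phi> (conjugacy `` {(T, G)}) = lad_isomorphism `` {associated_lad T G r}) \<and>
           bij_betw \<Phi> (P_closed_actions // conjugacy) (local_action_diagrams // lad_isomorphism))"
proof -
  let ?P = "P_closed_actions :: (('u, 'u) graph \<times> ('u \<Rightarrow> 'u) set) set"
  let ?A = "local_action_diagrams :: ('u set, 'u set, 'u) lad set"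
  define R where "R p \<Delta> \<longleftrightarrow> realises \<Delta> (fst p) (snd p)"
    for p :: "('u, 'u) graph \<times> ('u \<Rightarrow> 'u) set" and \<Delta> :: "('u set, 'u set, 'u) lad"
  \<comment> \<open>The equivalences and the bijection follow formally from the next four facts
    about \<open>R\<close>: each side has a partner on the other, and the partners of an object form
    one class.\<close>
  have total: "\<exists>\<Delta>\<in>?A. R p \<Delta>" if "p \<in> ?P" for p
    using realising_lad_exists[of "fst p" "snd p"] that by (simp add: R_def)
  have surj: "\<exists>p\<in>?P. R p \<Delta>" if D: "\<Delta> \<in> ?A" for \<Delta>
    using realisation_exists[OF D assms] realises_P_closed[OF D] by (force simp: R_def)
  have conj: "conjugate_actions p q \<longleftrightarrow> R q \<Delta>" if "p \<in> ?P" "\<Delta> \<in> ?A" "R p \<Delta>" for p q \<Delta>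
    using conjugate_actions_iff[of "fst p" "snd p" \<Delta> "fst q" "snd q"] that by (simp add: R_def)
  have iso: "isomorphic_lads \<Delta> \<Delta>' \<longleftrightarrow> R p \<Delta>'" if "\<Delta> \<in> ?A" "\<Delta>' \<in> ?A" "R p \<Delta>" for p \<Delta> \<Delta>'
    using realises_unique[OF that(1,2)] realises_isomorphic_lads[OF that(1,2)] that(3)
    unfolding R_def by blast
  \<comment> \<open>Being conjugate means sharing a diagram. In this form symmetry is evident, and
    likewise for diagrams that share an action.\<close>
  have conj_iff: "(p, q) \<in> conjugacy \<longleftrightarrow> p \<in> ?P \<and> q \<in> ?P \<and> (\<exists>\<Delta>\<in>?A. R p \<Delta> \<and> R q \<Delta>)" for p q
    unfolding conjugacy_def using total conj by blast
  have iso_iff: "(\<Delta>, \<Delta>') \<in> lad_isomorphism \<longleftrightarrow> \<Delta> \<in> ?A \<and> \<Delta>' \<in> ?A \<and> (\<exists>p\<in>?P. R p \<Delta> \<and> R p \<Delta>')"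
    for \<Delta> \<Delta>'
    unfolding lad_isomorphism_def using surj iso by blast
  have equiv_P: "equiv ?P conjugacy"
  proof (rule equivI)
    show "conjugacy \<subseteq> ?P \<times> ?P" using conj_iff by auto
    show "refl_on ?P conjugacy" using conj_iff total by (auto simp: refl_on_def)
    show "sym (conjugacy :: ((('u, 'u) graph \<times> ('u \<Rightarrow> 'u) set) \<times> (('u, 'u) graph \<times> ('u \<Rightarrow> 'u) set)) set)"
      by (rule symI) (use conj_iff in blast)
    show "trans (conjugacy :: ((('u, 'u) graph \<times> ('u \<Rightarrow> 'u) set) \<times> (('u, 'u) graph \<times> ('u \<Rightarrow> 'u) set)) set)"
    proof (rule transI)
      fix p q s :: "('u, 'u) graph \<times> ('u \<Rightarrow> 'u) set"
      assume 1: "(p, q) \<in> conjugacy" and 2: "(q, s) \<in> conjugacy"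
      obtain \<Delta> where D: "\<Delta> \<in> ?A" "R p \<Delta>" "R q \<Delta>" using 1 conj_iff by blast
      have V: "p \<in> ?P" "q \<in> ?P" "s \<in> ?P" "conjugate_actions q s"
        using 1 2 by (auto simp: conjugacy_def)
      have "R s \<Delta>" using conj[OF V(2) D(1,3)] V(4) by blast
      then show "(p, s) \<in> conjugacy" using conj_iff V D by blast
    qed
  qed
  have equiv_A: "equiv ?A lad_isomorphism"
  proof (rule equivI)
    show "lad_isomorphism \<subseteq> ?A \<times> ?A" using iso_iff by auto
    show "refl_on ?A lad_isomorphism" using iso_iff surj by (auto simp: refl_on_def)
    show "sym (lad_isomorphism :: (('u set, 'u set, 'u) lad \<times> ('u set, 'u set, 'u) lad) set)"
      by (rule symI) (use iso_iff in blast)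
    show "trans (lad_isomorphism :: (('u set, 'u set, 'u) lad \<times> ('u set, 'u set, 'u) lad) set)"
    proof (rule transI)
      fix p q s :: "('u set, 'u set, 'u) lad"
      assume 1: "(p, q) \<in> lad_isomorphism" and 2: "(q, s) \<in> lad_isomorphism"
      obtain x where x: "x \<in> ?P" "R x p" "R x q" using 1 iso_iff by blast
      have V: "p \<in> ?A" "q \<in> ?A" "s \<in> ?A" "isomorphic_lads q s"
        using 1 2 by (auto simp: lad_isomorphism_def)
      have "R x s" using iso[OF V(2,3) x(3)] V(4) by blast
      then show "(p, s) \<in> lad_isomorphism" using iso_iff V x by blast
    qed
  qed
  \<comment> \<open>The image of a class under \<open>R\<close>, formed without choosing a member of
    the class or orbit representatives; that it is one isomorphism class is shown next.\<close>
  define \<Phi> where "\<Phi> C = {\<Delta> \<in> ?A. \<exists>p\<in>C. R p \<Delta>}" for C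
  have \<Phi>: "\<Phi> (conjugacy `` {p}) = lad_isomorphism `` {\<Delta>}" if p: "p \<in> ?P" and D: "\<Delta> \<in> ?A" "R p \<Delta>" for p \<Delta>
  proof -
    have "(\<exists>q. (p, q) \<in> conjugacy \<and> R q \<Delta>') \<longleftrightarrow> (\<Delta>, \<Delta>') \<in> lad_isomorphism" if D': "\<Delta>' \<in> ?A" for \<Delta>'
    proof
      assume "\<exists>q. (p, q) \<in> conjugacy \<and> R q \<Delta>'"
      then obtain q where q: "(p, q) \<in> conjugacy" "R q \<Delta>'" by blast
      then have "q \<in> ?P" "R q \<Delta>" using conj[OF p D] by (auto simp: conjugacy_def)
      then show "(\<Delta>, \<Delta>') \<in> lad_isomorphism" using iso_iff D(1) D' q(2) by blast
    next
      assume "(\<Delta>, \<Delta>') \<in> lad_isomorphism"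
      then have "R p \<Delta>'" using iso[OF D(1) D' D(2)] by (simp add: lad_isomorphism_def)
      moreover have "(p, p) \<in> conjugacy" using conj_iff p D by blast
      ultimately show "\<exists>q. (p, q) \<in> conjugacy \<and> R q \<Delta>'" by blast
    qed
    moreover have "\<Delta>' \<in> ?A" if "(\<Delta>, \<Delta>') \<in> lad_isomorphism" for \<Delta>' using that iso_iff by blast
    ultimately show ?thesis unfolding \<Phi>_def by blast
  qed
  have "bij_betw \<Phi> (?P // conjugacy) (?A // lad_isomorphism)"
    unfolding bij_betw_def
  proof
    show "inj_on \<Phi> (?P // conjugacy)"
    proof (rule inj_onI)
      fix C C' assume C: "C \<in> ?P // conjugacy" "C' \<in> ?P // conjugacy" and eq: "\<Phi> C = \<Phi> C'"
      obtain p where p: "p \<in> ?P" "C = conjugacy `` {p}" using C(1) by (rule quotientE)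
      obtain q where q: "q \<in> ?P" "C' = conjugacy `` {q}" using C(2) by (rule quotientE)
      obtain \<Delta> where D: "\<Delta> \<in> ?A" "R p \<Delta>" using total[OF p(1)] by blast
      \<comment> \<open>A diagram of \<open>p\<close> lies in the common image, so it is also
        realised by some \<open>s\<close> in the other class, and \<open>s\<close> is then conjugate
        to \<open>p\<close>.\<close>
      have "\<Delta> \<in> \<Phi> C" unfolding p(2) \<Phi>[OF p(1) D] using equiv_class_self[OF equiv_A D(1)] .
      then have "\<Delta> \<in> \<Phi> C'" unfolding eq .
      then obtain s where s: "s \<in> C'" "R s \<Delta>" unfolding \<Phi>_def by blast
      have qs: "(q, s) \<in> conjugacy" using q(2) s(1) by simp
      then have "s \<in> ?P" using conj_iff by blast
      then have "(p, s) \<in> conjugacy" using conj_iff p(1) D s(2) by blast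
      then show "C = C'" unfolding p(2) q(2)
        using equiv_class_eq[OF equiv_P qs] equiv_class_eq[OF equiv_P] by metis
    qed
    show "\<Phi> ` (?P // conjugacy) = ?A // lad_isomorphism"
    proof (intro equalityI subsetI)
      fix X assume "X \<in> \<Phi> ` (?P // conjugacy)"
      then obtain p where p: "p \<in> ?P" "X = \<Phi> (conjugacy `` {p})" by (auto elim!: quotientE)
      obtain \<Delta> where D: "\<Delta> \<in> ?A" "R p \<Delta>" using total[OF p(1)] by blast
      show "X \<in> ?A // lad_isomorphism" unfolding p(2) \<Phi>[OF p(1) D] by (rule quotientI[OF D(1)])
    next
      fix X assume "X \<in> ?A // lad_isomorphism"
      then obtain \<Delta> where D: "\<Delta> \<in> ?A" "X = lad_isomorphism `` {\<Delta>}" by (rule quotientE)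
      obtain p where p: "p \<in> ?P" "R p \<Delta>" using surj[OF D(1)] by blast
      have "X = \<Phi> (conjugacy `` {p})" unfolding D(2) \<Phi>[OF p(1) D(1) p(2)] ..
      then show "X \<in> \<Phi> ` (?P // conjugacy)" using quotientI[OF p(1)] by blast
    qed
  qed
  moreover have "\<forall>(T, G)\<in>?P. \<forall>r. orbit_representatives T G r \<longrightarrow> associated_lad T G r \<in> ?A \<and>
      \<Phi> (conjugacy `` {(T, G)}) = lad_isomorphism `` {associated_lad T G r}"
  proof (clarify)
    fix T :: "('u, 'u) graph" and G r assume TG: "(T, G) \<in> ?P" and r: "orbit_representatives T G r"
    note D = realises_associated_lad[OF TG r]
    show "associated_lad T G r \<in> ?A \<and> \<Phi> (conjugacy `` {(T, G)}) = lad_isomorphism `` {associated_lad T G r}"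
      using D \<Phi>[OF TG D(1)] by (simp add: R_def)
  qed
  ultimately show ?thesis using equiv_P equiv_A by blast
qed

end
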